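(* Let $k,l,m$ be integers with $k\le l$. The coefficients (rational functions of $a,b,c,q,x$) of the three term relation $$\phi(aq^{k},bq^{l};cq^{m};q,x)=Q\cdot\phi(aq,bq;cq;q,x)+R\cdot\phi(a,b;c;q,x)$$ can be expressed as $$Q=Q(k,l,m)=-\frac{(1-a)(1-b)c}{(q-c)(1-c)}\,\frac{x^{1-\max\{m,0\}}}{(abqx/c)_{\max\{k+l-m,0\}-1}}\,P_{k,l,m}(a,b,c;x),$$ $$R=R(k,l,m)=-\frac{x^{-\max\{m-1,0\}}}{(abqx/c)_{\max\{k+l-m-1,0\}}}\,P_{k-1,l-1,m-1}(aq,bq,cq;x),$$ where $P_{k,l,m}(a,b,c;x)$ is the polynomial in $x$ defined in the context.
   Context: Here $q$ is a complex number with $0<|q|<1$, and $a,b,c$ are nonzero complex parameters satisfying E1: $c,\ a/b\notin q^{\mathbb{Z}}$ and E2: $a,\ b,\ c/a,\ c/b\notin q^{\mathbb{Z}}$. Put $(u)_\infty=\prod_{n\ge 0}(1-uq^n)$ and $(u)_n=(u)_\infty/(uq^n)_\infty$ for $n\in\mathbb{Z}$; i.e. $(u)_n=\prod_{j=0}^{n-1}(1-uq^j)$ for $n\ge0$ and $(u)_{-n}=\prod_{j=1}^{n}(1-uq^{-j})^{-1}$ for $n>0$. Define $$\phi(a,b;c;q,x)=\sum_{n\ge0}\frac{(a)_n(b)_n}{(q)_n(c)_n}x^n,\qquad {}_4\phi_3(a_0,a_1,a_2,a_3;b_1,b_2,b_3;q,z)=\sum_{i\ge0}\frac{(a_0)_i(a_1)_i(a_2)_i(a_3)_i}{(q)_i(b_1)_i(b_2)_i(b_3)_i}z^i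 .$$ Rational functions of $a,b,c,q,x$ are elements of $\mathbb{Q}(a,b,c,q,x)$; the relation is an identity for $|x|<1$ wherever both sides are defined. (The pair $(Q,R)$ of such rational functions is uniquely determined by $(k,l,m)$.) For integers $k\le l$ and $m$, the polynomial $P_{k,l,m}(a,b,c;x)$ is $$P_{k,l,m}(a,b,c;x)=\begin{cases}\sum_{n=0}^{l-1}(A_n-B_{n-m})x^n & (m\ge0,\ k+l-m\ge0),\\ \sum_{n=0}^{m-k-1}(\tilde A_n-\tilde B_{n-m})x^n & (m\ge0,\ k+l-m<0),\\ \sum_{n=0}^{l-m-1}(A_{n+m}-B_n)x^n & (m<0,\ k+l-m\ge0),\\ \sum_{n=0}^{-k-1}(\tilde A_{n+m}-\tilde B_n)x^n & (m<0,\ k+l-m<0),\end{cases}$$ where $A_n=B_n=\tilde A_n=\tilde B_n=0$ for $n<0$, and for $n\ge0$ (all depending on $k,l,m,a,b,c,q$) $$A_n=\frac{-c\,(aq/c)_{k-m}(bq/c)_{l-m}}{(q^2/c)_{-m-1}}\,\frac{(c)_{m-n-1}}{(q^{-n})_n(a)_{k-n}(b)_{l-n}}\,q^{m-n-1}\;{}_4\phi_3\!\left(q^{-n},cq^{m-n-1},a,b;\,c,aq^{k-n},bq^{l-n};\,q,q\right),$$ $$B_n=\frac{(aq/c)_n(bq/c)_n}{(q)_n(q^2/c)_n}\;{}_4\phi_3\!\left(q^{-n},cq^{-n-1},cq^{m-k}/a,cq^{m-l}/b;\,cq^m,cq^{-n}/a,cq^{-n}/b;\,q,q^{k+l-m+1}\right),$$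 $$\tilde A_n=\frac{(c)_m}{(a)_k(b)_l}\,\frac{(aq/c)_{n+k-m}(bq/c)_{n+l-m}}{(q)_n(q^2/c)_{n-m}}\;{}_4\phi_3\!\left(q^{-n},cq^{m-n-1},c/a,c/b;\,c,cq^{m-k-n}/a,cq^{m-l-n}/b;\,q,q^{m-k-l+1}\right),$$ $$\tilde B_n=\frac{(aq^{-n})_n(bq^{-n})_n}{(q^{-n})_n(cq^{-n-1})_n}\,q^{-n}\;{}_4\phi_3\!\left(q^{-n},cq^{-n-1},aq^k,bq^l;\,cq^m,aq^{-n},bq^{-n};\,q,q\right).$$ An empty sum is $0$. $P_{k-1,l-1,m-1}(aq,bq,cq;x)$ means: replace $(k,l,m)$ by $(k-1,l-1,m-1)$ and $(a,b,c)$ by $(aq,bq,cq)$ throughout (including in the case distinction). *)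

theory Defs
  imports
    "HOL-Analysis.Analysis"
    "HOL-Computational_Algebra.Computational_Algebra"
begin

section \<open>Basic hypergeometric series\<close>

text \<open>
  The $q$-shifted factorial $(u)_n$ for an arbitrary integer $n$. The finite products are used instead
  of $(u)_\infty / (u q^n)_\infty$ because they also make sense when $u$ is a power of $q$
  and the quotient of infinite products is $0/0$, as for $(q^{-n})_n$.
\<close>

definition qpoch :: "complex \<Rightarrow> complex \<Rightarrow> int \<Rightarrow> complex" where
  "qpoch u q n =
     (if n \<ge> 0 then \<Prod>j<nat n. 1 - u * q ^ j
      else \<Prod>j=1..nat (- n). inverse (1 - u * q powi (- int j)))"

definition phi21 :: "complex \<Rightarrow> complex \<Rightarrow> complex \<Rightarrow> complex \<Rightarrow> complex \<Rightarrow> complex" where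
  "phi21 a b c q x =
     (\<Sum>n. qpoch a q (int n) * qpoch b q (int n) / (qpoch q q (int n) * qpoch c q (int n)) * x ^ n)"

definition phi43 ::
  "complex \<Rightarrow> complex \<Rightarrow> complex \<Rightarrow> complex \<Rightarrow> complex \<Rightarrow> complex \<Rightarrow> complex \<Rightarrow> complex \<Rightarrow> complex \<Rightarrow> complex" where
  "phi43 a0 a1 a2 a3 b1 b2 b3 q z =
     (\<Sum>i. qpoch a0 q (int i) * qpoch a1 q (int i) * qpoch a2 q (int i) * qpoch a3 q (int i) /
           (qpoch q q (int i) * qpoch b1 q (int i) * qpoch b2 q (int i) * qpoch b3 q (int i)) * z ^ i)"

definition int_powers :: "complex \<Rightarrow> complex set" where
  "int_powers q = range (\<lambda>n::int. q powi n)"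

definition admissible :: "complex \<Rightarrow> complex \<Rightarrow> complex \<Rightarrow> complex \<Rightarrow> bool" where
  "admissible a b c q \<longleftrightarrow>
     0 < norm q \<and> norm q < 1 \<and> a \<noteq> 0 \<and> b \<noteq> 0 \<and> c \<noteq> 0 \<and>
     c \<notin> int_powers q \<and> a / b \<notin> int_powers q \<and>
     a \<notin> int_powers q \<and> b \<notin> int_powers q \<and> c / a \<notin> int_powers q \<and> c / b \<notin> int_powers q"


section \<open>The polynomials $P_{k,l,m}$\<close>

text \<open>
  The index \<open>n\<close> of the four coefficient sequences is an integer since they are needed
  at shifted indices; all of them vanish for \<open>n < 0\<close>.
\<close>

definition coeff_A ::
  "int \<Rightarrow> int \<Rightarrow> int \<Rightarrow> complex \<Rightarrow> complex \<Rightarrow> complex \<Rightarrow> complex \<Rightarrow> int \<Rightarrow> complex" where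
  "coeff_A k l m a b c q n =
     (if n < 0 then 0 else
        (- c * qpoch (a * q / c) q (k - m) * qpoch (b * q / c) q (l - m) / qpoch (q\<^sup>2 / c) q (- m - 1)) *
        (qpoch c q (m - n - 1) / (qpoch (q powi (- n)) q n * qpoch a q (k - n) * qpoch b q (l - n))) *
        q powi (m - n - 1) *
        phi43 (q powi (- n)) (c * q powi (m - n - 1)) a b
              c (a * q powi (k - n)) (b * q powi (l - n)) q q)"

definition coeff_B ::
  "int \<Rightarrow> int \<Rightarrow> int \<Rightarrow> complex \<Rightarrow> complex \<Rightarrow> complex \<Rightarrow> complex \<Rightarrow> int \<Rightarrow> complex" where
  "coeff_B k l m a b c q n =
     (if n < 0 then 0 else
        (qpoch (a * q / c) q n * qpoch (b * q / c) q n / (qpoch q q n * qpoch (q\<^sup>2 / c) q n)) *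
        phi43 (q powi (- n)) (c * q powi (- n - 1)) (c * q powi (m - k) / a) (c * q powi (m - l) / b)
              (c * q powi m) (c * q powi (- n) / a) (c * q powi (- n) / b)
              q (q powi (k + l - m + 1)))"

definition coeff_At ::
  "int \<Rightarrow> int \<Rightarrow> int \<Rightarrow> complex \<Rightarrow> complex \<Rightarrow> complex \<Rightarrow> complex \<Rightarrow> int \<Rightarrow> complex" where
  "coeff_At k l m a b c q n =
     (if n < 0 then 0 else
        (qpoch c q m / (qpoch a q k * qpoch b q l)) *
        (qpoch (a * q / c) q (n + k - m) * qpoch (b * q / c) q (n + l - m) /
           (qpoch q q n * qpoch (q\<^sup>2 / c) q (n - m))) *
        phi43 (q powi (- n)) (c * q powi (m - n - 1)) (c / a) (c / b)
              c (c * q powi (m - k - n) / a) (c * q powi (m - l - n) / b)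
              q (q powi (m - k - l + 1)))"

definition coeff_Bt ::
  "int \<Rightarrow> int \<Rightarrow> int \<Rightarrow> complex \<Rightarrow> complex \<Rightarrow> complex \<Rightarrow> complex \<Rightarrow> int \<Rightarrow> complex" where
  "coeff_Bt k l m a b c q n =
     (if n < 0 then 0 else
        (qpoch (a * q powi (- n)) q n * qpoch (b * q powi (- n)) q n /
           (qpoch (q powi (- n)) q n * qpoch (c * q powi (- n - 1)) q n)) *
        q powi (- n) *
        phi43 (q powi (- n)) (c * q powi (- n - 1)) (a * q powi k) (b * q powi l)
              (c * q powi m) (a * q powi (- n)) (b * q powi (- n)) q q)"

definition P_poly ::
  "int \<Rightarrow> int \<Rightarrow> int \<Rightarrow> complex \<Rightarrow> complex \<Rightarrow> complex \<Rightarrow> complex \<Rightarrow> complex poly" where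
  "P_poly k l m a b c q =
     (if m \<ge> 0 then
        if k + l - m \<ge> 0 then
          \<Sum>n<nat l. monom (coeff_A k l m a b c q (int n) - coeff_B k l m a b c q (int n - m)) n
        else
          \<Sum>n<nat (m - k). monom (coeff_At k l m a b c q (int n) - coeff_Bt k l m a b c q (int n - m)) n
      else
        if k + l - m \<ge> 0 then
          \<Sum>n<nat (l - m). monom (coeff_A k l m a b c q (int n + m) - coeff_B k l m a b c q (int n)) n
        else
          \<Sum>n<nat (- k). monom (coeff_At k l m a b c q (int n + m) - coeff_Bt k l m a b c q (int n)) n)"


section \<open>Rational functions in $\mathbb{Q}(a,b,c,q,x)$\<close>

text \<open>
  The polynomial ring in the five indeterminates $a,b,c,q,x$ is rendered as an iterated univariate
  polynomial ring, the innermost variable being $a$ and the outermost one $x$.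
\<close>

type_synonym poly5 = "rat poly poly poly poly poly"
type_synonym ratfun5 = "poly5 fract"

definition eval_via :: "('r::zero \<Rightarrow> complex) \<Rightarrow> complex \<Rightarrow> 'r poly \<Rightarrow> complex" where
  "eval_via h y p = poly (map_poly h p) y"

definition eval5 :: "poly5 \<Rightarrow> complex \<Rightarrow> complex \<Rightarrow> complex \<Rightarrow> complex \<Rightarrow> complex \<Rightarrow> complex" where
  "eval5 p a b c q x = eval_via (eval_via (eval_via (eval_via (eval_via of_rat a) b) c) q) x p"

text \<open>
  \<open>has_value F a b c q x v\<close>: the rational function \<open>F\<close> is defined at the given point, that is, some
  representation of it as a fraction has a denominator not vanishing there, and its value is \<open>v\<close>.
\<close>

definition has_value ::
  "ratfun5 \<Rightarrow> complex \<Rightarrow> complex \<Rightarrow> complex \<Rightarrow> complex \<Rightarrow> complex \<Rightarrow> complex \<Rightarrow> bool" where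
  "has_value F a b c q x v \<longleftrightarrow>
     (\<exists>N D. F = Fract N D \<and> eval5 D a b c q x \<noteq> 0 \<and> v = eval5 N a b c q x / eval5 D a b c q x)"

definition three_term_coeffs :: "int \<Rightarrow> int \<Rightarrow> int \<Rightarrow> ratfun5 \<Rightarrow> ratfun5 \<Rightarrow> bool" where
  "three_term_coeffs k l m Q R \<longleftrightarrow>
     (\<forall>a b c q x u v. admissible a b c q \<and> norm x < 1 \<and>
        has_value Q a b c q x u \<and> has_value R a b c q x v \<longrightarrow>
        phi21 (a * q powi k) (b * q powi l) (c * q powi m) q x =
          u * phi21 (a * q) (b * q) (c * q) q x + v * phi21 a b c q x)"

end

theory Submission
  imports Defs
begin

text \<open>
  The proof is Cramer's rule. Besides $f_{klm}(x) = \phi(aq^k, bq^l; cq^m; q, x)$ there is a second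
  solution at the origin, $x^{-m} g_{klm}(x)$ with
  $g_{klm}(x) = \phi(aq^{k-m+1}/c, bq^{l-m+1}/c; q^{2-m}/c; q, x)$ (the factor $x^{1 - \log_q c}$
  common to all shifts is dropped). After multiplication by suitable constants both families satisfy the
  same contiguous relations, so the unknown $Q$ and $R$ are quotients of $2 \times 2$ determinants of the two
  families. As an identity between such determinants the three term relation is trivial; what has to be
  proved is that the quotients are the stated rational functions. The determinants are formed with formal
  (Laurent) power series, and analysis enters only when the final identity is evaluated at a point of the unit disc.

  The determinant of the shifts $(0,0,0)$ and $(-1,-1,-1)$ solves a first order q-difference equation and is
  the infinite product $-(abx/c)_\infty / (x)_\infty$ (\<open>qhyp_casoratian\<close>, \<open>casoratian_minus_one\<close>). In the
  determinant of $(k,l,m)$ and $(0,0,0)$ the Heine-Euler transformation (\<open>heine_euler_transformation\<close>) splits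
  off the same kind of product. Two products of power series remain, whose coefficients are
  the four sequences $A_n$, $B_n$, $\tilde A_n$, $\tilde B_n$: reversing one factor of the Cauchy product turns it into
  a terminating ${}_4\phi_3$ (\<open>hyp_mult_nth\<close>).

  It remains to see that this difference of two infinite series is a Laurent polynomial of the stated degree.
  That it is one follows from contiguity alone: in \<open>contiguous_reduction\<close> every shift is expressed by the shifts
  $(0,0,0)$ and $(-1,-1,-1)$ with Laurent polynomial coefficients and the denominator
  $(abx/c)_{\max(k+l-m,0)}$. Since the coefficients are the same for all solutions of the contiguous relations, they
  can be tested on the two solutions at infinity, whose exponents bound the degree
  (\<open>casoratian_quotient_vanishes\<close>). Replacing $(a,b,c)$ by $(aq,bq,cq)$ gives $R$ from the same result, since the determinant
  of $(k,l,m)$ and $(1,1,1)$ is the one of $(k-1,l-1,m-1)$ and $(0,0,0)$ for the new parameters; this yields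
  \<open>three_term_fps\<close> and, at points, \<open>three_term_Q_R\<close>.

  For uniqueness it has to be shown that $\phi(aq,bq;cq)$ and $\phi(a,b;c)$ are independent over the rational
  functions (\<open>basic_functions_independent\<close>). For $a = q^{-N}$ they are coprime polynomials in $x$, and $\phi(a,b;c)$
  has degree $N$; a relation whose coefficients have bounded degree in $x$ must therefore vanish for all large $N$.
\<close>

unbundle no vec_syntax
unbundle fps_syntax

section \<open>Shifted factorials with integer index\<close>

text \<open>
  Non-resonance: no factor of any \<^const>\<open>qpoch\<close> with base \<open>u\<close> vanishes. The hypotheses that certain quotients are not powers of \<open>q\<close> enter in this form.
\<close>

definition nonres :: "complex \<Rightarrow> complex \<Rightarrow> bool" where
  "nonres q u \<longleftrightarrow> (\<forall>j::int. u * q powi j \<noteq> 1)"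

lemma nonresD: "nonres q u \<Longrightarrow> u * q powi j \<noteq> 1"
  by (auto simp: nonres_def)

lemma nonres_shift:
  assumes "q \<noteq> 0" "nonres q w" "u = w * q powi i"
  shows "nonres q u"
  using assms by (auto simp: nonres_def mult.assoc simp flip: power_int_add)

lemma nonres_inverse:
  assumes "q \<noteq> 0" "w \<noteq> 0" "nonres q w" "u = q powi i / w"
  shows "nonres q u"
  unfolding nonres_def
proof
  fix j
  show "u * q powi j \<noteq> 1"
  proof
    assume "u * q powi j = 1"
    hence "q powi (i + j) = w" using assms by (simp add: power_int_add field_simps)
    moreover have "q powi (i + j) * q powi (- (i + j)) = 1"
      using assms(1) by (simp only: power_int_minus) simp
    ultimately have "w * q powi (- (i + j)) = 1" by simp
    with nonresD[OF assms(3)] show False by blast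
  qed
qed

lemma not_root_of_unity:
  fixes q :: complex
  assumes "0 < norm q" "norm q < 1" "q powi j = 1"
  shows "j = 0"
proof (rule ccontr)
  assume "j \<noteq> 0"
  have "norm q powi j = 1" using assms(3) by (metis norm_one norm_power_int)
  have *: "norm q ^ nat \<bar>j\<bar> < 1"
    using assms \<open>j \<noteq> 0\<close> by (intro power_less_one_iff[THEN iffD2]) auto
  show False
  proof (cases "j \<ge> 0")
    case True
    thus False using * \<open>norm q powi j = 1\<close> by (simp add: power_int_def)
  next
    case False
    thus False using * \<open>norm q powi j = 1\<close> by (simp add: power_int_def field_simps power_inverse)
  qed
qed

lemma qpoch_0 [simp]: "qpoch u q 0 = 1"
  by (simp add: qpoch_def)

lemma qpoch_Suc: "qpoch u q (1 + int n) = qpoch u q (int n) * (1 - u * q ^ n)"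
proof -
  have "nat (1 + int n) = Suc n" by simp
  thus ?thesis by (simp add: qpoch_def)
qed

lemma qpoch_neg: "qpoch u q (- int n) = (\<Prod>j=1..n. inverse (1 - u * q powi (- int j)))"
  by (cases "n = 0") (auto simp: qpoch_def)

lemma qpoch_neg_Suc:
  "qpoch u q (- 1 - int n) = qpoch u q (- int n) * inverse (1 - u * q powi (- 1 - int n))"
proof -
  have e: "- 1 - int n = - int (Suc n)" by simp
  show ?thesis unfolding e qpoch_neg by (simp add: prod.nat_ivl_Suc')
qed

lemma qpoch_step:
  assumes "j < 0 \<longrightarrow> u * q powi j \<noteq> 1"
  shows "qpoch u q (j + 1) = (1 - u * q powi j) * qpoch u q j"
proof (cases "j \<ge> 0")
  case True
  then obtain n where "j = int n" using nonneg_int_cases by blast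
  thus ?thesis using qpoch_Suc[of u q n] by (simp add: add.commute)
next
  case False
  define n where "n = nat (- 1 - j)"
  have j: "j = - 1 - int n" using False by (simp add: n_def)
  hence j1: "j + 1 = - int n" by simp
  have "1 - u * q powi j \<noteq> 0" using assms False by auto
  thus ?thesis
    using qpoch_neg_Suc[of u q n] unfolding j1 j[symmetric] by (simp add: field_simps)
qed

text \<open>
  The reciprocals satisfy the recurrence through a pole as well: there \<open>inverse 0 = 0\<close> makes both sides vanish.
  This is how one-sided series arise below from coefficients that are defined for all integers.
\<close>

lemma inverse_qpoch_step:
  assumes "u * q powi j = 1 \<longrightarrow> j < 0"
  shows "inverse (qpoch u q j) = (1 - u * q powi j) * inverse (qpoch u q (j + 1))"
proof (cases "u * q powi j = 1")
  case False
  hence "1 - u * q powi j \<noteq> 0" by simp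
  thus ?thesis using qpoch_step[of j u q] False by simp
next
  case True
  define n where "n = nat (- 1 - j)"
  have "j < 0" using assms True by simp
  hence j: "j = - 1 - int n" by (simp add: n_def)
  show ?thesis using qpoch_neg_Suc[of u q n] True j by simp
qed

lemma qpoch_neq_0:
  assumes "\<And>i. 0 \<le> i \<Longrightarrow> i < n \<Longrightarrow> u * q powi i \<noteq> 1" "\<And>i. n \<le> i \<Longrightarrow> i < 0 \<Longrightarrow> u * q powi i \<noteq> 1"
  shows "qpoch u q n \<noteq> 0"
proof (cases "n \<ge> 0")
  case True
  have "u * q ^ j \<noteq> 1" if "j < nat n" for j
    using assms(1)[of "int j"] that by simp
  thus ?thesis using True by (auto simp: qpoch_def)
next
  case False
  have "u * q powi (- int j) \<noteq> 1" if "j \<in> {1..nat (- n)}" for j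
  proof (rule assms(2))
    show "n \<le> - int j" "- int j < 0" using that False by auto
  qed
  thus ?thesis using False by (auto simp: qpoch_def)
qed

lemma qpoch_nonres: "nonres q u \<Longrightarrow> qpoch u q n \<noteq> 0"
  by (rule qpoch_neq_0) (auto dest: nonresD)

lemma qpoch_q_neq_0:
  assumes "0 < norm q" "norm q < 1"
  shows "qpoch q q (int n) \<noteq> 0"
proof (rule qpoch_neq_0)
  fix i :: int assume "0 \<le> i" "i < int n"
  have "q * q powi i = q powi (1 + i)" using assms by (subst power_int_add) auto
  thus "q * q powi i \<noteq> 1" using not_root_of_unity[OF assms, of "1 + i"] \<open>0 \<le> i\<close> by auto
qed auto

lemma qpoch_q_neg:
  assumes "q \<noteq> 0" "n < 0"
  shows "qpoch q q n = 0"
proof -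
  have "\<exists>j\<in>{1..nat (- n)}. inverse (1 - q * q powi (- int j)) = 0"
    using assms by (intro bexI[of _ 1]) auto
  thus ?thesis using assms by (auto simp: qpoch_def intro!: prod_zero)
qed

lemma qpoch_add:
  assumes "q \<noteq> 0" "nonres q u"
  shows "qpoch u q (m + n) = qpoch u q m * qpoch (u * q powi m) q n"
proof -
  have nz: "nonres q (u * q powi m)" using nonres_shift[OF assms] by blast
  have st: "qpoch u q (j + 1) = (1 - u * q powi j) * qpoch u q j" for j
    using qpoch_step nonresD[OF assms(2)] by blast
  have st': "qpoch (u * q powi m) q (j + 1) = (1 - u * q powi (m + j)) * qpoch (u * q powi m) q j" for j
    using qpoch_step[of j "u * q powi m" q] nonresD[OF nz, of j] assms(1) by (simp add: power_int_add mult.assoc)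
  show ?thesis
  proof (induction n rule: int_induct[where k = 0])
    case base
    show ?case by simp
  next
    case (step1 i)
    thus ?case using st[of "m + i"] st'[of i] by (simp add: add.assoc)
  next
    case (step2 i)
    have "1 - u * q powi (m + (i - 1)) \<noteq> 0" using nonresD[OF assms(2)] by auto
    moreover have "m + (i - 1) + 1 = m + i" "i - 1 + 1 = i" by simp_all
    ultimately show ?case using st[of "m + (i - 1)"] st'[of "i - 1"] step2(2) by simp
  qed
qed

lemma qpoch_add_nat:
  "qpoch u q (int m + int n) = qpoch u q (int m) * qpoch (u * q ^ m) q (int n)"
proof (induction n)
  case (Suc n)
  have "int m + int (Suc n) = 1 + int (m + n)" by simp
  hence "qpoch u q (int m + int (Suc n)) = qpoch u q (int m + int n) * (1 - u * q ^ (m + n))"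
    using qpoch_Suc[of u q "m + n"] by (simp add: add_ac)
  thus ?case using Suc qpoch_Suc[of "u * q ^ m" q n] by (simp add: power_add mult_ac)
qed simp

lemma qpoch_negative_power_eq_0:
  assumes "q \<noteq> 0" "n > N"
  shows "qpoch (q powi (- int N)) q (int n) = 0"
proof -
  have "\<exists>j\<in>{..<n}. 1 - q powi (- int N) * q ^ j = 0"
    using assms by (intro bexI[of _ N]) (auto simp: power_int_minus)
  thus ?thesis by (auto simp: qpoch_def intro!: prod_zero)
qed

text \<open>
  The power $q^{i(i+1)/2}$ that appears when a shifted factorial is read backwards.
\<close>

definition qtri :: "complex \<Rightarrow> nat \<Rightarrow> complex" where
  "qtri q i = (\<Prod>j<i. q ^ Suc j)"

lemma qtri_0 [simp]: "qtri q 0 = 1" and qtri_Suc: "qtri q (Suc i) = qtri q i * q ^ Suc i"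
  by (simp_all add: qtri_def)

lemma qtri_neq_0 [simp]: "q \<noteq> 0 \<Longrightarrow> qtri q i \<noteq> 0"
  by (simp add: qtri_def)

lemma qtri_square: "qtri q i * qtri q i = (q ^ Suc i) ^ i"
  by (induction i) (simp_all add: qtri_Suc power_mult_distrib power_add mult_ac)

text \<open>
  Writing $1 - uq^j = -uq^j(1 - q^{-j}/u)$ in each of the top \<open>i\<close> factors turns the complement of an initial
  segment into a shifted factorial of length \<open>i\<close>; it is what makes terminating series out of Cauchy products.
\<close>

lemma qpoch_reverse:
  assumes "q \<noteq> 0" "u \<noteq> 0" "\<And>j. j < 0 \<Longrightarrow> N - int i \<le> j \<Longrightarrow> u * q powi j \<noteq> 1"
  shows "qpoch u q N * qtri q i =
    qpoch u q (N - int i) * qpoch (q powi (1 - N) / u) q (int i) * (- u * q powi N) ^ i"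
  using assms(3)
proof (induction i)
  case (Suc i)
  define M where "M = N - int (Suc i)"
  have MS: "N - int i = M + 1" by (simp add: M_def)
  have st: "qpoch u q (N - int i) = (1 - u * q powi M) * qpoch u q M"
    unfolding MS by (rule qpoch_step) (use Suc.prems[of M] in \<open>auto simp: M_def\<close>)
  have IH: "qpoch u q N * qtri q i =
    qpoch u q (N - int i) * qpoch (q powi (1 - N) / u) q (int i) * (- u * q powi N) ^ i"
    by (rule Suc.IH) (use Suc.prems in auto)
  have inv: "q powi (1 - N) / u * q ^ i = inverse (u * q powi M)"
  proof -
    have "q powi (1 - N) * q ^ i = q powi (- M)"
      using assms(1) by (simp add: M_def power_int_add power_int_diff power_int_minus field_simps)
    thus ?thesis using assms by (simp add: power_int_minus field_simps)
  qed
  have nz: "u * q powi M \<noteq> 0" using assms by simp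
  have "(1 - u * q powi M) * q ^ Suc i = (1 - q powi (1 - N) / u * q ^ i) * (- u * q powi N)"
  proof -
    have "u * q powi N = u * q powi M * q ^ Suc i"
    proof -
      have "q powi N = q powi (M + int (Suc i))" by (simp add: M_def)
      also have "\<dots> = q powi M * q ^ Suc i" using assms(1) by (simp only: power_int_add power_int_of_nat simp_thms)
      finally show ?thesis by simp
    qed
    thus ?thesis unfolding inv using nz by (simp add: field_simps)
  qed
  have "qpoch u q N * qtri q (Suc i) = (1 - u * q powi M) * qpoch u q M * qpoch (q powi (1 - N) / u) q (int i)
      * (- u * q powi N) ^ i * q ^ Suc i"
    unfolding qtri_Suc mult.assoc[symmetric] IH st ..
  also have "\<dots> = qpoch u q M * qpoch (q powi (1 - N) / u) q (int i) * (- u * q powi N) ^ i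
      * ((1 - u * q powi M) * q ^ Suc i)"
    by (simp only: mult_ac)
  also have "\<dots> = qpoch u q M * qpoch (q powi (1 - N) / u) q (int i) * (- u * q powi N) ^ i
      * ((1 - q powi (1 - N) / u * q ^ i) * (- u * q powi N))"
    using \<open>(1 - u * q powi M) * q ^ Suc i = _\<close> by (rule arg_cong)
  also have "\<dots> = qpoch u q M * (qpoch (q powi (1 - N) / u) q (int i) * (1 - q powi (1 - N) / u * q ^ i))
      * (- u * q powi N) ^ Suc i"
    by (simp only: mult_ac power_Suc)
  also have "qpoch (q powi (1 - N) / u) q (int i) * (1 - q powi (1 - N) / u * q ^ i)
      = qpoch (q powi (1 - N) / u) q (int (Suc i))"
    using qpoch_Suc[of "q powi (1 - N) / u" q i] by simp
  finally show ?case unfolding M_def .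
qed simp

lemma one_minus_power_Suc_neq_0:
  fixes q :: complex
  assumes "0 < norm q" "norm q < 1"
  shows "1 - q ^ Suc n \<noteq> 0"
proof
  assume "1 - q ^ Suc n = 0"
  hence "q powi int (Suc n) = 1" by (simp only: power_int_of_nat right_minus_eq)
  from not_root_of_unity[OF assms this] show False by simp
qed

lemma nonres_one_minus_power: "nonres q u \<Longrightarrow> 1 - u * q ^ n \<noteq> 0"
  using nonresD[of q u "int n"] by auto

section \<open>Formal power series solutions of the q-difference equation\<close>

text \<open>
  The scale \<open>s\<close> is part of the series since Heine's transformation rescales the argument.
\<close>

definition hyp :: "complex \<Rightarrow> complex \<Rightarrow> complex \<Rightarrow> complex \<Rightarrow> complex \<Rightarrow> complex fps" where
  "hyp q a b c s = Abs_fps (\<lambda>n. qpoch a q (int n) * qpoch b q (int n) /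
     (qpoch q q (int n) * qpoch c q (int n)) * s ^ n)"

text \<open>
  By the q-binomial theorem this is $(dx)_\infty / (x)_\infty$; its q-difference equation determines it up to a constant.
\<close>

definition qbin :: "complex \<Rightarrow> complex \<Rightarrow> complex fps" where
  "qbin q d = Abs_fps (\<lambda>n. qpoch d q (int n) / qpoch q q (int n))"

definition qshift :: "complex \<Rightarrow> complex fps \<Rightarrow> complex fps" where
  "qshift q f = f oo (fps_const q * fps_X)"

lemma qshift_nth [simp]: "qshift q f $ n = q ^ n * f $ n"
  by (simp add: qshift_def)

lemma qshift_mult: "qshift q (f * g) = qshift q f * qshift q g"
  unfolding qshift_def by (rule fps_compose_mult_distrib) simp

lemma qshift_diff: "qshift q (f - g) = qshift q f - qshift q g"
  by (simp add: fps_eq_iff algebra_simps)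

lemma qshift_const: "qshift q (fps_const u * f) = fps_const u * qshift q f"
  by (simp add: fps_eq_iff)

lemma qshift_X: "qshift q (fps_X * f) = fps_const q * fps_X * qshift q f"
proof (rule fps_ext)
  fix n show "qshift q (fps_X * f) $ n = (fps_const q * fps_X * qshift q f) $ n"
    by (cases n) (simp_all add: mult.assoc)
qed

lemma hyp_nth_Suc:
  assumes "0 < norm q" "norm q < 1" "nonres q c"
  shows "hyp q a b c s $ Suc n * ((1 - q ^ Suc n) * (1 - c * q ^ n))
    = s * (hyp q a b c s $ n * ((1 - a * q ^ n) * (1 - b * q ^ n)))"
proof -
  have nz: "1 - q ^ Suc n \<noteq> 0" "1 - c * q ^ n \<noteq> 0"
    using one_minus_power_Suc_neq_0[OF assms(1,2), of n] nonres_one_minus_power[OF assms(3), of n] by simp_all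
  have "int (Suc n) = 1 + int n" by simp
  hence "hyp q a b c s $ Suc n = qpoch a q (int n) * (1 - a * q ^ n) * (qpoch b q (int n) * (1 - b * q ^ n)) /
     (qpoch q q (int n) * (1 - q ^ Suc n) * (qpoch c q (int n) * (1 - c * q ^ n))) * s ^ Suc n"
    unfolding hyp_def by (simp only: fps_nth_Abs_fps qpoch_Suc power_Suc)
  moreover have "A * x * (B * y) / (Q * e * (R * f)) * (s * t) * (e * f) = s * (A * B / (Q * R) * t * (x * y))"
    if "e \<noteq> 0" "f \<noteq> 0" for A x B y Q e R f t :: complex
    using that by simp
  ultimately show ?thesis using nz by (simp only: hyp_def fps_nth_Abs_fps power_Suc)
qed

lemma hyp_0 [simp]: "hyp q a b c s $ 0 = 1"
  by (simp add: hyp_def)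

text \<open>
  The q-hypergeometric equation $(1-\sigma)(1-\frac{c}{q}\sigma) f = s x (1-a\sigma)(1-b\sigma) f$ with
  $(\sigma f)(x) = f(qx)$, sorted by powers of $\sigma$. For the coefficients it is a two-term recurrence.
\<close>

definition qhyp_eq :: "complex \<Rightarrow> complex \<Rightarrow> complex \<Rightarrow> complex \<Rightarrow> complex \<Rightarrow> complex fps \<Rightarrow> bool" where
  "qhyp_eq q a b c s f \<longleftrightarrow>
     (1 - fps_const s * fps_X) * f
       - (fps_const (1 + c / q) - fps_const (s * (a + b)) * fps_X) * qshift q f
       + (fps_const (c / q) - fps_const (s * (a * b)) * fps_X) * qshift q (qshift q f) = 0"

lemma qhyp_eq_iff:
  assumes "q \<noteq> 0"
  shows "qhyp_eq q a b c s f \<longleftrightarrow>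
    (\<forall>n. f $ Suc n * ((1 - q ^ Suc n) * (1 - c * q ^ n)) = s * (f $ n * ((1 - a * q ^ n) * (1 - b * q ^ n))))"
proof -
  define L where "L = (1 - fps_const s * fps_X) * f
       - (fps_const (1 + c / q) - fps_const (s * (a + b)) * fps_X) * qshift q f
       + (fps_const (c / q) - fps_const (s * (a * b)) * fps_X) * qshift q (qshift q f)"
  have L0: "L $ 0 = 0" by (simp add: L_def algebra_simps)
  have LS: "L $ Suc n = f $ Suc n * ((1 - q ^ Suc n) * (1 - c * q ^ n))
      - s * (f $ n * ((1 - a * q ^ n) * (1 - b * q ^ n)))" for n
    using assms by (simp add: L_def left_diff_distrib mult.assoc) (simp add: field_simps)
  have "L = 0 \<longleftrightarrow> (\<forall>n. L $ n = 0)" by (simp add: fps_eq_iff)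
  also have "\<dots> \<longleftrightarrow> (\<forall>n. L $ Suc n = 0)" using L0 by (metis not0_implies_Suc)
  finally show ?thesis unfolding qhyp_eq_def L_def[symmetric] LS by simp
qed

lemma qhyp_eq_hyp:
  assumes "0 < norm q" "norm q < 1" "nonres q c"
  shows "qhyp_eq q a b c s (hyp q a b c s)"
  using hyp_nth_Suc[OF assms] assms(1) by (subst qhyp_eq_iff) auto

lemma qhyp_eq_unique:
  assumes "0 < norm q" "norm q < 1" "nonres q c"
    and "qhyp_eq q a b c s f" "qhyp_eq q a b c s g" "f $ 0 = g $ 0"
  shows "f = g"
proof (rule fps_ext)
  fix n show "f $ n = g $ n"
  proof (induction n)
    case (Suc n)
    have nz: "(1 - q ^ Suc n) * (1 - c * q ^ n) \<noteq> 0"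
      using one_minus_power_Suc_neq_0[OF assms(1,2), of n] nonres_one_minus_power[OF assms(3), of n] by simp_all
    have "q \<noteq> 0" using assms(1) by auto
    hence "f $ Suc n * ((1 - q ^ Suc n) * (1 - c * q ^ n)) = g $ Suc n * ((1 - q ^ Suc n) * (1 - c * q ^ n))"
      using assms(4,5) Suc unfolding qhyp_eq_iff[OF \<open>q \<noteq> 0\<close>] by simp
    thus ?case using nz by simp
  qed (rule assms)
qed

lemma qbin_0 [simp]: "qbin q d $ 0 = 1"
  by (simp add: qbin_def)

lemma qbin_eq:
  assumes "0 < norm q" "norm q < 1"
  shows "(1 - fps_X) * qbin q d = (1 - fps_const d * fps_X) * qshift q (qbin q d)"
proof (rule fps_ext)
  fix n
  show "((1 - fps_X) * qbin q d) $ n = ((1 - fps_const d * fps_X) * qshift q (qbin q d)) $ n"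
  proof (cases n)
    case (Suc m)
    have nz: "1 - q ^ Suc m \<noteq> 0" by (rule one_minus_power_Suc_neq_0[OF assms])
    have "int (Suc m) = 1 + int m" by simp
    hence "qbin q d $ Suc m = qpoch d q (int m) * (1 - d * q ^ m) / (qpoch q q (int m) * (1 - q ^ Suc m))"
      unfolding qbin_def by (simp only: fps_nth_Abs_fps qpoch_Suc power_Suc)
    hence "qbin q d $ Suc m * (1 - q ^ Suc m) = qbin q d $ m * (1 - d * q ^ m)"
      using nz by (simp add: qbin_def)
    thus ?thesis unfolding Suc by (simp add: left_diff_distrib mult.assoc) (simp add: algebra_simps)
  qed simp
qed

lemma qbin_eq_unique:
  assumes "0 < norm q" "norm q < 1"
    and f: "(1 - fps_X) * f = (1 - fps_const d * fps_X) * qshift q f"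
  shows "f = fps_const (f $ 0) * qbin q d"
proof (rule fps_ext)
  fix n show "f $ n = (fps_const (f $ 0) * qbin q d) $ n"
  proof (induction n)
    case (Suc m)
    have nz: "1 - q ^ Suc m \<noteq> 0" by (rule one_minus_power_Suc_neq_0[OF assms(1,2)])
    have *: "g $ Suc m * (1 - q ^ Suc m) = g $ m * (1 - d * q ^ m)"
      if "(1 - fps_X) * g = (1 - fps_const d * fps_X) * qshift q g" for g
      using arg_cong[OF that, of "\<lambda>h. h $ Suc m"]
      by (simp add: left_diff_distrib mult.assoc) (simp add: algebra_simps)
    have "f $ Suc m * (1 - q ^ Suc m) = f $ m * (1 - d * q ^ m)" by (rule *[OF f])
    also have "\<dots> = f $ 0 * (qbin q d $ m * (1 - d * q ^ m))" using Suc by simp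
    also have "\<dots> = f $ 0 * qbin q d $ Suc m * (1 - q ^ Suc m)"
      using *[OF qbin_eq[OF assms(1,2)]] by (simp add: mult.assoc)
    finally show ?case using nz by simp
  qed simp
qed

lemma qbin_shift:
  assumes "0 < norm q" "norm q < 1"
  shows "(1 - fps_const d * fps_X) * qbin q (d * q) = qbin q d"
proof -
  let ?f = "(1 - fps_const d * fps_X) * qbin q (d * q)"
  have s: "qshift q ?f = (1 - fps_const (d * q) * fps_X) * qshift q (qbin q (d * q))"
    by (simp add: left_diff_distrib qshift_diff mult.assoc qshift_const qshift_X mult.left_commute flip: fps_const_mult)
  have "(1 - fps_X) * ?f = (1 - fps_const d * fps_X) * ((1 - fps_X) * qbin q (d * q))"
    by (simp only: mult_ac)
  also have "\<dots> = (1 - fps_const d * fps_X) * qshift q ?f"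
    unfolding qbin_eq[OF assms] s ..
  finally have "?f = fps_const (?f $ 0) * qbin q d" by (rule qbin_eq_unique[OF assms])
  thus ?thesis by simp
qed

text \<open>
  Both sides solve the same q-hypergeometric equation. For the right-hand side, the first order equation of the
  factor \<^const>\<open>qbin\<close> exchanges the leading coefficients $1 - x$ and $1 - abx/c$.
\<close>

theorem heine_euler_transformation:
  assumes "0 < norm q" "norm q < 1" "nonres q c" "a \<noteq> 0" "b \<noteq> 0" "c \<noteq> 0"
  shows "hyp q a b c 1 = qbin q (a * b / c) * hyp q (c / a) (c / b) c (a * b / c)"
proof (rule qhyp_eq_unique[OF assms(1-3) qhyp_eq_hyp[OF assms(1-3)]])
  define d where "d = a * b / c"
  define K where "K = qbin q d"
  define \<psi> where "\<psi> = hyp q (c / a) (c / b) c d"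
  have q: "q \<noteq> 0" using assms by auto
  have K1: "(1 - fps_X) * K = (1 - fps_const d * fps_X) * qshift q K"
    unfolding K_def by (rule qbin_eq[OF assms(1,2)])
  have "qshift q ((1 - fps_X) * K) = qshift q ((1 - fps_const d * fps_X) * qshift q K)"
    by (rule arg_cong[OF K1])
  hence K2: "(1 - fps_const q * fps_X) * qshift q K = (1 - fps_const (d * q) * fps_X) * qshift q (qshift q K)"
    by (simp add: left_diff_distrib qshift_diff mult.assoc qshift_const qshift_X mult.left_commute flip: fps_const_mult)
  have e: "d * (c / a + c / b) = a + b" "d * (c / a * (c / b)) = c" "c / q * (d * q) = a * b"
    using assms q by (simp_all add: d_def field_simps)
  have psi: "(1 - fps_const d * fps_X) * \<psi>
       - (fps_const (1 + c / q) - fps_const (a + b) * fps_X) * qshift q \<psi>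
       + (fps_const (c / q) - fps_const c * fps_X) * qshift q (qshift q \<psi>) = 0"
    using qhyp_eq_hyp[OF assms(1-3), of "c / a" "c / b" d] unfolding qhyp_eq_def \<psi>_def[symmetric] e .
  have c1: "fps_const (c / q) - fps_const (a * b) * fps_X = fps_const (c / q) * (1 - fps_const (d * q) * fps_X)"
    unfolding e(3)[symmetric] by (simp add: right_diff_distrib mult.assoc flip: fps_const_mult)
  have c2: "fps_const (c / q) * (1 - fps_const q * fps_X) = fps_const (c / q) - fps_const c * fps_X"
    using q by (simp add: right_diff_distrib mult.assoc[symmetric])
  have "(1 - fps_X) * (K * \<psi>) = qshift q K * ((1 - fps_const d * fps_X) * \<psi>)"
    using K1 by (metis mult.assoc mult.commute)
  moreover have "(fps_const (c / q) - fps_const (a * b) * fps_X) * (qshift q (qshift q K) * qshift q (qshift q \<psi>))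
      = fps_const (c / q) * ((1 - fps_const (d * q) * fps_X) * qshift q (qshift q K)) * qshift q (qshift q \<psi>)"
    unfolding c1 by (simp only: mult_ac)
  moreover have "\<dots> = qshift q K * ((fps_const (c / q) - fps_const c * fps_X) * qshift q (qshift q \<psi>))"
    unfolding K2[symmetric] c2[symmetric] by (simp only: mult_ac)
  ultimately have "(1 - fps_X) * (K * \<psi>)
       - (fps_const (1 + c / q) - fps_const (a + b) * fps_X) * qshift q (K * \<psi>)
       + (fps_const (c / q) - fps_const (a * b) * fps_X) * qshift q (qshift q (K * \<psi>))
     = qshift q K * ((1 - fps_const d * fps_X) * \<psi>
       - (fps_const (1 + c / q) - fps_const (a + b) * fps_X) * qshift q \<psi>
       + (fps_const (c / q) - fps_const c * fps_X) * qshift q (qshift q \<psi>))"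
    unfolding qshift_mult by (simp only: distrib_left right_diff_distrib) (simp only: mult_ac)
  thus "qhyp_eq q a b c 1 (qbin q (a * b / c) * hyp q (c / a) (c / b) c (a * b / c))"
    unfolding qhyp_eq_def psi K_def[symmetric] \<psi>_def[symmetric] d_def[symmetric] by simp
qed simp

text \<open>
  The factor $1 - q^n$ cancels the last factor of $(q)_n$ and shifts the summation.
\<close>

lemma hyp_minus_qshift:
  assumes q: "0 < norm q" "norm q < 1" and c: "nonres q c"
  shows "hyp q a b c 1 - qshift q (hyp q a b c 1) =
    fps_const ((1 - a) * (1 - b) / (1 - c)) * fps_X * hyp q (a * q) (b * q) (c * q) 1"
proof (rule fps_ext)
  fix n show "(hyp q a b c 1 - qshift q (hyp q a b c 1)) $ n =
      (fps_const ((1 - a) * (1 - b) / (1 - c)) * fps_X * hyp q (a * q) (b * q) (c * q) 1) $ n"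
  proof (cases n)
    case (Suc m)
    have sh: "qpoch u q (1 + int m) = (1 - u) * qpoch (u * q) q (int m)" for u
      using qpoch_add_nat[of u q 1 m] qpoch_Suc[of u q 0] by simp
    have nz: "1 - q ^ Suc m \<noteq> 0" by (rule one_minus_power_Suc_neq_0[OF q])
    have qq: "qpoch q q (int (Suc m)) = qpoch q q (int m) * (1 - q ^ Suc m)"
      using qpoch_Suc[of q q m] by simp
    have "hyp q a b c 1 $ Suc m * (1 - q ^ Suc m) = (1 - a) * (1 - b) / (1 - c) * hyp q (a * q) (b * q) (c * q) 1 $ m"
      using nz unfolding hyp_def fps_nth_Abs_fps qq by (simp add: sh mult_ac)
    thus ?thesis unfolding Suc by (simp add: mult.assoc) (simp add: algebra_simps)
  qed (simp add: mult.assoc)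
qed

text \<open>
  The q-analogue of Abel's formula for the Wronskian: the determinant \<open>V\<close> of the two solutions and their q-shifts
  satisfies a first order equation, with \<^const>\<open>qbin\<close> as the only solution up to a constant. The shifted
  functions are then replaced by the contiguous ones.
\<close>

theorem qhyp_casoratian:
  assumes q: "0 < norm q" "norm q < 1" and c: "nonres q c" and ne: "a \<noteq> 0" "b \<noteq> 0" "c \<noteq> 0"
  shows "fps_const ((1 - a) * (1 - b) / ((1 - c) * (1 - q / c))) * fps_X
           * hyp q (a * q / c) (b * q / c) (q\<^sup>2 / c) 1 * hyp q (a * q) (b * q) (c * q) 1
         - hyp q a b c 1 * hyp q (a * q / c) (b * q / c) (q / c) 1
         = - qbin q (a * b * q / c)"
proof -
  have q0: "q \<noteq> 0" using q by auto
  have c1: "1 - c \<noteq> 0" "1 - q / c \<noteq> 0"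
  proof -
    show "1 - c \<noteq> 0" using nonresD[OF c, of 0] by simp
    show "1 - q / c \<noteq> 0" using nonresD[OF c, of "-1"] ne q0 by (auto simp: field_simps)
  qed
  have nr2: "nonres q (q\<^sup>2 / c)" by (rule nonres_inverse[OF q0 ne(3) c, of _ 2]) simp
  have nr1: "nonres q (q / c)" by (rule nonres_inverse[OF q0 ne(3) c, of _ 1]) simp
  have nrq: "nonres q (c * q)" by (rule nonres_shift[OF q0 c, of _ 1]) simp
  define f g where "f = hyp q a b c 1" and "g = hyp q (a * q / c) (b * q / c) (q\<^sup>2 / c) 1"
  define f1 g1 where "f1 = hyp q (a * q) (b * q) (c * q) 1"
    and "g1 = hyp q (a * q / c) (b * q / c) (q / c) 1"
  define V where "V = fps_const (q / c) * f * qshift q g - qshift q f * g"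
  have ff: "f - qshift q f = fps_const ((1 - a) * (1 - b) / (1 - c)) * fps_X * f1"
    unfolding f_def f1_def by (rule hyp_minus_qshift[OF q c])
  have gg: "g - fps_const (q / c) * qshift q g = fps_const (1 - q / c) * g1"
  proof (rule fps_ext)
    fix n
    have "(1 - q / c) * qpoch (q\<^sup>2 / c) q (int n) = qpoch (q / c) q (int n) * (1 - q / c * q ^ n)"
      using qpoch_add_nat[of "q / c" q 1 n] qpoch_Suc[of "q / c" q n] qpoch_Suc[of "q / c" q 0]
      by (simp add: power2_eq_square mult.commute)
    moreover have "qpoch (q\<^sup>2 / c) q (int n) \<noteq> 0" "qpoch (q / c) q (int n) \<noteq> 0" "qpoch q q (int n) \<noteq> 0"
      using nr1 nr2 q by (simp_all add: qpoch_nonres qpoch_q_neq_0)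
    ultimately have "(1 - q / c * q ^ n) / qpoch (q\<^sup>2 / c) q (int n) = (1 - q / c) / qpoch (q / c) q (int n)"
      by (subst frac_eq_eq) (simp_all add: mult_ac)
    hence "g $ n * (1 - q / c * q ^ n) = (1 - q / c) * g1 $ n"
      unfolding g_def g1_def hyp_def fps_nth_Abs_fps
      by (simp only: divide_inverse inverse_mult_distrib mult_ac)
    thus "(g - fps_const (q / c) * qshift q g) $ n = (fps_const (1 - q / c) * g1) $ n"
      by (simp add: algebra_simps)
  qed
  \<comment> \<open>The factor \<open>q / c\<close> is the effect of the q-shift on the power of \<open>x\<close> that belongs to the second solution.\<close>
  define F1 G1 where "F1 = qshift q f" and "G1 = fps_const (q / c) * qshift q g"
  define F2 G2 where "F2 = qshift q F1" and "G2 = fps_const (q / c) * qshift q G1"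
  define \<alpha> \<beta> where "\<alpha> = fps_const (1 + c / q) - fps_const (a + b) * fps_X"
    and "\<beta> = fps_const (c / q) - fps_const (a * b) * fps_X"
  have feq: "(1 - fps_X) * f - \<alpha> * F1 + \<beta> * F2 = 0"
    using qhyp_eq_hyp[OF q c, of a b 1] unfolding qhyp_eq_def f_def F1_def F2_def \<alpha>_def \<beta>_def by simp
  have geq: "(1 - fps_X) * g - \<alpha> * G1 + \<beta> * G2 = 0"
  proof -
    have h: "fps_const (1 + (q\<^sup>2 / c) / q) - fps_const (1 * (a * q / c + b * q / c)) * fps_X = \<alpha> * fps_const (q / c)"
      "fps_const ((q\<^sup>2 / c) / q) - fps_const (1 * (a * q / c * (b * q / c))) * fps_X
        = \<beta> * fps_const (q / c) * fps_const (q / c)"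
    proof -
      have e: "1 + (q\<^sup>2 / c) / q = (1 + c / q) * (q / c)" "1 * (a * q / c + b * q / c) = (a + b) * (q / c)"
        "(q\<^sup>2 / c) / q = c / q * (q / c) * (q / c)" "1 * (a * q / c * (b * q / c)) = a * b * (q / c) * (q / c)"
        using q0 ne by (simp_all add: field_simps power2_eq_square)
      show "fps_const (1 + (q\<^sup>2 / c) / q) - fps_const (1 * (a * q / c + b * q / c)) * fps_X = \<alpha> * fps_const (q / c)"
        unfolding e(1,2) \<alpha>_def fps_const_mult[symmetric] left_diff_distrib by (simp only: mult_ac)
      show "fps_const ((q\<^sup>2 / c) / q) - fps_const (1 * (a * q / c * (b * q / c))) * fps_X
        = \<beta> * fps_const (q / c) * fps_const (q / c)"
        unfolding e(3,4) \<beta>_def fps_const_mult[symmetric] left_diff_distrib by (simp only: mult_ac)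
    qed
    thus ?thesis
      using qhyp_eq_hyp[OF q nr2, of "a * q / c" "b * q / c" 1]
      unfolding qhyp_eq_def g_def[symmetric] h G1_def G2_def qshift_const
      by (simp only: mult.assoc fps_const_1_eq_1 mult_1)
  qed
  have Vfg: "V = f * G1 - F1 * g" unfolding V_def F1_def G1_def by (simp only: mult_ac)
  have V2: "fps_const (q / c) * qshift q V = F1 * G2 - F2 * G1"
  proof -
    have "qshift q V = F1 * qshift q G1 - F2 * qshift q g"
      unfolding Vfg qshift_diff qshift_mult F1_def F2_def ..
    thus ?thesis unfolding G2_def G1_def by (simp only: right_diff_distrib mult_ac)
  qed
  have "(1 - fps_X) * V = \<beta> * (F1 * G2 - F2 * G1)"
  proof -
    have "(1 - fps_X) * V - \<beta> * (F1 * G2 - F2 * G1) =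
       ((1 - fps_X) * f - \<alpha> * F1 + \<beta> * F2) * G1 - ((1 - fps_X) * g - \<alpha> * G1 + \<beta> * G2) * F1"
      unfolding Vfg by (simp add: algebra_simps)
    thus ?thesis unfolding feq geq by simp
  qed
  also have "\<dots> = (\<beta> * fps_const (q / c)) * qshift q V"
    unfolding V2[symmetric] by (simp only: mult_ac)
  also have "\<beta> * fps_const (q / c) = 1 - fps_const (a * b * q / c) * fps_X"
  proof -
    have "fps_const (c / q) * fps_const (q / c) = 1" using q0 ne by simp
    moreover have "fps_const (a * b) * fps_X * fps_const (q / c) = fps_const (a * b * q / c) * fps_X"
    proof -
      have "fps_const (a * b * q / c) = fps_const (a * b) * fps_const (q / c)" by simp
      thus ?thesis by (simp only: mult_ac)
    qed
    ultimately show ?thesis unfolding \<beta>_def left_diff_distrib by simp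
  qed
  finally have "V = fps_const (V $ 0) * qbin q (a * b * q / c)" by (rule qbin_eq_unique[OF q])
  moreover have "V $ 0 = - (1 - q / c)" by (simp add: V_def f_def g_def)
  ultimately have V3: "V = fps_const (- (1 - q / c)) * qbin q (a * b * q / c)" by simp
  have "fps_const (1 - q / c) * (fps_const ((1 - a) * (1 - b) / ((1 - c) * (1 - q / c))) * fps_X * g * f1 - f * g1)
     = fps_const ((1 - a) * (1 - b) / (1 - c)) * fps_X * f1 * g - f * (fps_const (1 - q / c) * g1)"
  proof -
    have "(1 - a) * (1 - b) / (1 - c) = (1 - q / c) * ((1 - a) * (1 - b) / ((1 - c) * (1 - q / c)))"
      using c1 by simp
    thus ?thesis by (simp only: right_diff_distrib fps_const_mult[symmetric] mult_ac)
  qed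
  also have "\<dots> = V"
    unfolding ff[symmetric] gg[symmetric] V_def by (simp add: algebra_simps)
  also have "\<dots> = fps_const (1 - q / c) * (- qbin q (a * b * q / c))"
    by (simp only: V3 fps_const_neg[symmetric] mult_minus_left mult_minus_right)
  finally have "fps_const ((1 - a) * (1 - b) / ((1 - c) * (1 - q / c))) * fps_X * g * f1 - f * g1
      = - qbin q (a * b * q / c)"
    using c1 ne by (subst (asm) mult_cancel_left) auto
  thus ?thesis unfolding f_def g_def f1_def g1_def .
qed

section \<open>Products of two series\<close>

lemma phi43_terminating:
  assumes "q \<noteq> 0"
  shows "phi43 (q powi (- int n)) a1 a2 a3 b1 b2 b3 q z =
    (\<Sum>i\<le>n. qpoch (q powi (- int n)) q (int i) * qpoch a1 q (int i) * qpoch a2 q (int i) * qpoch a3 q (int i) /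
       (qpoch q q (int i) * qpoch b1 q (int i) * qpoch b2 q (int i) * qpoch b3 q (int i)) * z ^ i)"
  unfolding phi43_def using qpoch_negative_power_eq_0[OF assms] by (intro suminf_finite) auto

text \<open>
  In the Cauchy product the factorials of the first series have index \<open>n - i\<close>. Reversed, two of them move to the
  numerator and two to the denominator, so that the powers of \<open>q\<close> that are quadratic in \<open>i\<close> cancel and a ${}_4\phi_3$ remains.
\<close>

theorem hyp_mult_nth:
  assumes q: "0 < norm q" "norm q < 1" and nr: "nonres q A" "nonres q B" "nonres q C"
    and ne: "A \<noteq> 0" "B \<noteq> 0" "C \<noteq> 0" "s \<noteq> 0"
  shows "(hyp q A B C s * hyp q A' B' C' t) $ n =
    hyp q A B C s $ n *
    phi43 (q powi (- int n)) (q powi (1 - int n) / C) A' B'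
      C' (q powi (1 - int n) / A) (q powi (1 - int n) / B) q (q * C * t / (A * B * s))"
proof -
  have q0: "q \<noteq> 0" using q by auto
  let ?u = "\<lambda>i. hyp q A B C s $ i" and ?v = "\<lambda>i. hyp q A' B' C' t $ i"
  define z where "z = q * C * t / (A * B * s)"
  define T where "T = (\<lambda>i. qpoch (q powi (- int n)) q (int i) * qpoch (q powi (1 - int n) / C) q (int i)
      * qpoch A' q (int i) * qpoch B' q (int i) /
      (qpoch q q (int i) * qpoch C' q (int i) * qpoch (q powi (1 - int n) / A) q (int i)
      * qpoch (q powi (1 - int n) / B) q (int i)) * z ^ i)"
  have summand: "?v i * ?u (n - i) = ?u n * T i" if "i \<le> n" for i
  proof -
    have ni: "int (n - i) = int n - int i" using that by simp
    define Q where "Q = q ^ n"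
    have Q: "Q \<noteq> 0" "q powi (int n) = Q" using q0 by (simp_all add: Q_def)
    define E where "E = qtri q i"
    have E: "E \<noteq> 0" using q0 by (simp add: E_def)
    have rev: "qpoch w q (int n) * E =
        qpoch w q (int (n - i)) * qpoch (q powi (1 - int n) / w) q (int i) * (- w * Q) ^ i"
      if "w \<noteq> 0" for w
      unfolding ni E_def Q(2)[symmetric] by (rule qpoch_reverse[OF q0 that]) (use \<open>i \<le> n\<close> in auto)
    have qn: "q powi (1 - int n) / q = q powi (- int n)"
      using q0 by (simp add: power_int_diff power_int_minus field_simps)
    define a1 a2 a3 a4 where "a1 = qpoch (q powi (1 - int n) / A) q (int i)"
      and "a2 = qpoch (q powi (1 - int n) / B) q (int i)"
      and "a3 = qpoch (q powi (1 - int n) / C) q (int i)" and "a4 = qpoch (q powi (- int n)) q (int i)"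
    define b1 b2 b3 b4 where "b1 = qpoch A q (int (n - i))" and "b2 = qpoch B q (int (n - i))"
      and "b3 = qpoch C q (int (n - i))" and "b4 = qpoch q q (int (n - i))"
    define d1 d2 d3 d4 where "d1 = qpoch A q (int n)" and "d2 = qpoch B q (int n)"
      and "d3 = qpoch C q (int n)" and "d4 = qpoch q q (int n)"
    have r: "d1 * E = b1 * a1 * (- A * Q) ^ i" "d2 * E = b2 * a2 * (- B * Q) ^ i"
      "d3 * E = b3 * a3 * (- C * Q) ^ i" "d4 * E = b4 * a4 * (- q * Q) ^ i"
      using rev[OF ne(1)] rev[OF ne(2)] rev[OF ne(3)] rev[OF q0] unfolding qn
      by (simp_all add: a1_def a2_def a3_def a4_def b1_def b2_def b3_def b4_def d1_def d2_def d3_def d4_def)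
    have nz: "d1 \<noteq> 0" "d2 \<noteq> 0" "d3 \<noteq> 0" "d4 \<noteq> 0" "b3 \<noteq> 0" "b4 \<noteq> 0"
      using nr q by (simp_all add: d1_def d2_def d3_def d4_def b3_def b4_def qpoch_nonres qpoch_q_neq_0)
    have nz': "a1 \<noteq> 0" "a2 \<noteq> 0" "a3 \<noteq> 0" "a4 \<noteq> 0" using r nz E by auto
    have zi: "z ^ i * s ^ n = s ^ (n - i) * t ^ i * ((- q * Q) ^ i * (- C * Q) ^ i) / ((- A * Q) ^ i * (- B * Q) ^ i)"
    proof -
      have r: "(- q * Q) ^ i * (- C * Q) ^ i / ((- A * Q) ^ i * (- B * Q) ^ i) = (q * C / (A * B)) ^ i"
        unfolding power_mult_distrib[symmetric] power_divide[symmetric] using Q ne by (simp add: field_simps)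
      have "s ^ n = s ^ (n - i) * s ^ i" using that by (simp flip: power_add)
      hence "z ^ i * s ^ n = s ^ (n - i) * t ^ i * (q * C / (A * B)) ^ i"
        using ne(4) by (simp add: z_def power_divide power_mult_distrib)
      thus ?thesis unfolding r[symmetric] by simp
    qed
    have prod: "b1 * b2 / (b4 * b3) * (a1 * a2) * ((- A * Q) ^ i * (- B * Q) ^ i)
        = d1 * d2 / (d4 * d3) * (a4 * a3) * ((- q * Q) ^ i * (- C * Q) ^ i)"
    proof -
      have "b1 * b2 * (a1 * a2) * ((- A * Q) ^ i * (- B * Q) ^ i) = d1 * E * (d2 * E)"
        unfolding r by (simp only: mult_ac)
      moreover have "(a4 * a3) * ((- q * Q) ^ i * (- C * Q) ^ i) = d4 * E * (d3 * E) / (b4 * b3)"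
        unfolding r using nz by (simp add: field_simps)
      ultimately show ?thesis using nz E
        by (simp add: field_simps)
    qed
    have key: "b1 * b2 / (b4 * b3) = d1 * d2 / (d4 * d3) * (a4 * a3 / (a1 * a2)) *
        (((- q * Q) ^ i * (- C * Q) ^ i) / ((- A * Q) ^ i * (- B * Q) ^ i))"
    proof -
      have gen: "p = d * (x / y) * (v / w)" if "p * y * w = d * x * v" "y \<noteq> 0" "w \<noteq> 0"
        for p d x y v w :: complex
        using that by (simp add: field_simps)
      show ?thesis
        by (rule gen) (use nz' ne Q prod in simp_all)
    qed
    have "?v i * ?u (n - i) = qpoch A' q (int i) * qpoch B' q (int i) / (qpoch q q (int i) * qpoch C' q (int i))
        * t ^ i * (b1 * b2 / (b4 * b3) * s ^ (n - i))"
      unfolding hyp_def b1_def b2_def b3_def b4_def by simp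
    also have "\<dots> = d1 * d2 / (d4 * d3) * (qpoch A' q (int i) * qpoch B' q (int i) / (qpoch q q (int i) * qpoch C' q (int i)))
        * (a4 * a3 / (a1 * a2)) * (z ^ i * s ^ n)"
      unfolding key zi unfolding divide_inverse inverse_mult_distrib by (simp only: mult_ac)
    also have "\<dots> = ?u n * T i"
      unfolding hyp_def T_def a1_def a2_def a3_def a4_def d1_def d2_def d3_def d4_def by (simp add: mult_ac)
    finally show ?thesis .
  qed
  have "(hyp q A B C s * hyp q A' B' C' t) $ n = (\<Sum>i\<le>n. ?v i * ?u (n - i))"
    by (subst mult.commute) (simp add: fps_mult_nth atLeast0AtMost)
  also have "\<dots> = (\<Sum>i\<le>n. ?u n * T i)" by (intro sum.cong) (auto simp: summand)
  also have "\<dots> = ?u n * (\<Sum>i\<le>n. T i)" by (simp add: sum_distrib_left)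
  finally show ?thesis unfolding phi43_terminating[OF q0] T_def z_def .
qed

section \<open>Ring homomorphisms and evaluation of polynomials\<close>

text \<open>
  Evaluation of iterated polynomial rings, in complex numbers as well as in formal Laurent series, is handled by
  lifting homomorphisms of the coefficients one variable at a time.
\<close>

definition is_hom :: "('r::comm_ring_1 \<Rightarrow> 's::comm_ring_1) \<Rightarrow> bool" where
  "is_hom h \<longleftrightarrow> h 0 = 0 \<and> h 1 = 1 \<and> (\<forall>x y. h (x + y) = h x + h y) \<and> (\<forall>x y. h (x * y) = h x * h y)"

lemma is_homD:
  assumes "is_hom h"
  shows "h 0 = 0" "h 1 = 1" "h (x + y) = h x + h y" "h (x * y) = h x * h y"
  using assms by (auto simp: is_hom_def)

lemma is_hom_diff:
  assumes "is_hom h"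
  shows "h (x - y) = h x - h y"
  using is_homD(3)[OF assms, of "x - y" y] by simp

lemma is_hom_eval:
  assumes h: "is_hom h"
  shows "is_hom (\<lambda>p. poly (map_poly h p) y)"
proof -
  note [simp] = map_poly_pCons[where f = h, OF is_homD(1)[OF h]] is_homD[OF h]
  have add: "poly (map_poly h (p + r)) y = poly (map_poly h p) y + poly (map_poly h r) y" for p r
    by (induction p r rule: poly_induct2) (simp_all add: algebra_simps)
  have smult: "poly (map_poly h (smult c p)) y = h c * poly (map_poly h p) y" for c p
    by (induction p) (simp_all add: algebra_simps)
  have mult: "poly (map_poly h (p * r)) y = poly (map_poly h p) y * poly (map_poly h r) y" for p r
    by (induction p) (simp_all add: add smult algebra_simps)
  show ?thesis unfolding is_hom_def by (simp add: add mult one_pCons)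
qed

definition peval :: "complex poly \<Rightarrow> complex fls \<Rightarrow> complex fls" where
  "peval p X = poly (map_poly fls_const p) X"

lemma is_hom_fls_const: "is_hom (fls_const :: complex \<Rightarrow> complex fls)"
  by (simp add: is_hom_def fls_plus_const)

lemma is_hom_peval: "is_hom (\<lambda>p. peval p X)"
  unfolding peval_def by (rule is_hom_eval[OF is_hom_fls_const])

lemma peval_pCons [simp]: "peval (pCons c p) X = fls_const c + X * peval p X"
  by (simp add: peval_def map_poly_pCons)

lemma peval_0 [simp]: "peval 0 X = 0"
  by (simp add: peval_def)

lemmas peval_mult = is_homD(4)[OF is_hom_peval]
lemmas peval_add = is_homD(3)[OF is_hom_peval]

section \<open>Contiguous systems\<close>

text \<open>
  The contiguous relations in the normalization where \<open>H k l m\<close> stands for $\frac{(a)_k (b)_l}{(c)_m} f_{klm}$ or another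
  solution in its place. In terms of the q-shift $\sigma$ they say that raising \<open>k\<close>, raising \<open>l\<close>
  and lowering \<open>m\<close> are the operators $1 - aq^k\sigma$, $1 - bq^l\sigma$, $1 - cq^{m-1}\sigma$, with
  $\sigma H_{klm} = H_{klm} - x H_{k+1,l+1,m+1}$. In this form $\sigma$ does not have to be an operator on the
  series, and \<open>X\<close> can be \<open>x\<close> or, for expansions at infinity, the inverse of the local parameter.
\<close>

definition contiguous ::
  "complex \<Rightarrow> complex \<Rightarrow> complex \<Rightarrow> complex \<Rightarrow> complex fls \<Rightarrow> (int \<Rightarrow> int \<Rightarrow> int \<Rightarrow> complex fls) \<Rightarrow> bool" where
  "contiguous q a b c X H \<longleftrightarrow> X \<noteq> 0 \<and> (\<forall>k l m.
     H (k + 1) l m = (1 - fls_const (a * q powi k)) * H k l m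
       + fls_const (a * q powi k) * (X * H (k + 1) (l + 1) (m + 1)) \<and>
     H k (l + 1) m = (1 - fls_const (b * q powi l)) * H k l m
       + fls_const (b * q powi l) * (X * H (k + 1) (l + 1) (m + 1)) \<and>
     H k l (m - 1) = (1 - fls_const (c * q powi (m - 1))) * H k l m
       + fls_const (c * q powi (m - 1)) * (X * H (k + 1) (l + 1) (m + 1)))"

lemma contiguousD:
  assumes "contiguous q a b c X H"
  shows "X \<noteq> 0"
    "k' = k + 1 \<Longrightarrow> l' = l + 1 \<Longrightarrow> m' = m + 1 \<Longrightarrow>
     H k' l m = (1 - fls_const (a * q powi k)) * H k l m + fls_const (a * q powi k) * (X * H k' l' m')"
    "k' = k + 1 \<Longrightarrow> l' = l + 1 \<Longrightarrow> m' = m + 1 \<Longrightarrow>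
     H k l' m = (1 - fls_const (b * q powi l)) * H k l m + fls_const (b * q powi l) * (X * H k' l' m')"
    "k' = k + 1 \<Longrightarrow> l' = l + 1 \<Longrightarrow> m' = m + 1 \<Longrightarrow> m0 = m - 1 \<Longrightarrow>
     H k l m0 = (1 - fls_const (c * q powi m0)) * H k l m + fls_const (c * q powi m0) * (X * H k' l' m')"
  using assms unfolding contiguous_def by blast+

lemma contiguous_swap:
  "contiguous q a b c X H \<longleftrightarrow> contiguous q b a c X (\<lambda>k l m. H l k m)"
  unfolding contiguous_def by blast

text \<open>
  \<open>in_span q a b c \<phi>\<close>: the expression \<open>\<phi>\<close> is a combination of \<open>H 0 0 0\<close> and \<open>H (-1) (-1) (-1)\<close> with
  Laurent polynomials in \<open>X\<close> as coefficients, the same ones for all contiguous systems. The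
  uniformity is the point: one pair of coefficients serves the expansions at the origin and at infinity.
\<close>

definition in_span ::
  "complex \<Rightarrow> complex \<Rightarrow> complex \<Rightarrow> complex \<Rightarrow>
    (complex fls \<Rightarrow> (int \<Rightarrow> int \<Rightarrow> int \<Rightarrow> complex fls) \<Rightarrow> complex fls) \<Rightarrow> bool" where
  "in_span q a b c \<phi> \<longleftrightarrow> (\<exists>N p r. \<forall>X H. contiguous q a b c X H \<longrightarrow>
     X ^ N * \<phi> X H = peval p X * H 0 0 0 + peval r X * H (- 1) (- 1) (- 1))"

lemma in_span_swap:
  assumes "in_span q a b c \<phi>"
  shows "in_span q b a c (\<lambda>X H. \<phi> X (\<lambda>k l m. H l k m))"
  using assms unfolding in_span_def contiguous_swap[of q b a c] by blast

lemma in_span_combination: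
  assumes "in_span q a b c \<phi>" "in_span q a b c \<psi>"
    and "\<And>X H. contiguous q a b c X H \<Longrightarrow> X ^ M * \<chi> X H = peval u X * \<phi> X H + peval v X * \<psi> X H"
  shows "in_span q a b c \<chi>"
proof -
  obtain N1 p1 r1 where 1: "\<And>X H. contiguous q a b c X H \<Longrightarrow>
      X ^ N1 * \<phi> X H = peval p1 X * H 0 0 0 + peval r1 X * H (- 1) (- 1) (- 1)"
    using assms(1) unfolding in_span_def by blast
  obtain N2 p2 r2 where 2: "\<And>X H. contiguous q a b c X H \<Longrightarrow>
      X ^ N2 * \<psi> X H = peval p2 X * H 0 0 0 + peval r2 X * H (- 1) (- 1) (- 1)"
    using assms(2) unfolding in_span_def by blast
  have mon: "peval (monom 1 n) X = X ^ n" for n X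
    by (induction n) (simp_all add: monom_0 monom_Suc)
  show ?thesis unfolding in_span_def
  proof (intro exI allI impI)
    fix X H assume H: "contiguous q a b c X H"
    have "X ^ (N1 + N2 + M) * \<chi> X H = X ^ N2 * peval u X * (X ^ N1 * \<phi> X H) + X ^ N1 * peval v X * (X ^ N2 * \<psi> X H)"
      unfolding power_add mult.assoc assms(3)[OF H] by (simp add: algebra_simps)
    also have "\<dots> = peval (monom 1 N2 * u * p1 + monom 1 N1 * v * p2) X * H 0 0 0
      + peval (monom 1 N2 * u * r1 + monom 1 N1 * v * r2) X * H (- 1) (- 1) (- 1)"
      unfolding 1[OF H] 2[OF H] by (simp add: peval_add peval_mult mon algebra_simps)
    finally show "X ^ (N1 + N2 + M) * \<chi> X H = \<dots>" .
  qed
qed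

lemma in_span_const_combination:
  assumes "in_span q a b c \<phi>" "in_span q a b c \<psi>" "w \<noteq> 0"
    and eq: "\<And>X H. contiguous q a b c X H \<Longrightarrow>
      fls_const w * \<chi> X H = fls_const u * \<phi> X H + fls_const v * \<psi> X H"
  shows "in_span q a b c \<chi>"
proof (rule in_span_combination[OF assms(1,2), of 0 _ "[:u / w:]" "[:v / w:]"])
  fix X H assume H: "contiguous q a b c X H"
  have "fls_const w \<noteq> 0" using assms(3) by (rule fls_const_nonzero)
  moreover have "fls_const w * (fls_const (u / w) * \<phi> X H + fls_const (v / w) * \<psi> X H)
     = fls_const (w * (u / w)) * \<phi> X H + fls_const (w * (v / w)) * \<psi> X H"
    unfolding fls_const_mult_const[symmetric] by (simp only: distrib_left mult.assoc)
  ultimately have "\<chi> X H = fls_const (u / w) * \<phi> X H + fls_const (v / w) * \<psi> X H"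
    using eq[OF H] assms(3) by (metis mult_left_cancel nonzero_mult_div_cancel_left times_divide_eq_right)
  thus "X ^ 0 * \<chi> X H = peval [:u / w:] X * \<phi> X H + peval [:v / w:] X * \<psi> X H" by simp
qed

lemma in_span_X_cancel:
  assumes "in_span q a b c (\<lambda>X H. X * \<phi> X H)"
  shows "in_span q a b c \<phi>"
  by (rule in_span_combination[OF assms assms, of 1 _ 1 0]) (simp add: is_homD(2)[OF is_hom_peval])

lemma in_span_mult:
  assumes "in_span q a b c \<phi>"
  shows "in_span q a b c (\<lambda>X H. peval u X * \<phi> X H)"
  by (rule in_span_combination[OF assms assms, of 0 _ u 0]) simp

text \<open>
  By the contiguous relations, \<open>H k l m\<close> and its four neighbours \<open>H (k + 1) l m\<close>, \<open>H k (l + 1) m\<close>,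
  \<open>H k l (m - 1)\<close>, \<open>X * H (k + 1) (l + 1) (m + 1)\<close> span a space of dimension at most two over the constants; the predicate
  says that all of it satisfies \<^const>\<open>in_span\<close>. Each neighbour has a level $k+l-m$ that is larger by one.
\<close>

definition cell :: "complex \<Rightarrow> complex \<Rightarrow> complex \<Rightarrow> complex \<Rightarrow> int \<Rightarrow> int \<Rightarrow> int \<Rightarrow> bool" where
  "cell q a b c k l m \<longleftrightarrow> in_span q a b c (\<lambda>X H. H k l m) \<and>
     in_span q a b c (\<lambda>X H. X * H (k + 1) (l + 1) (m + 1))"

lemma cell_swap: "cell q a b c k l m \<Longrightarrow> cell q b a c l k m"
  unfolding cell_def using in_span_swap by blast

lemma cell_neighbours:
  assumes "cell q a b c k l m"
  shows "in_span q a b c (\<lambda>X H. H (k + 1) l m)" "in_span q a b c (\<lambda>X H. H k (l + 1) m)"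
    "in_span q a b c (\<lambda>X H. H k l (m - 1))" "in_span q a b c (\<lambda>X H. H (k + 1) (l + 1) (m + 1))"
proof -
  note c = assms[unfolded cell_def]
  show "in_span q a b c (\<lambda>X H. H (k + 1) l m)"
    by (rule in_span_const_combination[OF c[THEN conjunct1] c[THEN conjunct2],
        of 1 _ "1 - a * q powi k" "a * q powi k"])
      (simp_all add: contiguousD(2)[where l' = "l + 1" and m' = "m + 1"] flip: fls_minus_const)
  show "in_span q a b c (\<lambda>X H. H k (l + 1) m)"
    by (rule in_span_const_combination[OF c[THEN conjunct1] c[THEN conjunct2],
        of 1 _ "1 - b * q powi l" "b * q powi l"])
      (simp_all add: contiguousD(3)[where k' = "k + 1" and m' = "m + 1"] flip: fls_minus_const)
  show "in_span q a b c (\<lambda>X H. H k l (m - 1))"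
    by (rule in_span_const_combination[OF c[THEN conjunct1] c[THEN conjunct2],
        of 1 _ "1 - c * q powi (m - 1)" "c * q powi (m - 1)"])
      (simp_all add: contiguousD(4)[where k' = "k + 1" and l' = "l + 1" and m' = "m + 1" and m = m] flip: fls_minus_const)
  show "in_span q a b c (\<lambda>X H. H (k + 1) (l + 1) (m + 1))"
    by (rule in_span_X_cancel) (rule c[THEN conjunct2])
qed

text \<open>
  For generic parameters any two of the five elements generate the others. This is the instance in which the contiguous relation
  that raises \<open>k\<close> is solved for the shifted term.
\<close>

lemma cellI_a:
  assumes "in_span q a b c (\<lambda>X H. H k l m)" "in_span q a b c (\<lambda>X H. H (k + 1) l m)"
    and "a * q powi k \<noteq> 0"
  shows "cell q a b c k l m"
proof -
  have "in_span q a b c (\<lambda>X H. X * H (k + 1) (l + 1) (m + 1))"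
  proof (rule in_span_const_combination[OF assms(2,1), of "a * q powi k" _ 1 "- (1 - a * q powi k)"])
    fix X H assume H: "contiguous q a b c X H"
    show "fls_const (a * q powi k) * (X * H (k + 1) (l + 1) (m + 1)) =
        fls_const 1 * H (k + 1) l m + fls_const (- (1 - a * q powi k)) * H k l m"
      unfolding contiguousD(2)[OF H, where l' = "l + 1" and m' = "m + 1" and k = k, OF refl refl refl]
      by (simp flip: fls_minus_const add: algebra_simps)
  qed (rule assms(3))
  thus ?thesis using assms(1) by (simp add: cell_def)
qed

text \<open>
  The conditions on the parameters under which none of the eliminations below divides by zero.
\<close>

definition generic :: "complex \<Rightarrow> complex \<Rightarrow> complex \<Rightarrow> complex \<Rightarrow> bool" where
  "generic q a b c \<longleftrightarrow> q \<noteq> 0 \<and> a \<noteq> 0 \<and> b \<noteq> 0 \<and> c \<noteq> 0 \<and> nonres q a \<and> nonres q b \<and>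
     nonres q (a / b) \<and> nonres q (c / a) \<and> nonres q (c / b)"

lemma generic_swap: "generic q a b c \<Longrightarrow> generic q b a c"
  unfolding generic_def using nonres_inverse[of q "a / b" "b / a" 0] by simp

text \<open>
  Lowering the level needs no denominator. The elements \<open>H (k + 1) (l + 1) (m + 1)\<close> and \<open>H k (l + 1) m\<close> belong to the
  cell at \<open>(k, l, m)\<close> and also to the one at \<open>(k, l + 1, m + 1)\<close>, which gives \<open>H k (l + 1) (m + 1)\<close>.
  Together with \<open>H k l m\<close> this is a pair in the cell at \<open>(k - 1, l, m)\<close>.
\<close>

lemma cell_lower:
  assumes g: "generic q a b c" and c: "cell q a b c k l m"
  shows "cell q a b c (k - 1) l m"
proof -
  have q: "q \<noteq> 0" and a: "a \<noteq> 0" and ca: "nonres q (c / a)" and an: "nonres q a"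
    using g by (auto simp: generic_def)
  define A C A' where "A = a * q powi k" and "C = c * q powi m" and "A' = a * q powi (k - 1)"
  have Z: "in_span q a b c (\<lambda>X H. H k (l + 1) (m + 1))"
  proof (rule in_span_const_combination[OF cell_neighbours(4,2)[OF c], of "C - A" _ C "- A"])
    show "C - A \<noteq> 0"
    proof
      assume "C - A = 0"
      hence "c / a * q powi (m - k) = 1" using q a by (simp add: C_def A_def power_int_diff field_simps)
      thus False using nonresD[OF ca] by blast
    qed
    fix X H assume H: "contiguous q a b c X H"
    have e1: "H (k + 1) (l + 1) (m + 1) = (1 - fls_const A) * H k (l + 1) (m + 1)
        + fls_const A * (X * H (k + 1) (l + 2) (m + 2))"
      unfolding A_def by (rule contiguousD(2)[OF H]) auto
    have e2: "H k (l + 1) m = (1 - fls_const C) * H k (l + 1) (m + 1)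
        + fls_const C * (X * H (k + 1) (l + 2) (m + 2))"
      unfolding C_def by (rule contiguousD(4)[OF H]) auto
    show "fls_const (C - A) * H k (l + 1) (m + 1) =
       fls_const C * H (k + 1) (l + 1) (m + 1) + fls_const (- A) * H k (l + 1) m"
      unfolding e1 e2 by (simp flip: fls_minus_const add: algebra_simps)
  qed
  have ZX: "in_span q a b c (\<lambda>X H. X * H k (l + 1) (m + 1))"
    using in_span_mult[OF Z, of "[:0, 1:]"] by simp
  have "in_span q a b c (\<lambda>X H. H (k - 1) l m)"
  proof (rule in_span_const_combination[OF c[unfolded cell_def, THEN conjunct1] ZX, of "1 - A'" _ 1 "- A'"])
    show "1 - A' \<noteq> 0" using nonresD[OF an, of "k - 1"] by (auto simp: A'_def)
    fix X H assume H: "contiguous q a b c X H"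
    have "H k l m = (1 - fls_const A') * H (k - 1) l m + fls_const A' * (X * H k (l + 1) (m + 1))"
      unfolding A'_def by (rule contiguousD(2)[OF H]) auto
    thus "fls_const (1 - A') * H (k - 1) l m = fls_const 1 * H k l m + fls_const (- A') * (X * H k (l + 1) (m + 1))"
      by (simp flip: fls_minus_const add: algebra_simps)
  qed
  thus ?thesis unfolding cell_def using ZX by simp
qed

text \<open>
  The new cell has one element in common with the cell at \<open>(k, l, m)\<close> and another one with the cell at
  \<open>(k - 1, l, m)\<close>; these two generate it.
\<close>

lemma cell_sideways:
  assumes g: "generic q a b c" and c: "cell q a b c k l m"
  shows "cell q a b c k (l + 1) (m + 1)" "cell q a b c (k - 1) l (m - 1)"
proof -
  have q: "a * q powi j \<noteq> 0" for j using g by (auto simp: generic_def)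
  note low = cell_lower[OF g c]
  show "cell q a b c k (l + 1) (m + 1)"
    using cellI_a[OF _ cell_neighbours(4)[OF c] q] cell_neighbours(4)[OF low] by simp
  show "cell q a b c (k - 1) l (m - 1)"
    using cellI_a[OF cell_neighbours(3)[OF low] _ q] cell_neighbours(3)[OF c] by simp
qed

text \<open>
  The sideways steps and their mirror images in \<open>a\<close> and \<open>b\<close> generate the whole lattice of level $-1$, starting from
  the cell of \<open>H (-1) (-1) (-1)\<close> and \<open>H 0 0 0\<close>; the lower levels follow by descending.
\<close>

lemma cell_nonpos_level:
  assumes g: "generic q a b c"
  shows "k + l - m \<le> - 1 \<Longrightarrow> cell q a b c k l m"
proof -
  note g' = generic_swap[OF g]
  have base: "cell q a b c (- 1) (- 1) (- 1)"
  proof -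
    have "in_span q a b c (\<lambda>X H. H (- 1) (- 1) (- 1))"
      unfolding in_span_def by (intro exI[of _ 0] exI[of _ 0] exI[of _ 1]) (simp add: is_homD(2)[OF is_hom_peval])
    moreover have "in_span q a b c (\<lambda>X H. X * H 0 0 0)"
      unfolding in_span_def by (intro exI[of _ 0] exI[of _ "[:0, 1:]"] exI[of _ 0]) simp
    ultimately show ?thesis by (simp add: cell_def)
  qed
  have 1: "cell q a b c i (- 1) i" for i
  proof (induction i rule: int_induct[where k = "- 1"])
    case base
    show ?case by (rule \<open>cell q a b c (- 1) (- 1) (- 1)\<close>)
  next
    case (step1 i)
    show ?case using cell_swap[OF cell_sideways(1)[OF g' cell_swap[OF step1(2)]]] .
  next
    case (step2 i)
    show ?case using cell_sideways(2)[OF g step2(2)] .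
  qed
  have 2: "cell q a b c i j (i + j + 1)" for i j
  proof (induction j rule: int_induct[where k = "- 1"])
    case base
    show ?case using 1[of i] by simp
  next
    case (step1 j)
    show ?case using cell_sideways(1)[OF g step1(2)] by (simp add: add_ac)
  next
    case (step2 j)
    have "i + j + 1 - 1 = i + (j - 1) + 1" by simp
    thus ?case using cell_swap[OF cell_sideways(2)[OF g' cell_swap[OF step2(2)]]] by simp
  qed
  have 3: "cell q a b c (k - int n) l m" if "k + l - m = - 1" for n k l m
  proof (induction n)
    case 0
    have "m = k + l + 1" using that by simp
    thus ?case using 2[of k l] by simp
  next
    case (Suc n)
    show ?case using cell_lower[OF g Suc] by (simp add: algebra_simps)
  qed
  show "cell q a b c k l m" if "k + l - m \<le> - 1"
    using 3[of "m - l - 1" l m "nat (- 1 - k - l + m)"] that by simp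
qed

definition qprod :: "complex \<Rightarrow> complex \<Rightarrow> nat \<Rightarrow> complex poly" where
  "qprod q d n = (\<Prod>j<n. [:1, - d * q ^ j:])"

lemma qprod_0 [simp]: "qprod q d 0 = 1" and qprod_Suc: "qprod q d (Suc n) = qprod q d n * [:1, - d * q ^ n:]"
  by (simp_all add: qprod_def)

text \<open>
  The step to a higher level is the only one that costs a denominator: the new element \<open>H k l m\<close> satisfies two
  relations over the cell at \<open>(k - 1, l - 1, m)\<close>, and eliminating \<open>H (k + 1) l (m + 1)\<close> leaves the factor
  $1 - \frac{ab}{c} q^{k+l-m-1} x$ in front of it.
\<close>

lemma raise_level:
  assumes g: "generic q a b c"
    and Y: "in_span q a b c (\<lambda>X H. peval u X * H (k - 1) (l - 1) m)"
    and Z: "in_span q a b c (\<lambda>X H. peval u X * H k (l - 1) m)"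
  shows "in_span q a b c (\<lambda>X H. peval (u * [:1, - (a * b / c * q powi (k + l - m - 1)):]) X * H k l m)"
proof -
  have q: "q \<noteq> 0" and a: "a \<noteq> 0" "b \<noteq> 0" "c \<noteq> 0" using g by (auto simp: generic_def)
  define A B C A' where "A = a * q powi k" and "B = b * q powi (l - 1)" and "C = c * q powi m"
    and "A' = a * q powi (k - 1)"
  define d where "d = a * b / c * q powi (k + l - m - 1)"
  have A': "A' \<noteq> 0" "C \<noteq> 0" using q a by (auto simp: A'_def C_def)
  have d: "C * d = A * B"
    using q a by (simp add: d_def A_def B_def C_def power_int_add power_int_diff field_simps)
  show ?thesis unfolding d_def[symmetric]
  proof (rule in_span_const_combination[OF Y Z, of "A' * C" _ "- (C - A) * B * (1 - A')" "(C - A) * B + A' * C * (1 - B)"])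
    show "A' * C \<noteq> 0" using A' by simp
    fix X H assume H: "contiguous q a b c X H"
    define \<alpha> \<beta> \<gamma> \<alpha>' \<delta> where "\<alpha> = fls_const A" and "\<beta> = fls_const B" and "\<gamma> = fls_const C" and "\<alpha>' = fls_const A'"
      and "\<delta> = fls_const d"
    have dd: "\<gamma> * \<delta> = \<alpha> * \<beta>" using d by (simp add: \<alpha>_def \<beta>_def \<gamma>_def \<delta>_def)
    have 1: "H k (l - 1) m = (1 - \<alpha>') * H (k - 1) (l - 1) m + \<alpha>' * (X * H k l (m + 1))"
      unfolding A'_def \<alpha>'_def by (rule contiguousD(2)[OF H]) auto
    have 2: "H k l m = (1 - \<beta>) * H k (l - 1) m + \<beta> * (X * H (k + 1) l (m + 1))"
      unfolding B_def \<beta>_def by (rule contiguousD(3)[OF H]) auto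
    have 3: "H (k + 1) l (m + 1) = (1 - \<alpha>) * H k l (m + 1) + \<alpha> * (X * H (k + 1) (l + 1) (m + 2))"
      unfolding A_def \<alpha>_def by (rule contiguousD(2)[OF H]) auto
    have 4: "H k l m = (1 - \<gamma>) * H k l (m + 1) + \<gamma> * (X * H (k + 1) (l + 1) (m + 2))"
      unfolding C_def \<gamma>_def by (rule contiguousD(4)[OF H]) auto
    have 5: "\<gamma> * H (k + 1) l (m + 1) - \<alpha> * H k l m = (\<gamma> - \<alpha>) * H k l (m + 1)"
      unfolding 3 4 by (simp add: algebra_simps)
    have "\<alpha>' * \<gamma> * ((1 - \<delta> * X) * H k l m)
        = \<alpha>' * \<gamma> * H k l m - \<alpha>' * X * (\<gamma> * \<delta>) * H k l m"
      by (simp add: algebra_simps)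
    also have "\<dots> = \<alpha>' * \<gamma> * (1 - \<beta>) * H k (l - 1) m
        + \<alpha>' * \<beta> * X * (\<gamma> * H (k + 1) l (m + 1) - \<alpha> * H k l m)"
      unfolding dd by (subst (1) 2) (simp add: algebra_simps)
    also have "\<dots> = \<alpha>' * \<gamma> * (1 - \<beta>) * H k (l - 1) m + (\<gamma> - \<alpha>) * \<beta> * (\<alpha>' * (X * H k l (m + 1)))"
      unfolding 5 by (simp add: algebra_simps)
    also have "\<alpha>' * (X * H k l (m + 1)) = H k (l - 1) m - (1 - \<alpha>') * H (k - 1) (l - 1) m"
      using 1 by simp
    finally have key: "\<alpha>' * \<gamma> * ((1 - \<delta> * X) * H k l m) =
      - ((\<gamma> - \<alpha>) * \<beta> * (1 - \<alpha>')) * H (k - 1) (l - 1) m + ((\<gamma> - \<alpha>) * \<beta> + \<alpha>' * \<gamma> * (1 - \<beta>)) * H k (l - 1) m"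
      by (simp add: algebra_simps)
    have "fls_const (A' * C) * (peval (u * [:1, - d:]) X * H k l m) = peval u X * (\<alpha>' * \<gamma> * ((1 - \<delta> * X) * H k l m))"
    proof -
      have "peval [:1, - d:] X = 1 - \<delta> * X" by (simp add: \<delta>_def mult.commute)
      moreover have "fls_const (A' * C) = \<alpha>' * \<gamma>" by (simp add: \<alpha>'_def \<gamma>_def)
      ultimately show ?thesis by (simp only: peval_mult mult_ac)
    qed
    also have "\<dots> = fls_const (- (C - A) * B * (1 - A')) * (peval u X * H (k - 1) (l - 1) m)
      + fls_const ((C - A) * B + A' * C * (1 - B)) * (peval u X * H k (l - 1) m)"
    proof -
      have cc: "fls_const (- (C - A) * B * (1 - A')) = - ((\<gamma> - \<alpha>) * \<beta> * (1 - \<alpha>'))"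
        "fls_const ((C - A) * B + A' * C * (1 - B)) = (\<gamma> - \<alpha>) * \<beta> + \<alpha>' * \<gamma> * (1 - \<beta>)"
        by (simp_all add: \<alpha>_def \<beta>_def \<gamma>_def \<alpha>'_def fls_minus_const fls_plus_const flip: fls_const_1 fls_const_uminus)
          (simp add: algebra_simps)
      show ?thesis unfolding key cc by (simp only: distrib_left mult.left_commute)
    qed
    finally show "fls_const (A' * C) * (peval (u * [:1, - d:]) X * H k l m) = \<dots>" .
  qed
qed

text \<open>
  Going up one level at a time from level $0$ collects exactly the factors of $(abx/c)_{k+l-m}$.
\<close>

theorem contiguous_reduction:
  assumes g: "generic q a b c"
  shows "in_span q a b c (\<lambda>X H. peval (qprod q (a * b / c) (nat (k + l - m))) X * H k l m)"
proof -
  define d where "d = a * b / c"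
  have neg: "in_span q a b c (\<lambda>X H. H k l m)" if "k + l - m \<le> 0" for k l m
    using cell_neighbours(1)[OF cell_nonpos_level[OF g, of "k - 1" l m]] that by simp
  have "\<forall>k l m. k + l - m = int n \<longrightarrow> in_span q a b c (\<lambda>X H. peval (qprod q d n) X * H k l m)" for n
  proof (induction n rule: less_induct)
    case (less n)
    show ?case
    proof (intro allI impI)
      fix k l m assume n: "k + l - m = int n"
      show "in_span q a b c (\<lambda>X H. peval (qprod q d n) X * H k l m)"
      proof (cases n)
        case 0
        thus ?thesis using neg[of k l m] n by (simp add: is_homD(2)[OF is_hom_peval])
      next
        case (Suc j)
        have Z: "in_span q a b c (\<lambda>X H. peval (qprod q d j) X * H k (l - 1) m)"
          using less[of j] Suc n by simp
        have Y: "in_span q a b c (\<lambda>X H. peval (qprod q d j) X * H (k - 1) (l - 1) m)"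
        proof (cases j)
          case 0
          thus ?thesis using neg[of "k - 1" "l - 1" m] n Suc by (simp add: is_homD(2)[OF is_hom_peval])
        next
          case (Suc i)
          hence "in_span q a b c (\<lambda>X H. peval (qprod q d i) X * H (k - 1) (l - 1) m)"
            using less[of i] \<open>n = Suc j\<close> n by simp
          from in_span_mult[OF this, of "[:1, - d * q ^ i:]"] show ?thesis
            unfolding Suc qprod_Suc peval_mult by (simp add: mult_ac)
        qed
        have "k + l - m - 1 = int j" using n Suc by simp
        hence e: "- (a * b / c * q powi (k + l - m - 1)) = - d * q ^ j" by (simp add: d_def)
        show ?thesis unfolding Suc qprod_Suc using raise_level[OF g Y Z] unfolding e .
      qed
    qed
  qed
  thus ?thesis unfolding d_def using neg[of k l m]
    by (cases "k + l - m \<ge> 0") (auto simp: is_homD(2)[OF is_hom_peval])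
qed

section \<open>Solutions of the contiguous relations\<close>

text \<open>
  One formula for the coefficients, indexed by all integers, of all four local solutions: with \<open>z = 1\<close> and \<open>z = q / c\<close> it
  is supported on a right half line and gives the solutions at the origin, with \<open>z = 1 / a\<close> and \<open>z = 1 / b\<close>
  it is supported on a left half line and gives those at infinity. The number $zq^n$ is the eigenvalue of the q-shift on the \<open>n\<close>-th term.
\<close>

definition bilateral ::
  "complex \<Rightarrow> complex \<Rightarrow> complex \<Rightarrow> complex \<Rightarrow> complex \<Rightarrow> int \<Rightarrow> int \<Rightarrow> int \<Rightarrow> int \<Rightarrow> complex" where
  "bilateral q a b c z k l m n = qpoch (a * z) q (n + k) * qpoch (b * z) q (n + l) *
     inverse (qpoch (c * z) q (n + m)) * inverse (qpoch (q * z) q n)"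

text \<open>
  A factorial in the numerator may vanish and one in the denominator may have poles, since then the term is zero;
  these two predicates exclude the opposite cases.
\<close>

definition pole_free :: "complex \<Rightarrow> complex \<Rightarrow> bool" where
  "pole_free q u \<longleftrightarrow> (\<forall>j<0. u * q powi j \<noteq> 1)"

definition zero_free :: "complex \<Rightarrow> complex \<Rightarrow> bool" where
  "zero_free q u \<longleftrightarrow> (\<forall>j\<ge>0. u * q powi j \<noteq> 1)"

lemma bilateral_contiguous:
  assumes q: "q \<noteq> 0" and "pole_free q (a * z)" "pole_free q (b * z)" "zero_free q (c * z)" "zero_free q (q * z)"
  defines "h \<equiv> bilateral q a b c z"
  shows
    "h (k + 1) l m n = (1 - a * q powi k) * h k l m n + a * q powi k * h (k + 1) (l + 1) (m + 1) (n - 1)"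
    "h k (l + 1) m n = (1 - b * q powi l) * h k l m n + b * q powi l * h (k + 1) (l + 1) (m + 1) (n - 1)"
    "h k l (m - 1) n = (1 - c * q powi (m - 1)) * h k l m n + c * q powi (m - 1) * h (k + 1) (l + 1) (m + 1) (n - 1)"
proof -
  define \<zeta> where "\<zeta> = z * q powi n"
  have num: "qpoch u q (j + 1) = (1 - u * q powi j) * qpoch u q j" if "pole_free q u" for u j
    using that qpoch_step unfolding pole_free_def by blast
  have den: "inverse (qpoch u q j) = (1 - u * q powi j) * inverse (qpoch u q (j + 1))" if "zero_free q u" for u j
    by (rule inverse_qpoch_step) (use that in \<open>meson zero_free_def not_le\<close>)
  have Z: "h (k + 1) (l + 1) (m + 1) (n - 1) = (1 - \<zeta>) * h k l m n"
    using den[OF assms(5), of "n - 1"] q by (simp add: h_def bilateral_def \<zeta>_def power_int_diff)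
  have i: "n + (k + 1) = n + k + 1" "n + (l + 1) = n + l + 1" by simp_all
  have "h (k + 1) l m n = (1 - a * q powi k * \<zeta>) * h k l m n" "h k (l + 1) m n = (1 - b * q powi l * \<zeta>) * h k l m n"
    unfolding h_def bilateral_def i num[OF assms(2)] num[OF assms(3)]
    using q by (simp_all add: \<zeta>_def power_int_add mult_ac)
  moreover have "h k l (m - 1) n = (1 - c * q powi (m - 1) * \<zeta>) * h k l m n"
  proof -
    have "n + (m - 1) + 1 = n + m" by simp
    moreover have "q powi (n + (m - 1)) = q powi n * q powi (m - 1)" using q by (intro power_int_add) auto
    ultimately show ?thesis
      using den[OF assms(4), of "n + (m - 1)"] by (simp add: h_def bilateral_def \<zeta>_def mult_ac)
  qed
  ultimately show
    "h (k + 1) l m n = (1 - a * q powi k) * h k l m n + a * q powi k * h (k + 1) (l + 1) (m + 1) (n - 1)"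
    "h k (l + 1) m n = (1 - b * q powi l) * h k l m n + b * q powi l * h (k + 1) (l + 1) (m + 1) (n - 1)"
    "h k l (m - 1) n = (1 - c * q powi (m - 1)) * h k l m n + c * q powi (m - 1) * h (k + 1) (l + 1) (m + 1) (n - 1)"
    unfolding Z by (simp_all add: algebra_simps)
qed

lemma contiguous_at_origin:
  assumes "q \<noteq> 0" "pole_free q (a * z)" "pole_free q (b * z)" "zero_free q (c * z)" "zero_free q (q * z)"
    and H: "\<And>k l m n. H k l m $$ n = bilateral q a b c z k l m n"
  shows "contiguous q a b c fls_X H"
  unfolding contiguous_def
proof (intro conjI allI)
  fix k l m
  note h = bilateral_contiguous[OF assms(1-5), of k l m]
  note nth = H left_diff_distrib fls_X_times_conv_shift
  show "H (k + 1) l m = (1 - fls_const (a * q powi k)) * H k l m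
       + fls_const (a * q powi k) * (fls_X * H (k + 1) (l + 1) (m + 1))"
    by (rule fls_eqI) (use h(1) in \<open>simp add: nth\<close>)
  show "H k (l + 1) m = (1 - fls_const (b * q powi l)) * H k l m
       + fls_const (b * q powi l) * (fls_X * H (k + 1) (l + 1) (m + 1))"
    by (rule fls_eqI) (use h(2) in \<open>simp add: nth\<close>)
  show "H k l (m - 1) = (1 - fls_const (c * q powi (m - 1))) * H k l m
       + fls_const (c * q powi (m - 1)) * (fls_X * H (k + 1) (l + 1) (m + 1))"
    by (rule fls_eqI) (use h(3) in \<open>simp add: nth\<close>)
qed simp

lemma contiguous_at_infinity:
  assumes "q \<noteq> 0" "pole_free q (a * z)" "pole_free q (b * z)" "zero_free q (c * z)" "zero_free q (q * z)"
    and H: "\<And>k l m n. H k l m $$ n = bilateral q a b c z k l m (- n)"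
  shows "contiguous q a b c fls_X_inv H"
  unfolding contiguous_def
proof (intro conjI allI)
  fix k l m
  note h = bilateral_contiguous[OF assms(1-5), of k l m "- n" for n]
  note nth = H left_diff_distrib fls_X_inv_times_conv_shift
  show "H (k + 1) l m = (1 - fls_const (a * q powi k)) * H k l m
       + fls_const (a * q powi k) * (fls_X_inv * H (k + 1) (l + 1) (m + 1))"
    by (rule fls_eqI) (use h(1) in \<open>simp add: nth\<close>)
  show "H k (l + 1) m = (1 - fls_const (b * q powi l)) * H k l m
       + fls_const (b * q powi l) * (fls_X_inv * H (k + 1) (l + 1) (m + 1))"
    by (rule fls_eqI) (use h(2) in \<open>simp add: nth\<close>)
  show "H k l (m - 1) = (1 - fls_const (c * q powi (m - 1))) * H k l m
       + fls_const (c * q powi (m - 1)) * (fls_X_inv * H (k + 1) (l + 1) (m + 1))"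
    by (rule fls_eqI) (use h(3) in \<open>simp add: nth\<close>)
qed simp

lemma fls_shift_one_mult_nth [simp]: "(fls_shift j 1 * (f :: complex fls)) $$ n = f $$ (n + j)"
  using fls_X_intpow_times_conv_shift(1)[of "- j" f] by simp

text \<open>
  The bounds \<open>M\<close> and \<open>N\<close> need not be the exact orders, which avoids distinguishing whether a factor is zero.
\<close>

lemma fls_lowest_coeff_mult:
  fixes f g :: "complex fls"
  assumes "\<And>n. n < M \<Longrightarrow> f $$ n = 0" "\<And>n. n < N \<Longrightarrow> g $$ n = 0"
  shows "n < M + N \<Longrightarrow> (f * g) $$ n = 0" "(f * g) $$ (M + N) = f $$ M * g $$ N"
proof -
  define F G where "F = Abs_fps (\<lambda>n. f $$ (M + int n))" and "G = Abs_fps (\<lambda>n. g $$ (N + int n))"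
  have f: "f = fls_X_intpow M * fps_to_fls F" and g: "g = fls_X_intpow N * fps_to_fls G"
    by (rule fls_eqI; use assms in \<open>auto simp: fls_X_intpow_times_conv_shift F_def G_def\<close>)+
  have fg: "f * g = fls_X_intpow (M + N) * fps_to_fls (F * G)"
    unfolding f g fls_times_fps_to_fls fls_X_intpow_times_fls_X_intpow[symmetric] by (simp only: mult_ac)
  show "n < M + N \<Longrightarrow> (f * g) $$ n = 0" "(f * g) $$ (M + N) = f $$ M * g $$ N"
    unfolding fg by (simp_all add: fls_X_intpow_times_conv_shift F_def G_def)
qed

lemma peval_X: "peval p fls_X = fps_to_fls (fps_of_poly p)"
  by (induction p) (simp_all add: fps_of_poly_pCons fls_times_fps_to_fls mult.commute)

lemma peval_X_inv_nth: "peval p fls_X_inv $$ n = (if n \<le> 0 then coeff p (nat (- n)) else 0)"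
proof (induction p arbitrary: n)
  case (pCons c p)
  have "nat (- n) = Suc (nat (- (n + 1)))" if "n < 0" using that by simp
  thus ?case
    using pCons.IH[of "n + 1"] by (auto simp: fls_X_inv_times_conv_shift)
qed simp

lemma degree_qprod: "degree (qprod q d n) \<le> n"
proof (induction n)
  case (Suc n)
  have "degree (qprod q d n * [:1, - d * q ^ n:]) \<le> degree (qprod q d n) + degree [:1, - d * q ^ n:]"
    by (rule degree_mult_le)
  also have "\<dots> \<le> n + 1" using Suc by (intro add_mono) (auto intro: order.trans[OF degree_pCons_le])
  finally show ?case by (simp add: qprod_Suc)
qed simp

lemma fls_X_powi_nonneg: "fls_X_intpow (int n) = (fls_X :: complex fls) ^ n"
  by (simp flip: fls_X_power_int)

section \<open>The four coefficient sequences as coefficients of products\<close>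

text \<open>
  The constant by which the second solution has to be multiplied, relative to the first one, for the pair to satisfy the same
  contiguous relations.
\<close>

definition normalization_ratio :: "complex \<Rightarrow> complex \<Rightarrow> complex \<Rightarrow> complex \<Rightarrow> int \<Rightarrow> int \<Rightarrow> int \<Rightarrow> complex" where
  "normalization_ratio q a b c k l m = qpoch c q m / (qpoch a q k * qpoch b q l) *
     (qpoch (a * q / c) q (k - m) * qpoch (b * q / c) q (l - m) / qpoch (q\<^sup>2 / c) q (- m))"

definition origin_f :: "complex \<Rightarrow> complex \<Rightarrow> complex \<Rightarrow> complex \<Rightarrow> int \<Rightarrow> int \<Rightarrow> int \<Rightarrow> complex fps" where
  "origin_f q a b c k l m = hyp q (a * q powi k) (b * q powi l) (c * q powi m) 1"

definition origin_g :: "complex \<Rightarrow> complex \<Rightarrow> complex \<Rightarrow> complex \<Rightarrow> int \<Rightarrow> int \<Rightarrow> int \<Rightarrow> complex fps" where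
  "origin_g q a b c k l m = hyp q (a * q / c * q powi (k - m)) (b * q / c * q powi (l - m)) (q\<^sup>2 / c * q powi (- m)) 1"

text \<open>
  What is left of \<^const>\<open>origin_f\<close> when the infinite product in Heine's transformation is removed.
\<close>

definition origin_f_reduced :: "complex \<Rightarrow> complex \<Rightarrow> complex \<Rightarrow> complex \<Rightarrow> int \<Rightarrow> int \<Rightarrow> int \<Rightarrow> complex fps" where
  "origin_f_reduced q a b c k l m = hyp q (c * q powi (m - k) / a) (c * q powi (m - l) / b) (c * q powi m)
     (a * b / c * q powi (k + l - m))"

definition origin_g_reduced :: "complex \<Rightarrow> complex \<Rightarrow> complex \<Rightarrow> complex \<Rightarrow> int \<Rightarrow> int \<Rightarrow> int \<Rightarrow> complex fps" where
  "origin_g_reduced q a b c k l m = hyp q (q powi (1 - k) / a) (q powi (1 - l) / b) (q\<^sup>2 / c * q powi (- m))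
     (a * b / c * q powi (k + l - m))"

lemma qbin_qprod:
  assumes "0 < norm q" "norm q < 1"
  shows "fps_of_poly (qprod q d n) * qbin q (d * q ^ n) = qbin q d"
proof (induction n)
  case (Suc n)
  have "fps_of_poly (qprod q d (Suc n)) * qbin q (d * q ^ Suc n) =
      fps_of_poly (qprod q d n) * ((1 - fps_const (d * q ^ n) * fps_X) * qbin q (d * q ^ n * q))"
    by (simp add: qprod_Suc fps_of_poly_mult fps_of_poly_pCons mult_ac)
  also have "\<dots> = qbin q d" unfolding qbin_shift[OF assms] by (rule Suc)
  finally show ?case .
qed simp

text \<open>
  The determinant of the shifts \<open>(k, l, m)\<close> and \<open>(0, 0, 0)\<close>, up to sign and normalized so that \<^const>\<open>origin_f\<close> enters with factor one.
\<close>

definition casoratian :: "complex \<Rightarrow> complex \<Rightarrow> complex \<Rightarrow> complex \<Rightarrow> int \<Rightarrow> int \<Rightarrow> int \<Rightarrow> complex fls" where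
  "casoratian q a b c k l m = fls_const (normalization_ratio q a b c k l m) * fls_X_intpow (- m) *
       fps_to_fls (origin_g q a b c k l m) * fps_to_fls (origin_f q a b c 0 0 0)
     - fps_to_fls (origin_f q a b c k l m) * fps_to_fls (origin_g q a b c 0 0 0)"

definition system_f :: "complex \<Rightarrow> complex \<Rightarrow> complex \<Rightarrow> complex \<Rightarrow> int \<Rightarrow> int \<Rightarrow> int \<Rightarrow> complex fls" where
  "system_f q a b c k l m = fls_const (qpoch a q k * qpoch b q l / qpoch c q m) * fps_to_fls (origin_f q a b c k l m)"

definition system_g :: "complex \<Rightarrow> complex \<Rightarrow> complex \<Rightarrow> complex \<Rightarrow> int \<Rightarrow> int \<Rightarrow> int \<Rightarrow> complex fls" where
  "system_g q a b c k l m = fls_const (qpoch (a * q / c) q (k - m) * qpoch (b * q / c) q (l - m) / qpoch (q\<^sup>2 / c) q (- m)) *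
     (fls_X_intpow (- m) * fps_to_fls (origin_g q a b c k l m))"

text \<open>
  The series whose coefficients, moved by \<open>max m 0\<close>, make up the polynomial $P_{k,l,m}$ before truncation. The two cases
  differ in where the infinite product is taken out: at level $k+l-m$ or at level $0$.
\<close>

definition casoratian_quotient :: "complex \<Rightarrow> complex \<Rightarrow> complex \<Rightarrow> complex \<Rightarrow> int \<Rightarrow> int \<Rightarrow> int \<Rightarrow> complex fls" where
  "casoratian_quotient q a b c k l m = (if k + l - m \<ge> 0 then
       fls_X_intpow (- m) * fps_to_fls (Abs_fps (\<lambda>n. coeff_A k l m a b c q (int n)))
         - fps_to_fls (Abs_fps (\<lambda>n. coeff_B k l m a b c q (int n)))
     else
       fls_X_intpow (- m) * fps_to_fls (Abs_fps (\<lambda>n. coeff_At k l m a b c q (int n)))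
         - fps_to_fls (Abs_fps (\<lambda>n. coeff_Bt k l m a b c q (int n))))"

context
  fixes q a b c :: complex
  assumes q: "0 < norm q" "norm q < 1"
    and gen: "generic q a b c" and nrc: "nonres q c"
begin
lemma q_nz: "q \<noteq> 0"
  using q by auto

lemma params_nz: "a \<noteq> 0" "b \<noteq> 0" "c \<noteq> 0"
  using gen by (auto simp: generic_def)

lemma nonres_params: "nonres q a" "nonres q b" "nonres q (c / a)" "nonres q (c / b)"
  using gen by (auto simp: generic_def)

lemma nonres_powi: "nonres q u \<Longrightarrow> nonres q (u * q powi i)"
  using nonres_shift[OF q_nz] by blast

lemma nonres_dual: "nonres q (a * q / c)" "nonres q (b * q / c)" "nonres q (q\<^sup>2 / c)"
  using nonres_inverse[OF q_nz _ nonres_params(3), of "a * q / c" 1]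
    nonres_inverse[OF q_nz _ nonres_params(4), of "b * q / c" 1]
    nonres_inverse[OF q_nz _ nrc, of "q\<^sup>2 / c" 2] params_nz
  by auto

text \<open>
  The two solutions at the same shift split off the same product, so it factors out of the whole determinant.
\<close>

lemma origin_f_factorization: "origin_f q a b c k l m = qbin q (a * b / c * q powi (k + l - m)) * origin_f_reduced q a b c k l m"
proof -
  have e: "a * q powi k * (b * q powi l) / (c * q powi m) = a * b / c * q powi (k + l - m)"
    "c * q powi m / (a * q powi k) = c * q powi (m - k) / a" "c * q powi m / (b * q powi l) = c * q powi (m - l) / b"
    using q_nz by (simp_all add: power_int_add power_int_diff)
  show ?thesis
    unfolding origin_f_def origin_f_reduced_def
    using heine_euler_transformation[OF q nonres_powi[OF nrc], of "a * q powi k" "b * q powi l" m]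
      q_nz params_nz unfolding e by simp
qed

lemma origin_g_factorization: "origin_g q a b c k l m = qbin q (a * b / c * q powi (k + l - m)) * origin_g_reduced q a b c k l m"
proof -
  have e: "a * q / c * q powi (k - m) * (b * q / c * q powi (l - m)) / (q\<^sup>2 / c * q powi (- m))
      = a * b / c * q powi (k + l - m)"
    "q\<^sup>2 / c * q powi (- m) / (a * q / c * q powi (k - m)) = q powi (1 - k) / a"
    "q\<^sup>2 / c * q powi (- m) / (b * q / c * q powi (l - m)) = q powi (1 - l) / b"
    using q_nz params_nz by (simp_all add: power_int_add power_int_diff power_int_minus power2_eq_square field_simps)
  show ?thesis
    unfolding origin_g_def origin_g_reduced_def
    using heine_euler_transformation[OF q nonres_powi[OF nonres_dual(3)],
        of "a * q / c * q powi (k - m)" "b * q / c * q powi (l - m)" "- m"]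
      q_nz params_nz unfolding e by simp
qed

lemma coeff_B_nth: "coeff_B k l m a b c q (int n) = (origin_g q a b c 0 0 0 * origin_f_reduced q a b c k l m) $ n"
proof -
  have e: "q powi (1 - int n) / (q\<^sup>2 / c) = c * q powi (- int n - 1)"
    "q powi (1 - int n) / (a * q / c) = c * q powi (- int n) / a"
    "q powi (1 - int n) / (b * q / c) = c * q powi (- int n) / b"
    "q * (q\<^sup>2 / c) * (a * b / c * q powi (k + l - m)) / (a * q / c * (b * q / c) * 1) = q powi (k + l - m + 1)"
    using q_nz params_nz by (simp_all add: power_int_add power_int_diff power_int_minus power2_eq_square field_simps)
  have "(origin_g q a b c 0 0 0 * origin_f_reduced q a b c k l m) $ n = origin_g q a b c 0 0 0 $ n *
     phi43 (q powi (- int n)) (c * q powi (- int n - 1)) (c * q powi (m - k) / a) (c * q powi (m - l) / b)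
              (c * q powi m) (c * q powi (- int n) / a) (c * q powi (- int n) / b)
              q (q powi (k + l - m + 1))"
    unfolding origin_g_def origin_f_reduced_def
    using hyp_mult_nth[OF q nonres_dual, of 1 "c * q powi (m - k) / a" "c * q powi (m - l) / b" "c * q powi m"
        "a * b / c * q powi (k + l - m)" n] params_nz q_nz unfolding e by simp
  thus ?thesis by (simp add: coeff_B_def origin_g_def hyp_def)
qed

lemma coeff_Bt_nth: "coeff_Bt k l m a b c q (int n) = (origin_g_reduced q a b c 0 0 0 * origin_f q a b c k l m) $ n"
proof -
  have nr: "nonres q (q / a)" "nonres q (q / b)"
    using nonres_inverse[OF q_nz _ nonres_params(1), of _ 1] nonres_inverse[OF q_nz _ nonres_params(2), of _ 1] params_nz
    by auto
  have e: "q powi (1 - int n) / (q\<^sup>2 / c) = c * q powi (- int n - 1)"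
    "q powi (1 - int n) / (q / a) = a * q powi (- int n)"
    "q powi (1 - int n) / (q / b) = b * q powi (- int n)"
    "q * (q\<^sup>2 / c) * 1 / (q / a * (q / b) * (a * b / c)) = q"
    using q_nz params_nz by (simp_all add: power_int_add power_int_diff power_int_minus power2_eq_square field_simps)
  have "(origin_g_reduced q a b c 0 0 0 * origin_f q a b c k l m) $ n = origin_g_reduced q a b c 0 0 0 $ n *
     phi43 (q powi (- int n)) (c * q powi (- int n - 1)) (a * q powi k) (b * q powi l)
              (c * q powi m) (a * q powi (- int n)) (b * q powi (- int n)) q q"
    unfolding origin_g_reduced_def origin_f_def
    using hyp_mult_nth[OF q nr nonres_dual(3), of "a * b / c" "a * q powi k" "b * q powi l" "c * q powi m" 1 n]
      params_nz q_nz unfolding e by simp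
  moreover have "origin_g_reduced q a b c 0 0 0 $ n = qpoch (a * q powi (- int n)) q (int n) * qpoch (b * q powi (- int n)) q (int n) /
           (qpoch (q powi (- int n)) q (int n) * qpoch (c * q powi (- int n - 1)) q (int n)) * q powi (- int n)"
  proof -
    define E where "E = qtri q n"
    define Q where "Q = q ^ n"
    have E: "E \<noteq> 0" and Q: "Q \<noteq> 0" using q_nz by (auto simp: E_def Q_def)
    have rev: "qpoch w q (int n) * E = qpoch (q powi (1 - int n) / w) q (int n) * (- w * Q) ^ n" if "w \<noteq> 0" for w
      using qpoch_reverse[OF q_nz that, of "int n" n] by (simp add: E_def Q_def)
    have qn: "q powi (1 - int n) / q = q powi (- int n)"
      using q_nz by (simp add: power_int_diff power_int_minus field_simps)
    define a1 a2 a3 a4 where "a1 = qpoch (a * q powi (- int n)) q (int n)"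
      and "a2 = qpoch (b * q powi (- int n)) q (int n)"
      and "a3 = qpoch (c * q powi (- int n - 1)) q (int n)" and "a4 = qpoch (q powi (- int n)) q (int n)"
    define d1 d2 d3 d4 where "d1 = qpoch (q / a) q (int n)" and "d2 = qpoch (q / b) q (int n)"
      and "d3 = qpoch (q\<^sup>2 / c) q (int n)" and "d4 = qpoch q q (int n)"
    have r: "d1 * E = a1 * (- (q / a) * Q) ^ n" "d2 * E = a2 * (- (q / b) * Q) ^ n"
      "d3 * E = a3 * (- (q\<^sup>2 / c) * Q) ^ n" "d4 * E = a4 * (- q * Q) ^ n"
      using rev[of "q / a"] rev[of "q / b"] rev[of "q\<^sup>2 / c"] rev[of q] q_nz params_nz unfolding qn e
      by (simp_all add: a1_def a2_def a3_def a4_def d1_def d2_def d3_def d4_def)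
    have nz: "d3 \<noteq> 0" "d4 \<noteq> 0"
      using nonres_dual q by (simp_all add: d3_def d4_def qpoch_nonres qpoch_q_neq_0)
    hence nz': "a3 \<noteq> 0" "a4 \<noteq> 0" using r E by auto
    have "(- (q / a) * Q) ^ n * (- (q / b) * Q) ^ n * (a * b / c) ^ n * q ^ n = (- (q\<^sup>2 / c) * Q) ^ n * (- q * Q) ^ n"
      unfolding power_mult_distrib[symmetric] using params_nz
      by (intro arg_cong[of _ _ "\<lambda>u. u ^ n"]) (simp add: field_simps power2_eq_square)
    hence w: "(- (q / a) * Q) ^ n * (- (q / b) * Q) ^ n * (a * b / c) ^ n / ((- (q\<^sup>2 / c) * Q) ^ n * (- q * Q) ^ n) = 1 / q ^ n"
      using q_nz params_nz Q by (simp add: frac_eq_eq)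
    have "d1 * d2 / (d4 * d3) * (a * b / c) ^ n = (d1 * E) * (d2 * E) / ((d4 * E) * (d3 * E)) * (a * b / c) ^ n"
      using E by simp
    also have "\<dots> = a1 * a2 / (a4 * a3) * ((- (q / a) * Q) ^ n * (- (q / b) * Q) ^ n * (a * b / c) ^ n / ((- (q\<^sup>2 / c) * Q) ^ n * (- q * Q) ^ n))"
      unfolding r unfolding divide_inverse inverse_mult_distrib by (simp only: mult_ac)
    also have "\<dots> = a1 * a2 / (a4 * a3) * q powi (- int n)"
      unfolding w by (simp add: power_int_minus divide_inverse)
    finally show ?thesis
      unfolding origin_g_reduced_def hyp_def a1_def a2_def a3_def a4_def d1_def d2_def d3_def d4_def by simp
  qed
  ultimately show ?thesis by (simp add: coeff_Bt_def)
qed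

lemma coeff_At_nth: "coeff_At k l m a b c q (int n) = normalization_ratio q a b c k l m * (origin_g q a b c k l m * origin_f_reduced q a b c 0 0 0) $ n"
proof -
  have e: "q powi (1 - int n) / (q\<^sup>2 / c * q powi (- m)) = c * q powi (m - int n - 1)"
    "q powi (1 - int n) / (a * q / c * q powi (k - m)) = c * q powi (m - k - int n) / a"
    "q powi (1 - int n) / (b * q / c * q powi (l - m)) = c * q powi (m - l - int n) / b"
    "q * (q\<^sup>2 / c * q powi (- m)) * (a * b / c) / (a * q / c * q powi (k - m) * (b * q / c * q powi (l - m)) * 1)
      = q powi (m - k - l + 1)"
    using q_nz params_nz by (simp_all add: power_int_add power_int_diff power_int_minus power2_eq_square field_simps)
  have "(origin_g q a b c k l m * origin_f_reduced q a b c 0 0 0) $ n = origin_g q a b c k l m $ n *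
     phi43 (q powi (- int n)) (c * q powi (m - int n - 1)) (c / a) (c / b)
              c (c * q powi (m - k - int n) / a) (c * q powi (m - l - int n) / b)
              q (q powi (m - k - l + 1))"
    unfolding origin_g_def origin_f_reduced_def
    using hyp_mult_nth[OF q nonres_powi[OF nonres_dual(1), of "k - m"] nonres_powi[OF nonres_dual(2), of "l - m"]
        nonres_powi[OF nonres_dual(3), of "- m"], of 1 "c / a" "c / b" c "a * b / c" n]
      params_nz q_nz unfolding e by simp
  moreover have "normalization_ratio q a b c k l m * origin_g q a b c k l m $ n = qpoch c q m / (qpoch a q k * qpoch b q l) *
        (qpoch (a * q / c) q (int n + k - m) * qpoch (b * q / c) q (int n + l - m) /
           (qpoch q q (int n) * qpoch (q\<^sup>2 / c) q (int n - m)))"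
  proof -
    have i: "int n + k - m = (k - m) + int n" "int n + l - m = (l - m) + int n" "int n - m = - m + int n" by simp_all
    show ?thesis
      unfolding i qpoch_add[OF q_nz nonres_dual(1)] qpoch_add[OF q_nz nonres_dual(2)] qpoch_add[OF q_nz nonres_dual(3)]
      by (simp add: normalization_ratio_def origin_g_def hyp_def mult_ac)
  qed
  ultimately show ?thesis by (simp add: coeff_At_def mult.assoc[symmetric])
qed

text \<open>
  The reversed factorials of \<^const>\<open>origin_g_reduced\<close> have bases that are reciprocal to \<open>a\<close>, \<open>b\<close>, \<open>c\<close>; reading them
  backwards once more turns the leading coefficient into the stated prefactor.
\<close>

lemma coeff_A_nth: "coeff_A k l m a b c q (int n) = normalization_ratio q a b c k l m * (origin_g_reduced q a b c k l m * origin_f q a b c 0 0 0) $ n"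
proof -
  define A B C d where "A = q powi (1 - k) / a" and "B = q powi (1 - l) / b" and "C = q\<^sup>2 / c * q powi (- m)"
    and "d = a * b / c * q powi (k + l - m)"
  have nr: "nonres q A" "nonres q B" "nonres q C"
    using nonres_inverse[OF q_nz _ nonres_params(1), of A "1 - k"] nonres_inverse[OF q_nz _ nonres_params(2), of B "1 - l"]
      nonres_powi[OF nonres_dual(3), of "- m"] params_nz
    by (auto simp: A_def B_def C_def)
  have ne: "A \<noteq> 0" "B \<noteq> 0" "C \<noteq> 0" "d \<noteq> 0"
    using q_nz params_nz by (auto simp: A_def B_def C_def d_def)
  have e: "q powi (1 - int n) / C = c * q powi (m - int n - 1)"
    "q powi (1 - int n) / A = a * q powi (k - int n)"
    "q powi (1 - int n) / B = b * q powi (l - int n)"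
    "q * C * 1 / (A * B * d) = q"
    using q_nz params_nz
    by (simp_all add: A_def B_def C_def d_def power_int_add power_int_diff power_int_minus power2_eq_square field_simps)
  have 1: "(origin_g_reduced q a b c k l m * origin_f q a b c 0 0 0) $ n = origin_g_reduced q a b c k l m $ n *
     phi43 (q powi (- int n)) (c * q powi (m - int n - 1)) a b
              c (a * q powi (k - int n)) (b * q powi (l - int n)) q q"
    unfolding origin_g_reduced_def origin_f_def A_def[symmetric] B_def[symmetric] C_def[symmetric] d_def[symmetric]
    using hyp_mult_nth[OF q nr ne, of a b c 1 n] unfolding e by simp
  have 2: "normalization_ratio q a b c k l m * origin_g_reduced q a b c k l m $ n =
     - c * qpoch (a * q / c) q (k - m) * qpoch (b * q / c) q (l - m) / qpoch (q\<^sup>2 / c) q (- m - 1) *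
        (qpoch c q (m - int n - 1) / (qpoch (q powi (- int n)) q (int n) * qpoch a q (k - int n) * qpoch b q (l - int n))) *
        q powi (m - int n - 1)"
  proof -
    define E where "E = qtri q n"
    define Q where "Q = q ^ n"
    have E: "E \<noteq> 0" "E * E = Q ^ n * q ^ n" and Q: "Q \<noteq> 0"
      using q_nz qtri_square[of q n] by (auto simp: E_def Q_def power_mult_distrib mult.commute)
    define d1 d2 d3 d4 where "d1 = qpoch A q (int n)" and "d2 = qpoch B q (int n)"
      and "d3 = qpoch C q (int n)" and "d4 = qpoch q q (int n)"
    define x1 x2 x3 x4 where "x1 = qpoch a q (k - int n)" and "x2 = qpoch b q (l - int n)"
      and "x3 = qpoch c q (m - int n - 1)" and "x4 = qpoch (q powi (- int n)) q (int n)"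
    define p where "p = q powi (m - 1)"
    define g where "g = qpoch (q\<^sup>2 / c) q (- m - 1)"
    have p: "p \<noteq> 0" using q_nz by (simp add: p_def)
    have rev: "qpoch w q N * E = qpoch w q (N - int n) * qpoch (q powi (1 - N) / w) q (int n) * (- w * q powi N) ^ n"
      if "w \<noteq> 0" "nonres q w" for w N
      unfolding E_def by (rule qpoch_reverse[OF q_nz that(1)]) (use nonresD[OF that(2)] in auto)
    have ra: "qpoch a q k * E = x1 * d1 * (- a * q powi k) ^ n"
      using rev[OF params_nz(1) nonres_params(1), of k] by (simp add: x1_def d1_def A_def)
    have rb: "qpoch b q l * E = x2 * d2 * (- b * q powi l) ^ n"
      using rev[OF params_nz(2) nonres_params(2), of l] by (simp add: x2_def d2_def B_def)
    have "q powi (1 - (m - 1)) / c = C" using q_nz by (simp add: C_def power_int_diff power_int_minus divide_inverse mult_ac)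
    hence rc: "qpoch c q (m - 1) * E = x3 * d3 * (- c * p) ^ n"
      using rev[OF params_nz(3) nrc, of "m - 1"] by (simp add: x3_def d3_def p_def algebra_simps)
    have qn: "q powi (1 - int n) / q = q powi (- int n)"
      using q_nz by (simp add: power_int_diff power_int_minus field_simps)
    have rq: "d4 * E = x4 * (- q * Q) ^ n"
      using qpoch_reverse[OF q_nz q_nz, of "int n" n] by (simp add: d4_def x4_def Q_def E_def qn)
    have cm: "qpoch c q m = (1 - c * p) * qpoch c q (m - 1)"
      using qpoch_step[of "m - 1" c q] nonresD[OF nrc] by (simp add: p_def)
    have gm: "qpoch (q\<^sup>2 / c) q (- m) = (1 - 1 / (c * p)) * g"
    proof -
      have "qpoch (q\<^sup>2 / c) q (- m - 1 + 1) = (1 - q\<^sup>2 / c * q powi (- m - 1)) * g"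
        unfolding g_def by (rule qpoch_step) (use nonresD[OF nonres_dual(3)] in auto)
      moreover have "q\<^sup>2 / c * q powi (- m - 1) = 1 / (c * p)"
        using q_nz params_nz by (simp add: p_def power_int_diff power_int_minus power2_eq_square field_simps)
      ultimately show ?thesis by simp
    qed
    have nz: "d1 \<noteq> 0" "d2 \<noteq> 0" "d3 \<noteq> 0" "d4 \<noteq> 0" "x1 \<noteq> 0" "x2 \<noteq> 0" "x3 \<noteq> 0" "g \<noteq> 0"
      using nr nonres_params nrc nonres_dual q
      by (simp_all add: d1_def d2_def d3_def d4_def x1_def x2_def x3_def g_def qpoch_nonres qpoch_q_neq_0)
    have x4: "x4 \<noteq> 0" using rq nz E by auto
    have cp: "1 - c * p \<noteq> 0" "c * p \<noteq> 0"
      using nonresD[OF nrc, of "m - 1"] params_nz p by (auto simp: p_def)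
    hence cmg: "(1 - c * p) / (1 - 1 / (c * p)) = - (c * p)" by (simp add: field_simps)
    define \<alpha> \<beta> where "\<alpha> = (- a * q powi k) ^ n" and "\<beta> = (- b * q powi l) ^ n"
    have ab: "\<alpha> \<noteq> 0" "\<beta> \<noteq> 0" using q_nz params_nz by (auto simp: \<alpha>_def \<beta>_def)
    have dn: "d ^ n * ((- c * p) ^ n * q ^ n) = \<alpha> * \<beta> * (- 1) ^ n"
      unfolding \<alpha>_def \<beta>_def power_mult_distrib[symmetric] d_def p_def using q_nz params_nz
      by (intro arg_cong[of _ _ "\<lambda>u. u ^ n"]) (simp add: power_int_add power_int_diff field_simps)
    have qQ: "(- q * Q) ^ n = (- 1) ^ n * (E * E)" unfolding E(2)
      by (simp add: power_mult_distrib[symmetric] mult.commute)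
    have sq: "(- 1) ^ n * (- 1) ^ n = (1 :: complex)" by (simp flip: power_mult_distrib)
    have ka: "1 / qpoch a q k = E / (x1 * d1 * \<alpha>)" and kb: "1 / qpoch b q l = E / (x2 * d2 * \<beta>)"
    proof -
      have "qpoch a q k = x1 * d1 * \<alpha> / E" "qpoch b q l = x2 * d2 * \<beta> / E"
        using ra rb E by (simp_all add: \<alpha>_def \<beta>_def field_simps)
      thus "1 / qpoch a q k = E / (x1 * d1 * \<alpha>)" "1 / qpoch b q l = E / (x2 * d2 * \<beta>)" by simp_all
    qed
    have kc: "qpoch c q (m - 1) = x3 * d3 * (- c * p) ^ n / E" using rc E by (simp add: field_simps)
    have kq: "1 / d4 = 1 / (x4 * (- 1) ^ n * E)"
    proof -
      have "d4 * E = (x4 * (- 1) ^ n * E) * E" using rq unfolding qQ by (simp only: mult_ac)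
      thus ?thesis using E by simp
    qed
    have main: "qpoch c q m / (qpoch a q k * qpoch b q l) * (1 / qpoch (q\<^sup>2 / c) q (- m)) * (d1 * d2 / (d4 * d3) * d ^ n)
      = - c / g * (x3 / (x4 * x1 * x2)) * (p / q ^ n)"
    proof -
      have "qpoch c q m / (qpoch a q k * qpoch b q l) * (1 / qpoch (q\<^sup>2 / c) q (- m)) * (d1 * d2 / (d4 * d3) * d ^ n)
         = ((1 - c * p) / (1 - 1 / (c * p))) * qpoch c q (m - 1) / g * (1 / qpoch a q k) * (1 / qpoch b q l) * (1 / d4) * (d1 * d2 / d3) * d ^ n"
        unfolding cm gm unfolding divide_inverse inverse_mult_distrib by (simp only: mult_ac mult_1_left)
      also have "\<dots> = - (c * p) / g * (x3 / (x4 * x1 * x2)) * (d ^ n * (- c * p) ^ n / (\<alpha> * \<beta> * (- 1) ^ n))"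
        unfolding cmg kc ka kb kq using nz E by (simp add: field_simps)
      also have "d ^ n * (- c * p) ^ n / (\<alpha> * \<beta> * (- 1) ^ n) = 1 / q ^ n"
        using dn ab q_nz by (simp add: frac_eq_eq mult_ac)
      finally show ?thesis by simp
    qed
    have pw: "q powi (m - int n - 1) = p / q ^ n" using q_nz by (simp add: p_def power_int_diff)
    have "normalization_ratio q a b c k l m * origin_g_reduced q a b c k l m $ n = qpoch (a * q / c) q (k - m) * qpoch (b * q / c) q (l - m) *
       (qpoch c q m / (qpoch a q k * qpoch b q l) * (1 / qpoch (q\<^sup>2 / c) q (- m)) * (d1 * d2 / (d4 * d3) * d ^ n))"
      by (simp add: normalization_ratio_def origin_g_reduced_def hyp_def A_def B_def C_def d_def d1_def d2_def d3_def d4_def)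
    also have "\<dots> = - c * qpoch (a * q / c) q (k - m) * qpoch (b * q / c) q (l - m) / g *
        (x3 / (x4 * x1 * x2)) * q powi (m - int n - 1)"
      unfolding main pw by simp
    finally show ?thesis unfolding g_def x1_def x2_def x3_def x4_def .
  qed
  show ?thesis unfolding 1 mult.assoc[symmetric] 2 by (simp add: coeff_A_def)
qed






section \<open>The determinant of two solutions at the origin\<close>

lemma nonres_free: "nonres q u \<Longrightarrow> pole_free q u" "nonres q u \<Longrightarrow> zero_free q u"
  by (auto simp: pole_free_def zero_free_def nonres_def)

lemma q_powi_neq_1: "j \<noteq> 0 \<Longrightarrow> q powi j \<noteq> 1"
  using not_root_of_unity[OF q] by blast

lemma free_special: "zero_free q q" "pole_free q 1"
proof -
  have "q * q powi j = q powi (1 + j)" for j using q_nz by (simp add: power_int_add)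
  thus "zero_free q q" using q_powi_neq_1 by (auto simp: zero_free_def)
  show "pole_free q 1" using q_powi_neq_1 by (auto simp: pole_free_def)
qed

lemma contiguous_system_f: "contiguous q a b c fls_X (system_f q a b c)"
proof (rule contiguous_at_origin[OF q_nz, where z = 1])
  fix k l m n
  show "system_f q a b c k l m $$ n = bilateral q a b c 1 k l m n"
  proof (cases "n \<ge> 0")
    case False
    thus ?thesis using qpoch_q_neg[OF q_nz] by (simp add: system_f_def bilateral_def)
  next
    case True
    then obtain j where j: "n = int j" using nonneg_int_cases by blast
    have s: "qpoch u q (int j + i) = qpoch u q i * qpoch (u * q powi i) q (int j)" if "nonres q u" for u i
      using qpoch_add[OF q_nz that, of i "int j"] by (simp add: add.commute)
    show ?thesis
      using nonres_params nrc
      by (simp add: system_f_def bilateral_def j origin_f_def hyp_def s divide_inverse mult_ac)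
  qed
qed (use nonres_params nrc free_special nonres_free in auto)

lemma contiguous_system_g: "contiguous q a b c fls_X (system_g q a b c)"
proof (rule contiguous_at_origin[OF q_nz, where z = "q / c"])
  note nr = nonres_dual
  have e: "a * (q / c) = a * q / c" "b * (q / c) = b * q / c" "c * (q / c) = q" "q * (q / c) = q\<^sup>2 / c"
    using params_nz by (simp_all add: power2_eq_square)
  fix k l m n
  show "system_g q a b c k l m $$ n = bilateral q a b c (q / c) k l m n"
  proof (cases "n + m \<ge> 0")
    case False
    thus ?thesis using qpoch_q_neg[OF q_nz, of "n + m"] unfolding bilateral_def e
      by (simp add: system_g_def mult.assoc fls_X_intpow_times_conv_shift)
  next
    case True
    then obtain j where "n + m = int j" using nonneg_int_cases by blast
    hence j: "n = int j - m" by simp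
    have s: "qpoch u q (int j + i) = qpoch u q i * qpoch (u * q powi i) q (int j)" if "nonres q u" for u i
      using qpoch_add[OF q_nz that, of i "int j"] by (simp add: add.commute)
    have i: "int j - m + k = int j + (k - m)" "int j - m + l = int j + (l - m)" "int j - m + m = int j"
      "int j - m = int j + - m" by simp_all
    show ?thesis unfolding bilateral_def e j unfolding i(1-3) unfolding i(4) s[OF nr(1)] s[OF nr(2)] s[OF nr(3)]
      by (simp add: system_g_def origin_g_def hyp_def fls_X_intpow_times_conv_shift divide_inverse mult_ac)
  qed
next
  have e: "a * (q / c) = a * q / c" "b * (q / c) = b * q / c" "c * (q / c) = q" "q * (q / c) = q\<^sup>2 / c"
    using params_nz by (simp_all add: power2_eq_square)
  show "pole_free q (a * (q / c))" "pole_free q (b * (q / c))" "zero_free q (c * (q / c))" "zero_free q (q * (q / c))"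
    unfolding e using nonres_dual free_special nonres_free by auto
qed

lemma system_000: "system_f q a b c 0 0 0 = fps_to_fls (origin_f q a b c 0 0 0)" "system_g q a b c 0 0 0 = fps_to_fls (origin_g q a b c 0 0 0)"
  by (simp_all add: system_f_def system_g_def)

lemma casoratian_conv_system:
  "casoratian q a b c k l m = fls_const (qpoch c q m / (qpoch a q k * qpoch b q l)) *
     (system_g q a b c k l m * system_f q a b c 0 0 0 - system_f q a b c k l m * system_g q a b c 0 0 0)"
proof -
  have nz: "qpoch a q k \<noteq> 0" "qpoch b q l \<noteq> 0" "qpoch c q m \<noteq> 0"
    using nonres_params nrc by (simp_all add: qpoch_nonres)
  have 1: "qpoch c q m / (qpoch a q k * qpoch b q l) * (qpoch a q k * qpoch b q l / qpoch c q m) = 1"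
    using nz by simp
  have "fls_const (qpoch c q m / (qpoch a q k * qpoch b q l)) * system_f q a b c k l m = fps_to_fls (origin_f q a b c k l m)"
    unfolding system_f_def mult.assoc[symmetric] fls_const_mult_const 1 by simp
  moreover have "fls_const (qpoch c q m / (qpoch a q k * qpoch b q l)) * system_g q a b c k l m
     = fls_const (normalization_ratio q a b c k l m) * fls_X_intpow (- m) * fps_to_fls (origin_g q a b c k l m)"
    unfolding system_g_def normalization_ratio_def by (simp only: mult.assoc[symmetric] fls_const_mult_const)
  ultimately show ?thesis unfolding casoratian_def system_000[symmetric] right_diff_distrib mult.assoc[symmetric] by simp
qed

text \<open>
  This is the q-Abel formula for the parameters \<open>a / q\<close>, \<open>b / q\<close>, \<open>c / q\<close>.
\<close>

lemma casoratian_minus_one: "casoratian q a b c (- 1) (- 1) (- 1) = - fps_to_fls (qbin q (a * b / c))"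
proof -
  have m1: "qpoch u q (- 1) = 1 / (1 - u / q)" for u
    using qpoch_neg_Suc[of u q 0] by (simp add: power_int_minus divide_inverse)
  have p1: "qpoch u q 1 = 1 - u" for u using qpoch_Suc[of u q 0] by simp
  have nrc': "nonres q (c / q)"
    by (rule nonres_shift[OF q_nz nrc, of _ "-1"]) (simp add: power_int_minus divide_inverse)
  have e: "a / q * q / (c / q) = a * q / c" "b / q * q / (c / q) = b * q / c" "q\<^sup>2 / (c / q) = q\<^sup>2 / c * q"
    "q / (c / q) = q\<^sup>2 / c" "a / q * q = a" "b / q * q = b" "c / q * q = c" "a / q * (b / q) * q / (c / q) = a * b / c"
    using q_nz by (simp_all add: power2_eq_square)
  have l: "normalization_ratio q a b c (- 1) (- 1) (- 1) = (1 - a / q) * (1 - b / q) / ((1 - c / q) * (1 - q\<^sup>2 / c))"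
    by (simp add: normalization_ratio_def m1 p1)
  have "fps_const (normalization_ratio q a b c (- 1) (- 1) (- 1)) * fps_X * origin_g q a b c (- 1) (- 1) (- 1) * origin_f q a b c 0 0 0
     - origin_f q a b c (- 1) (- 1) (- 1) * origin_g q a b c 0 0 0 = - qbin q (a * b / c)"
    using qhyp_casoratian[OF q nrc', of "a / q" "b / q"] params_nz q_nz unfolding e l
    by (simp add: origin_f_def origin_g_def power_int_minus divide_inverse mult_ac)
  from arg_cong[OF this, of fps_to_fls] show ?thesis
    unfolding casoratian_def by (simp add: fls_times_fps_to_fls fps_to_fls_minus flip: fls_X_conv_shift_1)
qed


lemma qprod_casoratian:
  "peval (qprod q (a * b / c) (nat (k + l - m))) fls_X * casoratian q a b c k l m = fps_to_fls (qbin q (a * b / c)) * casoratian_quotient q a b c k l m"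
proof (cases "k + l - m \<ge> 0")
  case True
  define d where "d = a * b / c * q powi (k + l - m)"
  have A: "Abs_fps (\<lambda>n. coeff_A k l m a b c q (int n)) = fps_const (normalization_ratio q a b c k l m) * (origin_g_reduced q a b c k l m * origin_f q a b c 0 0 0)"
    by (rule fps_ext) (simp add: coeff_A_nth)
  have B: "Abs_fps (\<lambda>n. coeff_B k l m a b c q (int n)) = origin_g q a b c 0 0 0 * origin_f_reduced q a b c k l m"
    by (rule fps_ext) (simp add: coeff_B_nth)
  have "casoratian q a b c k l m = fps_to_fls (qbin q d) * casoratian_quotient q a b c k l m"
    using True unfolding casoratian_def casoratian_quotient_def A B origin_f_factorization[of k l m] origin_g_factorization[of k l m] d_def[symmetric]
    by (simp add: fls_times_fps_to_fls algebra_simps)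
  moreover have "d = a * b / c * q ^ nat (k + l - m)" using True by (simp add: d_def power_int_def)
  ultimately show ?thesis
    using qbin_qprod[OF q, of "a * b / c" "nat (k + l - m)"]
    by (simp add: peval_X mult.assoc[symmetric] fls_times_fps_to_fls[symmetric])
next
  case False
  have A: "Abs_fps (\<lambda>n. coeff_At k l m a b c q (int n)) = fps_const (normalization_ratio q a b c k l m) * (origin_g q a b c k l m * origin_f_reduced q a b c 0 0 0)"
    by (rule fps_ext) (simp add: coeff_At_nth)
  have B: "Abs_fps (\<lambda>n. coeff_Bt k l m a b c q (int n)) = origin_g_reduced q a b c 0 0 0 * origin_f q a b c k l m"
    by (rule fps_ext) (simp add: coeff_Bt_nth)
  have "casoratian q a b c k l m = fps_to_fls (qbin q (a * b / c)) * casoratian_quotient q a b c k l m"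
    using False unfolding casoratian_def casoratian_quotient_def A B origin_f_factorization[of 0 0 0] origin_g_factorization[of 0 0 0]
    by (simp add: fls_times_fps_to_fls algebra_simps)
  thus ?thesis using False by (simp add: is_homD(2)[OF is_hom_peval])
qed

lemma qbin_neq_0: "qbin q d \<noteq> 0"
  using qbin_0[of q d] by (metis fps_zero_nth zero_neq_one)

text \<open>
  The solution with exponent \<open>w = a\<close> at infinity is $x^{-k}$ times a series in $1/x$, the one with \<open>w = b\<close> is $x^{-l}$ times
  such a series. The coefficients of index $0$ and $-1$ serve to show that their determinant does not vanish.
\<close>

lemma infinity_solutions:
  assumes "w = a \<or> w = b"
  obtains H where "contiguous q a b c fls_X_inv H"
    "\<And>k l m n. n < (if w = a then k else l) \<Longrightarrow> H k l m $$ n = 0"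
    "H 0 0 0 $$ 0 = 1" "H (- 1) (- 1) (- 1) $$ (- 1) = 1 / (1 - q / w)"
proof -
  have ab: "nonres q (b / a)" "nonres q (a / b)"
    using gen generic_swap[OF gen] by (auto simp: generic_def)
  have qw: "nonres q (q / a)" "nonres q (q / b)"
    using nonres_inverse[OF q_nz _ nonres_params(1), of _ 1]
      nonres_inverse[OF q_nz _ nonres_params(2), of _ 1] params_nz by auto
  have w: "w \<noteq> 0" using assms params_nz by auto
  have ne: "a \<noteq> b" using nonresD[OF ab(1), of 0] params_nz by auto
  define H where "H = (\<lambda>k l m. Abs_fls (\<lambda>n. bilateral q a b c (1 / w) k l m (- n)))"
  have one0: "qpoch 1 q n = 0" if "n > 0" for n
  proof -
    have "\<exists>j\<in>{..<nat n}. 1 - 1 * q ^ j = 0" using that by (intro bexI[of _ 0]) auto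
    thus ?thesis using that by (auto simp: qpoch_def intro!: prod_zero)
  qed
  have van: "bilateral q a b c (1 / w) k l m (- n) = 0" if "n < (if w = a then k else l)" for k l m n
    using that assms w one0[of "k - n"] one0[of "l - n"] ne by (auto simp: bilateral_def)
  have nth: "H k l m $$ n = bilateral q a b c (1 / w) k l m (- n)" for k l m n
    unfolding H_def by (rule nth_Abs_fls_lower_bound[of "if w = a then k else l"]) (use van in auto)
  show ?thesis
  proof (rule that[of H])
    show "contiguous q a b c fls_X_inv H"
      by (rule contiguous_at_infinity[OF q_nz, where z = "1 / w"])
        (use assms ab nonres_params qw free_special nonres_free w nth in auto)
    show "H k l m $$ n = 0" if "n < (if w = a then k else l)" for k l m n
      using van[OF that] nth by simp
    have p1: "qpoch u q 1 = 1 - u" for u using qpoch_Suc[of u q 0] by simp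
    show "H 0 0 0 $$ 0 = 1" "H (- 1) (- 1) (- 1) $$ (- 1) = 1 / (1 - q / w)"
      by (simp_all add: nth bilateral_def p1 divide_inverse)
  qed
qed

text \<open>
  Let \<open>r\<close> be the coefficient of \<open>H (-1) (-1) (-1)\<close> in the reduction of \<open>H k l m\<close>. By Cramer's rule at the origin the
  series in question is \<open>r\<close> up to a constant and a power of \<open>x\<close>. By Cramer's rule at infinity the degree of \<open>r\<close>
  is that of a quotient of two determinants: the numerator grows at most like $x^{-\min(k,l)}$ apart from the
  cleared denominators, and the denominator exactly like $x$.
\<close>

lemma casoratian_quotient_vanishes:
  assumes kl: "k \<le> l" and j: "j \<ge> max (k + l - m) 0 - k"
  shows "casoratian_quotient q a b c k l m $$ j = 0"
proof -
  define n where "n = nat (k + l - m)"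
  define den where "den = qprod q (a * b / c) n"
  obtain N p r where red: "\<And>X H. contiguous q a b c X H \<Longrightarrow>
      X ^ N * (peval den X * H k l m) = peval p X * H 0 0 0 + peval r X * H (- 1) (- 1) (- 1)"
    using contiguous_reduction[OF gen, of k l m] unfolding in_span_def den_def n_def by blast
  have cramer: "X ^ N * peval den X * (G k l m * H 0 0 0 - H k l m * G 0 0 0)
     = peval r X * (G (- 1) (- 1) (- 1) * H 0 0 0 - H (- 1) (- 1) (- 1) * G 0 0 0)"
    if "contiguous q a b c X H" "contiguous q a b c X G" for X H G
  proof -
    have "X ^ N * peval den X * (G k l m * H 0 0 0 - H k l m * G 0 0 0)
      = (X ^ N * (peval den X * G k l m)) * H 0 0 0 - (X ^ N * (peval den X * H k l m)) * G 0 0 0"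
      by (simp add: algebra_simps)
    thus ?thesis unfolding red[OF that(1)] red[OF that(2)] by (simp add: algebra_simps)
  qed
  have deg: "coeff r i = 0" if i: "int i \<ge> int N + int n - k" for i
  proof (rule ccontr)
    assume "coeff r i \<noteq> 0"
    hence r0: "r \<noteq> 0" and "i \<le> degree r" by (auto simp: le_degree)
    hence dr: "int (degree r) \<ge> int N + int n - k" using i by simp
    obtain H where H: "contiguous q a b c fls_X_inv H" "\<And>k l m n. n < k \<Longrightarrow> H k l m $$ n = 0"
      "H 0 0 0 $$ 0 = 1" "H (- 1) (- 1) (- 1) $$ (- 1) = 1 / (1 - q / a)"
      using infinity_solutions[of a] by auto
    have ne: "b \<noteq> a" using nonresD[of q "a / b" 0] gen params_nz by (auto simp: generic_def)
    obtain G where G: "contiguous q a b c fls_X_inv G" "\<And>k l m n. n < l \<Longrightarrow> G k l m $$ n = 0"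
      "G 0 0 0 $$ 0 = 1" "G (- 1) (- 1) (- 1) $$ (- 1) = 1 / (1 - q / b)"
      using infinity_solutions[of b] ne by auto
    have L1: "(peval den fls_X_inv :: complex fls) $$ i = 0" if "i < - int n" for i
      using that degree_qprod[of q "a * b / c" n] by (auto simp: peval_X_inv_nth den_def coeff_eq_0)
    have L2: "(fls_X_inv ^ N :: complex fls) $$ i = 0" if "i < - int N" for i using that by simp
    have L3: "(fls_X_inv ^ N * peval den fls_X_inv) $$ i = 0" if "i < - int N + - int n" for i
      by (rule fls_lowest_coeff_mult(1)[OF L2 L1 that])
    have L4: "(G k l m * H 0 0 0 - H k l m * G 0 0 0) $$ i = 0" if "i < k" for i
    proof -
      have "(G k l m * H 0 0 0) $$ i = 0"
        by (rule fls_lowest_coeff_mult(1)[of k _ 0]) (use G(2) H(2) that kl in auto)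
      moreover have "(H k l m * G 0 0 0) $$ i = 0"
        by (rule fls_lowest_coeff_mult(1)[of k _ 0]) (use G(2) H(2) that kl in auto)
      ultimately show ?thesis by simp
    qed
    \<comment> \<open>Its leading coefficient is \<open>1 / (1 - q / b) - 1 / (1 - q / a)\<close>, which is nonzero since \<open>a \<noteq> b\<close>.\<close>
    define W where "W = G (- 1) (- 1) (- 1) * H 0 0 0 - H (- 1) (- 1) (- 1) * G 0 0 0"
    have W1: "W $$ i = 0" if "i < - 1" for i
    proof -
      have "(G (- 1) (- 1) (- 1) * H 0 0 0) $$ i = 0" "(H (- 1) (- 1) (- 1) * G 0 0 0) $$ i = 0"
        by (rule fls_lowest_coeff_mult(1)[of "- 1" _ 0]; use G(2) H(2) that in auto)+
      thus ?thesis by (simp add: W_def)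
    qed
    have W2: "W $$ (- 1) \<noteq> 0"
    proof -
      have "(G (- 1) (- 1) (- 1) * H 0 0 0) $$ (- 1 + 0) = 1 / (1 - q / b) * 1"
        by (subst fls_lowest_coeff_mult(2)) (use G H in auto)
      moreover have "(H (- 1) (- 1) (- 1) * G 0 0 0) $$ (- 1 + 0) = 1 / (1 - q / a) * 1"
        by (subst fls_lowest_coeff_mult(2)) (use G H in auto)
      moreover have "1 - q / a \<noteq> 0" "1 - q / b \<noteq> 0"
        using nonresD[OF nonres_params(1), of "- 1"] nonresD[OF nonres_params(2), of "- 1"]
          q_nz params_nz by (auto simp: field_simps)
      moreover have "q / b \<noteq> q / a" using ne q_nz params_nz by (auto simp: field_simps)
      ultimately show ?thesis by (auto simp: W_def)
    qed
    have R1: "(peval r fls_X_inv :: complex fls) $$ i = 0" if "i < - int (degree r)" for i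
      using that by (auto simp: peval_X_inv_nth coeff_eq_0)
    have "(peval r fls_X_inv * W) $$ (- int (degree r) + - 1) = lead_coeff r * W $$ (- 1)"
      by (subst fls_lowest_coeff_mult(2)[OF R1 W1]) (auto simp: peval_X_inv_nth)
    moreover have "(peval r fls_X_inv * W) $$ (- int (degree r) + - 1) = 0"
      unfolding W_def cramer[OF H(1) G(1), symmetric]
      by (rule fls_lowest_coeff_mult(1)[OF L3 L4]) (use dr in auto)
    ultimately show False using W2 r0 by simp
  qed
  define \<kappa> where "\<kappa> = qpoch c q m / (qpoch a q k * qpoch b q l)"
  define \<kappa>' where "\<kappa>' = qpoch c q (- 1) / (qpoch a q (- 1) * qpoch b q (- 1))"
  have "\<kappa>' \<noteq> 0" using nonres_params nrc by (simp add: \<kappa>'_def qpoch_nonres)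
  define K where "K = fps_to_fls (qbin q (a * b / c))"
  have K: "K \<noteq> 0" by (simp add: K_def qbin_neq_0)
  have "fls_const \<kappa>' * (fls_X ^ N * (K * casoratian_quotient q a b c k l m))
      = fls_const \<kappa>' * (fls_X ^ N * peval den fls_X * casoratian q a b c k l m)"
    unfolding K_def qprod_casoratian[symmetric] den_def n_def by (simp only: mult.assoc)
  also have "\<dots> = fls_const \<kappa> * fls_const \<kappa>' * (fls_X ^ N * peval den fls_X *
      (system_g q a b c k l m * system_f q a b c 0 0 0 - system_f q a b c k l m * system_g q a b c 0 0 0))"
    unfolding casoratian_conv_system \<kappa>_def[symmetric] by (simp only: mult_ac)
  also have "\<dots> = fls_const \<kappa> * peval r fls_X * (fls_const \<kappa>' *
      (system_g q a b c (- 1) (- 1) (- 1) * system_f q a b c 0 0 0 - system_f q a b c (- 1) (- 1) (- 1) * system_g q a b c 0 0 0))"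
    unfolding cramer[OF contiguous_system_f contiguous_system_g] by (simp only: mult_ac)
  also have "\<dots> = fls_const \<kappa> * peval r fls_X * (- K)"
    unfolding \<kappa>'_def casoratian_conv_system[symmetric] casoratian_minus_one K_def ..
  finally have "K * (fls_const \<kappa>' * (fls_X ^ N * casoratian_quotient q a b c k l m)) = K * (- (fls_const \<kappa> * peval r fls_X))"
    by (simp add: mult_ac)
  hence eq: "fls_const \<kappa>' * (fls_X ^ N * casoratian_quotient q a b c k l m) = - (fls_const \<kappa> * peval r fls_X)"
    by (rule mult_left_cancel[OF K, THEN iffD1])
  have "(fls_const \<kappa>' * (fls_X ^ N * casoratian_quotient q a b c k l m)) $$ (j + int N) = \<kappa>' * casoratian_quotient q a b c k l m $$ j"
    unfolding fls_X_powi_nonneg[symmetric] by (simp add: fls_X_intpow_times_conv_shift)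
  moreover have "(fls_const \<kappa> * peval r fls_X) $$ (j + int N) = 0"
  proof (cases "j + int N \<ge> 0")
    case True
    have "int (nat (j + int N)) \<ge> int N + int n - k" using True j by (auto simp: n_def max_def split: if_splits)
    from deg[OF this] show ?thesis by (simp add: peval_X)
  qed (simp add: peval_X)
  ultimately have "\<kappa>' * casoratian_quotient q a b c k l m $$ j = 0"
    unfolding eq fls_uminus_nth by (simp only: minus_zero)
  thus ?thesis using \<open>\<kappa>' \<noteq> 0\<close> by simp
qed

text \<open>
  The four cases in the definition of $P_{k,l,m}$ are one sum: the number of its terms is
  $\max(k+l-m,0) - k + \max(m,0)$, which is where the series stops.
\<close>

lemma casoratian_quotient_eq_P_poly:
  assumes kl: "k \<le> l"
  shows "fls_X ^ nat m * casoratian_quotient q a b c k l m = fps_to_fls (fps_of_poly (P_poly k l m a b c q))"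
proof (rule fls_eqI)
  fix i
  define M where "M = max m 0"
  define S T where "S = (if k + l - m \<ge> 0 then coeff_A k l m a b c q else coeff_At k l m a b c q)"
    and "T = (if k + l - m \<ge> 0 then coeff_B k l m a b c q else coeff_Bt k l m a b c q)"
  define L where "L = max (k + l - m) 0 - k + M"
  have neg: "S n = 0" "T n = 0" if "n < 0" for n
    using that by (auto simp: S_def T_def coeff_A_def coeff_B_def coeff_At_def coeff_Bt_def)
  have casoratian_quotient_nth: "casoratian_quotient q a b c k l m $$ n = S (n + m) - T n" for n
    using neg[of "n + m"] neg(2)[of n] by (auto simp: casoratian_quotient_def S_def T_def fls_X_intpow_times_conv_shift)
  have P: "P_poly k l m a b c q = (\<Sum>n<nat L. monom (S (int n + (m - M)) - T (int n - M)) n)"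
    unfolding P_poly_def L_def M_def S_def T_def by (auto simp: max_def intro!: sum.cong)
  have cP: "coeff (P_poly k l m a b c q) n = (if n < nat L then S (int n + (m - M)) - T (int n - M) else 0)" for n
    unfolding P by (simp add: coeff_sum)
  have cL: "(fls_X ^ nat m * casoratian_quotient q a b c k l m) $$ i = S (i - M + m) - T (i - M)"
    unfolding fls_X_powi_nonneg[symmetric] by (simp add: fls_X_intpow_times_conv_shift casoratian_quotient_nth M_def max_def)
  have vL: "S (i - M + m) - T (i - M) = 0" if "i \<ge> L"
    using casoratian_quotient_vanishes[OF kl, of m "i - M"] that unfolding casoratian_quotient_nth L_def by simp
  have v0: "S (i - M + m) - T (i - M) = 0" if "i < 0"
    using that neg by (auto simp: M_def max_def)
  show "(fls_X ^ nat m * casoratian_quotient q a b c k l m) $$ i = fps_to_fls (fps_of_poly (P_poly k l m a b c q)) $$ i"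
  proof (cases "i < 0 \<or> i \<ge> L")
    case True
    thus ?thesis unfolding cL using vL v0 by (auto simp: cP)
  next
    case False
    have "i - M + m = i + (m - M)" by simp
    thus ?thesis using False unfolding cL by (simp only: cP fps_to_fls_nth fps_of_poly_nth) simp
  qed
qed

theorem casoratian_eq_P_poly:
  assumes "k \<le> l"
  shows "fls_X ^ nat m * peval (qprod q (a * b / c) (nat (k + l - m))) fls_X * casoratian q a b c k l m =
    fps_to_fls (qbin q (a * b / c) * fps_of_poly (P_poly k l m a b c q))"
  unfolding mult.assoc qprod_casoratian fls_times_fps_to_fls casoratian_quotient_eq_P_poly[OF assms, symmetric]
  by (simp only: mult_ac)

end

text \<open>
  The Plucker relation between the determinants of the shifts $(k,l,m)$, $(1,1,1)$ and $(0,0,0)$. The determinant of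
  $(k,l,m)$ and $(1,1,1)$ is a \<^const>\<open>casoratian\<close> with parameters \<open>a * q\<close>, \<open>b * q\<close>, \<open>c * q\<close>, and the
  infinite products of all three agree up to the factor $1 - abx/c$.
\<close>

theorem three_term_fps:
  fixes q a b c :: complex and k l m :: int
  assumes q: "0 < norm q" "norm q < 1" and gen: "generic q a b c" and nrc: "nonres q c" and kl: "k \<le> l"
  defines "dn \<equiv> fps_of_poly (qprod q (a * b / c) (nat (k + l - m)))"
    and "dn' \<equiv> fps_of_poly (qprod q (a * b * q / c) (nat (k + l - m - 1)))"
    and "P \<equiv> fps_of_poly (P_poly k l m a b c q)"
    and "P' \<equiv> fps_of_poly (P_poly (k - 1) (l - 1) (m - 1) (a * q) (b * q) (c * q) q)"
  shows "fps_X ^ (nat m + nat (m - 1)) * dn * dn' * hyp q (a * q powi k) (b * q powi l) (c * q powi m) 1 =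
     fps_const ((1 - a) * (1 - b) / ((1 - c) * (1 - q / c))) * fps_X ^ (1 + nat (m - 1)) *
       (1 - fps_const (a * b / c) * fps_X) * dn' * P * hyp q (a * q) (b * q) (c * q) 1
     - fps_X ^ nat m * dn * P' * hyp q a b c 1"
proof -
  have q0: "q \<noteq> 0" and ne: "a \<noteq> 0" "b \<noteq> 0" "c \<noteq> 0" using gen by (auto simp: generic_def)
  have sh: "nonres q (u * q)" if "nonres q u" for u
    by (rule nonres_shift[OF q0 that, of _ 1]) simp
  have gen': "generic q (a * q) (b * q) (c * q)" and nrc': "nonres q (c * q)"
    using gen sh nrc by (auto simp: generic_def)
  define \<mu> where "\<mu> = (1 - a) * (1 - b) / ((1 - c) * (1 - q / c))"
  define K where "K = qbin q (a * b * q / c)"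
  have K: "K \<noteq> 0" unfolding K_def by (rule qbin_neq_0[OF q gen nrc])
  have K0: "qbin q (a * b / c) = (1 - fps_const (a * b / c) * fps_X) * K"
    using qbin_shift[OF q, of "a * b / c"] by (simp add: K_def)
  define f0 f1 fv where "f0 = hyp q a b c 1" and "f1 = hyp q (a * q) (b * q) (c * q) 1"
    and "fv = hyp q (a * q powi k) (b * q powi l) (c * q powi m) 1"
  define g0 g1 gv where "g0 = hyp q (a * q / c) (b * q / c) (q\<^sup>2 / c) 1"
    and "g1 = hyp q (a * q / c) (b * q / c) (q / c) 1" and "gv = origin_g q a b c k l m"
  have cas: "fps_const \<mu> * fps_X * g0 * f1 - f0 * g1 = - K"
    unfolding \<mu>_def f0_def f1_def g0_def g1_def K_def by (rule qhyp_casoratian[OF q nrc ne])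
  define D D' where "D = casoratian q a b c k l m" and "D' = casoratian q (a * q) (b * q) (c * q) (k - 1) (l - 1) (m - 1)"
  define \<Lambda> \<Lambda>' where "\<Lambda> = normalization_ratio q a b c k l m" and "\<Lambda>' = normalization_ratio q (a * q) (b * q) (c * q) (k - 1) (l - 1) (m - 1)"
  have p1: "u * q * q powi (j - 1) = u * q powi j" for u j
    using q0 by (simp add: power_int_diff)
  have LL: "\<Lambda>' = \<mu> * \<Lambda>"
  proof -
    have s: "qpoch u q j = (1 - u) * qpoch (u * q) q (j - 1)" if "nonres q u" for u j
      using qpoch_add[OF q0 that, of 1 "j - 1"] qpoch_Suc[of u q 0] by simp
    have e: "a * q * q / (c * q) = a * q / c" "b * q * q / (c * q) = b * q / c" "q\<^sup>2 / (c * q) = q / c"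
      "q / c * q = q\<^sup>2 / c"
      using q0 by (simp_all add: power2_eq_square)
    have qc: "nonres q (q / c)" by (rule nonres_inverse[OF q0 ne(3) nrc, of _ 1]) simp
    have n1: "1 - u \<noteq> 0" if "nonres q u" for u using nonresD[OF that, of 0] by auto
    have nz: "1 - a \<noteq> 0" "1 - b \<noteq> 0" "1 - c \<noteq> 0" "1 - q / c \<noteq> 0"
      using gen nrc qc n1[of a] n1[of b] n1[of c] n1[of "q / c"] unfolding generic_def by blast+
    have ab: "nonres q a" "nonres q b" using gen by (auto simp: generic_def)
    have "\<Lambda> = (1 - c) * (1 - q / c) / ((1 - a) * (1 - b)) * \<Lambda>'"
    proof -
      have i: "k - 1 - (m - 1) = k - m" "l - 1 - (m - 1) = l - m" "- (m - 1) = 1 - m" "1 - m - 1 = - m" by simp_all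
      have alg: "c1 * C / (a1 * A * (b1 * B)) * (U * V / G) = c1 * w / (a1 * b1) * (C / (A * B) * (U * V / (w * G)))"
        if "w \<noteq> 0" for c1 C a1 A b1 B U V G w :: complex
        using that by (simp add: mult_ac)
      show ?thesis
        unfolding \<Lambda>_def \<Lambda>'_def normalization_ratio_def e i s[OF ab(1), of k] s[OF ab(2), of l] s[OF nrc, of m]
          s[OF qc, of "1 - m", unfolded e i]
        by (rule alg) (rule nz)
    qed
    thus ?thesis using nz ne by (simp add: \<mu>_def)
  qed
  have f0': "origin_f q a b c 0 0 0 = f0" "origin_f q (a * q) (b * q) (c * q) 0 0 0 = f1" "origin_f q a b c k l m = fv"
    "origin_f q (a * q) (b * q) (c * q) (k - 1) (l - 1) (m - 1) = fv"
    unfolding origin_f_def origin_f_def f0_def f1_def fv_def p1 by simp_all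
  have g0': "origin_g q a b c 0 0 0 = g0" "origin_g q (a * q) (b * q) (c * q) 0 0 0 = g1" "origin_g q a b c k l m = gv"
    "origin_g q (a * q) (b * q) (c * q) (k - 1) (l - 1) (m - 1) = gv"
  proof -
    have e: "a * q * q / (c * q) = a * q / c" "b * q * q / (c * q) = b * q / c" "q\<^sup>2 / (c * q) = q / c"
      "q\<^sup>2 / (c * q) * q powi (- (m - 1)) = q\<^sup>2 / c * q powi (- m)"
      using q0 by (simp_all add: power2_eq_square power_int_diff power_int_minus divide_inverse)
    show "origin_g q a b c 0 0 0 = g0" "origin_g q a b c k l m = gv"
      unfolding origin_g_def g0_def gv_def by simp_all
    show "origin_g q (a * q) (b * q) (c * q) 0 0 0 = g1"
      unfolding origin_g_def g1_def e(1-3) by simp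
    show "origin_g q (a * q) (b * q) (c * q) (k - 1) (l - 1) (m - 1) = gv"
      unfolding origin_g_def gv_def e(1,2,4) by simp
  qed
  define C where "C = (fps_to_fls :: complex fps \<Rightarrow> complex fls)"
  have D: "D = fls_const \<Lambda> * fls_X_intpow (- m) * C gv * C f0 - C fv * C g0"
    unfolding D_def \<Lambda>_def casoratian_def f0' g0' C_def ..
  have D': "D' = fls_const \<mu> * fls_X * (fls_const \<Lambda> * fls_X_intpow (- m) * C gv) * C f1 - C fv * C g1"
  proof -
    have "fls_X_intpow (- (m - 1)) = fls_X * (fls_X_intpow (- m) :: complex fls)"
      using fls_X_intpow_times_fls_X_intpow[of 1 "- m", where 'a = complex]
      by (simp flip: fls_X_conv_shift_1)
    thus ?thesis unfolding D'_def casoratian_def \<Lambda>'_def[symmetric] LL f0' g0' C_def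
      by (simp add: mult_ac flip: fls_const_mult_const)
  qed
  have key: "C K * C fv = fls_const \<mu> * fls_X * C f1 * D - C f0 * D'"
  proof -
    have "C (- K) = fls_const \<mu> * fls_X * C g0 * C f1 - C f0 * C g1"
      unfolding C_def cas[symmetric] by (simp add: fls_times_fps_to_fls)
    hence CK: "C K = C f0 * C g1 - fls_const \<mu> * fls_X * C g0 * C f1" by (simp add: C_def algebra_simps)
    show ?thesis unfolding D D' CK by (simp add: algebra_simps)
  qed
  have M: "fls_X ^ nat m * C dn * D = C K * C (1 - fps_const (a * b / c) * fps_X) * C P"
    using casoratian_eq_P_poly[OF q gen nrc kl, of m]
    unfolding peval_X D_def[symmetric] dn_def[symmetric] P_def[symmetric] C_def[symmetric] K0
    by (simp add: C_def fls_times_fps_to_fls mult_ac)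
  have lev: "k - 1 + (l - 1) - (m - 1) = k + l - m - 1" by simp
  have e': "a * q * (b * q) / (c * q) = a * b * q / c" using q0 by simp
  have M': "fls_X ^ nat (m - 1) * C dn' * D' = C K * C P'"
    using casoratian_eq_P_poly[OF q gen' nrc', of "k - 1" "l - 1" "m - 1"] kl
    unfolding peval_X D'_def[symmetric] lev e' dn'_def[symmetric] P'_def[symmetric] C_def[symmetric]
    by (simp add: C_def K_def fls_times_fps_to_fls)
  have "C K * C (fps_X ^ (nat m + nat (m - 1)) * dn * dn' * fv)
     = fls_X ^ nat m * fls_X ^ nat (m - 1) * C dn * C dn' * (C K * C fv)"
    by (simp add: C_def fls_times_fps_to_fls fps_to_fls_power power_add mult_ac)
  also have "\<dots> = fls_const \<mu> * fls_X * fls_X ^ nat (m - 1) * C dn' * C f1 * (fls_X ^ nat m * C dn * D)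
     - fls_X ^ nat m * C dn * C f0 * (fls_X ^ nat (m - 1) * C dn' * D')"
    unfolding key by (simp add: algebra_simps)
  also have "\<dots> = C K * (fls_const \<mu> * fls_X * fls_X ^ nat (m - 1) * C dn' * C f1 * C (1 - fps_const (a * b / c) * fps_X) * C P
     - fls_X ^ nat m * C dn * C f0 * C P')"
    unfolding M M' by (simp add: algebra_simps)
  also have "\<dots> = C K * C (fps_const \<mu> * fps_X ^ (1 + nat (m - 1)) * (1 - fps_const (a * b / c) * fps_X) * dn' * P * f1
     - fps_X ^ nat m * dn * P' * f0)"
    by (simp add: C_def fls_times_fps_to_fls fps_to_fls_power mult_ac)
  finally have "C (fps_X ^ (nat m + nat (m - 1)) * dn * dn' * fv) =
     C (fps_const \<mu> * fps_X ^ (1 + nat (m - 1)) * (1 - fps_const (a * b / c) * fps_X) * dn' * P * f1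
     - fps_X ^ nat m * dn * P' * f0)"
    using K by (simp add: C_def)
  thus ?thesis unfolding C_def fv_def f1_def f0_def \<mu>_def by (simp only: fps_to_fls_eq_iff)
qed

section \<open>The relation between the functions\<close>

lemma nonres_not_int_power:
  assumes "q \<noteq> 0" "u \<notin> int_powers q"
  shows "nonres q u"
  unfolding nonres_def
proof (intro allI notI)
  fix j assume "u * q powi j = 1"
  hence "u = q powi (- j)" using assms(1) by (simp add: power_int_minus field_simps)
  thus False using assms(2) by (auto simp: int_powers_def)
qed

lemma admissibleD:
  assumes "admissible a b c q"
  shows "0 < norm q" "norm q < 1" "generic q a b c" "nonres q c"
proof -
  have q: "q \<noteq> 0" using assms by (auto simp: admissible_def)
  thus "0 < norm q" "norm q < 1" "generic q a b c" "nonres q c"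
    using assms nonres_not_int_power[OF q] by (auto simp: admissible_def generic_def)
qed

lemma qpoch_qprod: "poly (qprod q d n) x = qpoch (d * x) q (int n)"
proof (induction n)
  case (Suc n)
  have "poly [:1, - d * q ^ n:] x = 1 - d * x * q ^ n" by simp
  moreover have "int (Suc n) = 1 + int n" by simp
  ultimately show ?case using Suc by (simp only: qprod_Suc qpoch_Suc poly_mult)
qed simp

lemma eval_hyp: "eval_fps (hyp q a b c 1) x = phi21 a b c q x"
  by (simp add: eval_fps_def hyp_def phi21_def)

text \<open>
  Ratio test; the ratio of consecutive coefficients tends to one.
\<close>

lemma hyp_conv_radius:
  assumes q: "0 < norm q" "norm q < 1" and nr: "nonres q a" "nonres q b" "nonres q c"
  shows "fps_conv_radius (hyp q a b c 1) = 1"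
  unfolding fps_conv_radius_def
proof (rule conv_radius_ratio_limit[where c = 1])
  let ?f = "\<lambda>n. hyp q a b c 1 $ n"
  have nz: "?f n \<noteq> 0" for n
    using nr q by (simp add: hyp_def qpoch_nonres qpoch_q_neq_0)
  show "\<forall>\<^sub>F n in sequentially. ?f n \<noteq> 0" using nz by simp
  have "?f n / ?f (Suc n) = (1 - q ^ Suc n) * (1 - c * q ^ n) / ((1 - a * q ^ n) * (1 - b * q ^ n))" for n
    using hyp_nth_Suc[OF q nr(3), of a b 1 n] nz[of "Suc n"] nonres_one_minus_power[OF nr(1), of n]
      nonres_one_minus_power[OF nr(2), of n] by (simp add: frac_eq_eq mult_ac)
  moreover have "(\<lambda>n. (1 - q ^ Suc n) * (1 - c * q ^ n) / ((1 - a * q ^ n) * (1 - b * q ^ n)))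
      \<longlonglongrightarrow> (1 - 0) * (1 - c * 0) / ((1 - a * 0) * (1 - b * 0))"
    using q(2) by (intro tendsto_intros LIMSEQ_Suc LIMSEQ_power_zero) auto
  ultimately have "(\<lambda>n. ?f n / ?f (Suc n)) \<longlonglongrightarrow> 1" by simp
  from tendsto_norm[OF this] show "(\<lambda>n. norm (?f n) / norm (?f (Suc n))) \<longlonglongrightarrow> 1"
    by (simp add: norm_divide)
qed (simp add: one_ereal_def)

lemma generic_shift:
  assumes "generic q a b c" "nonres q c"
  shows "nonres q (a * q powi k)" "nonres q (b * q powi l)" "nonres q (c * q powi m)"
    "nonres q (a * q)" "nonres q (b * q)" "nonres q (c * q)"
proof -
  have q: "q \<noteq> 0" and nr: "nonres q a" "nonres q b" using assms by (auto simp: generic_def)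
  have s: "nonres q (u * q powi i)" if "nonres q u" for u i
    by (rule nonres_shift[OF q that refl])
  show "nonres q (a * q powi k)" "nonres q (b * q powi l)" "nonres q (c * q powi m)"
    "nonres q (a * q)" "nonres q (b * q)" "nonres q (c * q)"
    using s[OF nr(1)] s[OF nr(2)] s[OF assms(2)] s[OF nr(1), of 1] s[OF nr(2), of 1] s[OF assms(2), of 1]
    by simp_all
qed

lemma fps_of_poly_linear_one_minus: "fps_of_poly [:1, - e:] = 1 - fps_const e * fps_X" for e :: complex
  by (simp add: fps_of_poly_pCons mult.commute)

lemma three_term_values:
  fixes k l m :: int
  assumes adm: "admissible a b c q" and x: "norm x < 1" and kl: "k \<le> l"
  shows "x ^ (nat m + nat (m - 1)) * qpoch (a * b * x / c) q (max (k + l - m) 0)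
       * qpoch (a * b * q * x / c) q (max (k + l - m - 1) 0) * phi21 (a * q powi k) (b * q powi l) (c * q powi m) q x
     = (1 - a) * (1 - b) / ((1 - c) * (1 - q / c)) * x ^ (1 + nat (m - 1)) * (1 - a * b * x / c)
       * qpoch (a * b * q * x / c) q (max (k + l - m - 1) 0) * poly (P_poly k l m a b c q) x * phi21 (a * q) (b * q) (c * q) q x
     - x ^ nat m * qpoch (a * b * x / c) q (max (k + l - m) 0)
       * poly (P_poly (k - 1) (l - 1) (m - 1) (a * q) (b * q) (c * q) q) x * phi21 a b c q x"
proof -
  note q = admissibleD(1,2)[OF adm] and gen = admissibleD(3)[OF adm] and nrc = admissibleD(4)[OF adm]
  define dn dn' where "dn = qprod q (a * b / c) (nat (k + l - m))" and "dn' = qprod q (a * b * q / c) (nat (k + l - m - 1))"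
  define P P' where "P = P_poly k l m a b c q" and "P' = P_poly (k - 1) (l - 1) (m - 1) (a * q) (b * q) (c * q) q"
  define U V W where "U = monom 1 (nat m + nat (m - 1)) * dn * dn'"
    and "V = monom ((1 - a) * (1 - b) / ((1 - c) * (1 - q / c))) (1 + nat (m - 1)) * [:1, - (a * b / c):] * dn' * P"
    and "W = monom 1 (nat m) * dn * P'"
  have "fps_of_poly U * hyp q (a * q powi k) (b * q powi l) (c * q powi m) 1 =
     fps_of_poly V * hyp q (a * q) (b * q) (c * q) 1 - fps_of_poly W * hyp q a b c 1"
    using three_term_fps[OF q gen nrc kl, of m]
    unfolding dn_def[symmetric] dn'_def[symmetric] P_def[symmetric] P'_def[symmetric] U_def V_def W_def
      fps_of_poly_mult fps_of_poly_monom fps_of_poly_linear_one_minus by simp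
  hence "eval_fps (fps_of_poly U * hyp q (a * q powi k) (b * q powi l) (c * q powi m) 1) x =
     eval_fps (fps_of_poly V * hyp q (a * q) (b * q) (c * q) 1 - fps_of_poly W * hyp q a b c 1) x"
    by (rule arg_cong)
  moreover have r: "fps_conv_radius (hyp q (a * q powi k) (b * q powi l) (c * q powi m) 1) = 1"
    "fps_conv_radius (hyp q (a * q) (b * q) (c * q) 1) = 1" "fps_conv_radius (hyp q a b c 1) = 1"
    using generic_shift[OF gen nrc] gen nrc by (auto intro!: hyp_conv_radius[OF q] simp: generic_def)
  moreover have "norm x < fps_conv_radius (fps_of_poly p * f)" if "fps_conv_radius f = 1" for p and f :: "complex fps"
    by (rule less_le_trans[OF _ fps_conv_radius_mult]) (use x that in \<open>simp add: one_ereal_def\<close>)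
  ultimately have "poly U x * phi21 (a * q powi k) (b * q powi l) (c * q powi m) q x
     = poly V x * phi21 (a * q) (b * q) (c * q) q x - poly W x * phi21 a b c q x"
    using x by (simp add: eval_fps_diff eval_fps_mult eval_hyp one_ereal_def)
  moreover have "int (nat j) = max j 0" for j by simp
  moreover have "a * b / c * x = a * b * x / c" "a * b * q / c * x = a * b * q * x / c" by simp_all
  moreover have "poly [:1, - (a * b / c):] x = 1 - a * b * x / c" by simp
  ultimately show ?thesis
    unfolding U_def V_def W_def dn_def dn'_def P_def P'_def poly_mult poly_monom qpoch_qprod
    by (simp only: mult_1_left)
qed

definition Q_value :: "int \<Rightarrow> int \<Rightarrow> int \<Rightarrow> complex \<Rightarrow> complex \<Rightarrow> complex \<Rightarrow> complex \<Rightarrow> complex \<Rightarrow> complex" where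
  "Q_value k l m a b c q x = - ((1 - a) * (1 - b) * c / ((q - c) * (1 - c)))
     * (x powi (1 - max m 0) / qpoch (a * b * q * x / c) q (max (k + l - m) 0 - 1))
     * poly (P_poly k l m a b c q) x"

definition R_value :: "int \<Rightarrow> int \<Rightarrow> int \<Rightarrow> complex \<Rightarrow> complex \<Rightarrow> complex \<Rightarrow> complex \<Rightarrow> complex \<Rightarrow> complex" where
  "R_value k l m a b c q x = - (x powi (- max (m - 1) 0) / qpoch (a * b * q * x / c) q (max (k + l - m - 1) 0))
     * poly (P_poly (k - 1) (l - 1) (m - 1) (a * q) (b * q) (c * q) q) x"

text \<open>
  The excluded arguments, finitely many for given parameters, are those where clearing denominators is not an equivalence.
\<close>

lemma three_term_Q_R:
  assumes adm: "admissible a b c q" and x: "norm x < 1" and kl: "k \<le> l"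
    and x0: "x \<noteq> 0" "a * b * x / c \<noteq> 1"
    and nz: "qpoch (a * b * q * x / c) q (max (k + l - m) 0 - 1) \<noteq> 0"
      "qpoch (a * b * q * x / c) q (max (k + l - m - 1) 0) \<noteq> 0"
  shows "phi21 (a * q powi k) (b * q powi l) (c * q powi m) q x =
    Q_value k l m a b c q x * phi21 (a * q) (b * q) (c * q) q x + R_value k l m a b c q x * phi21 a b c q x"
proof -
  define u where "u = a * b * x / c"
  have q: "q \<noteq> 0" and c: "c \<noteq> 0" using adm by (auto simp: admissible_def)
  have c1: "c \<noteq> 1" "q \<noteq> c"
  proof -
    have "q powi 0 \<in> int_powers q" "q powi 1 \<in> int_powers q" unfolding int_powers_def by blast+
    thus "c \<noteq> 1" "q \<noteq> c" using adm by (auto simp: admissible_def)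
  qed
  have uq: "a * b * q * x / c = u * q" by (simp add: u_def)
  \<comment> \<open>For \<open>k + l - m \<le> 0\<close> the index on the right is \<open>-1\<close>, so that the factorial is the inverse of \<open>1 - u\<close>.\<close>
  have step: "qpoch u q (max (k + l - m) 0) = (1 - u) * qpoch (u * q) q (max (k + l - m) 0 - 1)"
  proof (cases "k + l - m \<ge> 1")
    case True
    define n where "n = nat (k + l - m - 1)"
    have n: "max (k + l - m) 0 = 1 + int n" using True by (simp add: n_def)
    show ?thesis unfolding n using qpoch_add_nat[of u q 1 n] qpoch_Suc[of u q 0] by simp
  next
    case False
    have "qpoch (u * q) q (- 1) = inverse (1 - u)"
      using qpoch_neg_Suc[of "u * q" q 0] q by (simp add: power_int_minus)
    thus ?thesis using False x0 by (simp add: u_def)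
  qed
  define d1 d2 where "d1 = qpoch (u * q) q (max (k + l - m) 0 - 1)" and "d2 = qpoch (u * q) q (max (k + l - m - 1) 0)"
  have dz: "d1 \<noteq> 0" "d2 \<noteq> 0" using nz unfolding uq d1_def d2_def by auto
  define \<Phi> \<Phi>1 \<Phi>0 where "\<Phi> = phi21 (a * q powi k) (b * q powi l) (c * q powi m) q x"
    and "\<Phi>1 = phi21 (a * q) (b * q) (c * q) q x" and "\<Phi>0 = phi21 a b c q x"
  define p p' where "p = poly (P_poly k l m a b c q) x" and "p' = poly (P_poly (k - 1) (l - 1) (m - 1) (a * q) (b * q) (c * q) q) x"
  define \<mu> where "\<mu> = (1 - a) * (1 - b) / ((1 - c) * (1 - q / c))"
  have mu: "- ((1 - a) * (1 - b) * c / ((q - c) * (1 - c))) = \<mu>"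
  proof -
    have "(1 - q / c) * c = - (q - c)" using c by (simp add: field_simps)
    hence "\<mu> = (1 - a) * (1 - b) * c / ((1 - c) * (- (q - c)))"
      unfolding \<mu>_def using c by (metis (no_types, lifting) mult.assoc mult_divide_mult_cancel_right)
    thus ?thesis by (simp only: minus_divide_right mult_minus_right mult.commute)
  qed
  have "x ^ (nat m + nat (m - 1)) * ((1 - u) * d1) * d2 * \<Phi>
     = \<mu> * x ^ (1 + nat (m - 1)) * (1 - u) * d2 * p * \<Phi>1 - x ^ nat m * ((1 - u) * d1) * p' * \<Phi>0"
    using three_term_values[OF adm x kl, of m]
    unfolding uq u_def[symmetric] step d1_def[symmetric] d2_def[symmetric] \<Phi>_def[symmetric] \<Phi>1_def[symmetric]
      \<Phi>0_def[symmetric] p_def[symmetric] p'_def[symmetric] \<mu>_def[symmetric] .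
  hence eq1: "(1 - u) * (x ^ (nat m + nat (m - 1)) * d1 * d2 * \<Phi>)
     = (1 - u) * (\<mu> * x ^ (1 + nat (m - 1)) * d2 * p * \<Phi>1 - x ^ nat m * d1 * p' * \<Phi>0)"
    by (simp add: algebra_simps)
  have u1: "1 - u \<noteq> 0" using x0 by (simp add: u_def)
  have eq: "x ^ (nat m + nat (m - 1)) * d1 * d2 * \<Phi>
     = \<mu> * x ^ (1 + nat (m - 1)) * d2 * p * \<Phi>1 - x ^ nat m * d1 * p' * \<Phi>0"
    by (rule mult_left_cancel[OF u1, THEN iffD1, OF eq1])
  have p1: "x powi (1 - max m 0) = x / x ^ nat m" and p2: "x powi (- max (m - 1) 0) = 1 / x ^ nat (m - 1)"
  proof -
    have e: "max m 0 = int (nat m)" "max (m - 1) 0 = int (nat (m - 1))" by simp_all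
    show "x powi (1 - max m 0) = x / x ^ nat m" unfolding e using x0(1)
      by (subst power_int_diff) (simp_all only: power_int_1_right power_int_of_nat simp_thms)
    show "x powi (- max (m - 1) 0) = 1 / x ^ nat (m - 1)" unfolding e
      by (simp only: power_int_minus power_int_of_nat divide_inverse mult_1_left)
  qed
  have "Q_value k l m a b c q x = \<mu> * (x / x ^ nat m / d1) * p"
    unfolding Q_value_def mu uq d1_def p_def p1 ..
  moreover have "R_value k l m a b c q x = - (1 / x ^ nat (m - 1) / d2) * p'"
    unfolding R_value_def uq d2_def p'_def p2 ..
  moreover have "x ^ (nat m + nat (m - 1)) * d1 * d2 * (\<mu> * (x / x ^ nat m / d1) * p * \<Phi>1 + - (1 / x ^ nat (m - 1) / d2) * p' * \<Phi>0)
     = x ^ (nat m + nat (m - 1)) * d1 * d2 * \<Phi>"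
    by (subst eq) (use dz x0(1) in \<open>simp add: power_add field_simps\<close>)
  moreover have "x ^ (nat m + nat (m - 1)) * d1 * d2 \<noteq> 0" using dz x0(1) by simp
  ultimately have "Q_value k l m a b c q x * \<Phi>1 + R_value k l m a b c q x * \<Phi>0 = \<Phi>"
    using mult_left_cancel by metis
  thus ?thesis by (simp add: \<Phi>_def \<Phi>1_def \<Phi>0_def)
qed

section \<open>Rational functions of the parameters\<close>

type_synonym point = "complex \<times> complex \<times> complex \<times> complex \<times> complex"

abbreviation pa :: "point \<Rightarrow> complex" where "pa p \<equiv> fst p"
abbreviation pb :: "point \<Rightarrow> complex" where "pb p \<equiv> fst (snd p)"
abbreviation pc :: "point \<Rightarrow> complex" where "pc p \<equiv> fst (snd (snd p))"
abbreviation pq :: "point \<Rightarrow> complex" where "pq p \<equiv> fst (snd (snd (snd p)))"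
abbreviation px :: "point \<Rightarrow> complex" where "px p \<equiv> snd (snd (snd (snd p)))"

definition value_at :: "poly5 \<Rightarrow> point \<Rightarrow> complex" where
  "value_at P p = eval5 P (pa p) (pb p) (pc p) (pq p) (px p)"

lemma is_hom_of_rat: "is_hom (of_rat :: rat \<Rightarrow> complex)"
  by (simp add: is_hom_def of_rat_add of_rat_mult)

lemma is_hom_eval_via: "is_hom h \<Longrightarrow> is_hom (eval_via h y)"
  unfolding eval_via_def[abs_def] by (rule is_hom_eval)

lemma is_hom_eval5: "is_hom (\<lambda>P. eval5 P a b c q x)"
  unfolding eval5_def by (intro is_hom_eval_via is_hom_of_rat)

lemma is_hom_value_at: "is_hom (\<lambda>P. value_at P p)"
  unfolding value_at_def by (rule is_hom_eval5)

lemmas value_at_simps = is_homD[OF is_hom_value_at] is_hom_diff[OF is_hom_value_at]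
lemmas eval5_simps = is_homD[OF is_hom_eval5] is_hom_diff[OF is_hom_eval5]

lemma eval_via_pCons:
  assumes "is_hom h"
  shows "eval_via h y (pCons u P) = h u + y * eval_via h y P"
  unfolding eval_via_def by (simp add: map_poly_pCons[where f = h, OF is_homD(1)[OF assms]])

lemma eval_via_0 [simp]: "eval_via h y 0 = 0"
  by (simp add: eval_via_def)

text \<open>
  An induction principle for five-variable polynomial functions: whatever is shared by constants and
  coordinates and is preserved by sums and products holds for all of them.
\<close>

lemma eval_via_closed:
  fixes F :: "('t \<Rightarrow> complex) \<Rightarrow> bool"
  assumes "\<And>t. is_hom (h t)" "\<And>u. F (\<lambda>t. h t u)" "F y" "F (\<lambda>t. 0)"
    and "\<And>f g. F f \<Longrightarrow> F g \<Longrightarrow> F (\<lambda>t. f t + g t)" "\<And>f g. F f \<Longrightarrow> F g \<Longrightarrow> F (\<lambda>t. f t * g t)"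
  shows "F (\<lambda>t. eval_via (h t) (y t) P)"
proof (induction P)
  case (pCons u P)
  have "F (\<lambda>t. h t u + y t * eval_via (h t) (y t) P)"
    by (intro assms(5)[OF assms(2)] assms(6)[OF assms(3)] pCons)
  thus ?case by (simp add: eval_via_pCons[OF assms(1)])
qed (simp add: assms)

lemma eval5_closed:
  fixes F :: "('t \<Rightarrow> complex) \<Rightarrow> bool"
  assumes const: "\<And>r. F (\<lambda>t. r)" and coord: "F a" "F b" "F c" "F q" "F x"
    and add: "\<And>f g. F f \<Longrightarrow> F g \<Longrightarrow> F (\<lambda>t. f t + g t)" and mult: "\<And>f g. F f \<Longrightarrow> F g \<Longrightarrow> F (\<lambda>t. f t * g t)"
  shows "F (\<lambda>t. eval5 P (a t) (b t) (c t) (q t) (x t))"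
proof -
  note c = eval_via_closed[OF _ _ _ const add mult]
  have 1: "F (\<lambda>t. eval_via of_rat (a t) P)" for P
    by (rule c) (auto intro: is_hom_of_rat const coord)
  have 2: "F (\<lambda>t. eval_via (eval_via of_rat (a t)) (b t) P)" for P
    by (rule c) (auto intro: is_hom_of_rat is_hom_eval_via 1 coord)
  have 3: "F (\<lambda>t. eval_via (eval_via (eval_via of_rat (a t)) (b t)) (c t) P)" for P
    by (rule c) (auto intro: is_hom_of_rat is_hom_eval_via 2 coord)
  have 4: "F (\<lambda>t. eval_via (eval_via (eval_via (eval_via of_rat (a t)) (b t)) (c t)) (q t) P)" for P
    by (rule c) (auto intro: is_hom_of_rat is_hom_eval_via 3 coord)
  show ?thesis unfolding eval5_def
    by (rule c) (intro is_hom_of_rat is_hom_eval_via 4 coord)+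
qed

text \<open>
  One representation as a fraction has to work on all of \<open>S\<close>: for a suitable set \<open>S\<close> this is what turns a formula into a single element of
  \<^typ>\<open>ratfun5\<close> that is defined wherever the formula is.
\<close>

definition rational_on :: "point set \<Rightarrow> (point \<Rightarrow> complex) \<Rightarrow> bool" where
  "rational_on S f \<longleftrightarrow> (\<exists>N D. \<forall>p\<in>S. value_at D p \<noteq> 0 \<and> f p = value_at N p / value_at D p)"

lemma rational_onI:
  assumes "\<And>p. p \<in> S \<Longrightarrow> value_at D p \<noteq> 0" "\<And>p. p \<in> S \<Longrightarrow> f p = value_at N p / value_at D p"
  shows "rational_on S f"
  unfolding rational_on_def using assms by blast

lemma rational_on_poly: "(\<And>p. f p = value_at N p) \<Longrightarrow> rational_on S f"
  by (rule rational_onI[of S 1 _ N]) (simp_all add: value_at_simps)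

lemma rational_on_cong: "rational_on S f \<Longrightarrow> (\<And>p. p \<in> S \<Longrightarrow> g p = f p) \<Longrightarrow> rational_on S g"
  unfolding rational_on_def by auto

lemma rational_on_coord:
  "rational_on S pa" "rational_on S pb" "rational_on S pc" "rational_on S pq" "rational_on S px"
proof -
  note h = is_hom_of_rat is_hom_eval_via
  show "rational_on S pa"
    by (rule rational_on_poly[where N = "[:[:[:[:[:0, 1:]:]:]:]:]"])
      (simp add: value_at_def eval5_def eval_via_pCons h)
  show "rational_on S pb"
    by (rule rational_on_poly[where N = "[:[:[:[:0, 1:]:]:]:]"])
      (simp add: value_at_def eval5_def eval_via_pCons h is_homD[OF is_hom_eval_via[OF is_hom_of_rat]])
  show "rational_on S pc"
    by (rule rational_on_poly[where N = "[:[:[:0, 1:]:]:]"])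
      (simp add: value_at_def eval5_def eval_via_pCons h is_homD[OF is_hom_eval_via[OF is_hom_eval_via[OF is_hom_of_rat]]])
  show "rational_on S pq"
    by (rule rational_on_poly[where N = "[:[:0, 1:]:]"])
      (simp add: value_at_def eval5_def eval_via_pCons h
        is_homD[OF is_hom_eval_via[OF is_hom_eval_via[OF is_hom_eval_via[OF is_hom_of_rat]]]])
  show "rational_on S px"
    by (rule rational_on_poly[where N = "[:0, 1:]"])
      (simp add: value_at_def eval5_def eval_via_pCons h
        is_homD[OF is_hom_eval_via[OF is_hom_eval_via[OF is_hom_eval_via[OF is_hom_eval_via[OF is_hom_of_rat]]]]])
qed

lemma rational_on_0: "rational_on S (\<lambda>p. 0)" and rational_on_1: "rational_on S (\<lambda>p. 1)"
  by (rule rational_on_poly[where N = 0], simp add: value_at_simps)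
    (rule rational_on_poly[where N = 1], simp add: value_at_simps)

lemma rational_on_add:
  assumes "rational_on S f" "rational_on S g"
  shows "rational_on S (\<lambda>p. f p + g p)"
proof -
  obtain N D where f: "\<And>p. p \<in> S \<Longrightarrow> value_at D p \<noteq> 0 \<and> f p = value_at N p / value_at D p"
    using assms(1) unfolding rational_on_def by blast
  obtain N' D' where g: "\<And>p. p \<in> S \<Longrightarrow> value_at D' p \<noteq> 0 \<and> g p = value_at N' p / value_at D' p"
    using assms(2) unfolding rational_on_def by blast
  show ?thesis
    by (rule rational_onI[of S "D * D'" _ "N * D' + N' * D"])
      (use f g in \<open>simp_all add: value_at_simps add_frac_eq\<close>)
qed

lemma rational_on_mult:
  assumes "rational_on S f" "rational_on S g"
  shows "rational_on S (\<lambda>p. f p * g p)"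
proof -
  obtain N D where f: "\<And>p. p \<in> S \<Longrightarrow> value_at D p \<noteq> 0 \<and> f p = value_at N p / value_at D p"
    using assms(1) unfolding rational_on_def by blast
  obtain N' D' where g: "\<And>p. p \<in> S \<Longrightarrow> value_at D' p \<noteq> 0 \<and> g p = value_at N' p / value_at D' p"
    using assms(2) unfolding rational_on_def by blast
  show ?thesis
    by (rule rational_onI[of S "D * D'" _ "N * N'"]) (use f g in \<open>simp_all add: value_at_simps\<close>)
qed

lemma rational_on_inverse:
  assumes "rational_on S f" "\<And>p. p \<in> S \<Longrightarrow> f p \<noteq> 0"
  shows "rational_on S (\<lambda>p. inverse (f p))"
proof -
  obtain N D where f: "\<And>p. p \<in> S \<Longrightarrow> value_at D p \<noteq> 0 \<and> f p = value_at N p / value_at D p"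
    using assms(1) unfolding rational_on_def by blast
  show ?thesis
    by (rule rational_onI[of S N _ D]) (use f assms(2) in \<open>force\<close>)+
qed

lemma rational_on_minus: "rational_on S f \<Longrightarrow> rational_on S (\<lambda>p. - f p)"
proof -
  assume f: "rational_on S f"
  have "rational_on S (\<lambda>p. - 1 :: complex)"
    by (rule rational_on_poly[where N = "0 - 1"]) (subst value_at_simps(5), simp add: value_at_simps)
  from rational_on_mult[OF this f] show ?thesis by simp
qed

lemma rational_on_diff: "rational_on S f \<Longrightarrow> rational_on S g \<Longrightarrow> rational_on S (\<lambda>p. f p - g p)"
  using rational_on_add[OF _ rational_on_minus, of S f g] by simp

lemma rational_on_divide:
  "rational_on S f \<Longrightarrow> rational_on S g \<Longrightarrow> (\<And>p. p \<in> S \<Longrightarrow> g p \<noteq> 0) \<Longrightarrow> rational_on S (\<lambda>p. f p / g p)"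
  unfolding divide_inverse by (intro rational_on_mult rational_on_inverse) auto

lemma rational_on_power: "rational_on S f \<Longrightarrow> rational_on S (\<lambda>p. f p ^ n)"
  by (induction n) (auto intro: rational_on_1 rational_on_mult)

lemma rational_on_powi:
  "rational_on S f \<Longrightarrow> j \<ge> 0 \<or> (\<forall>p\<in>S. f p \<noteq> 0) \<Longrightarrow> rational_on S (\<lambda>p. f p powi j)"
  unfolding power_int_def
  by (cases "j \<ge> 0") (auto intro!: rational_on_power rational_on_inverse)

lemma rational_on_sum: "(\<And>i. i \<in> I \<Longrightarrow> rational_on S (f i)) \<Longrightarrow> rational_on S (\<lambda>p. \<Sum>i\<in>I. f i p)"
  by (induction I rule: infinite_finite_induct) (auto intro: rational_on_0 rational_on_add)

lemma rational_on_prod: "(\<And>i. i \<in> I \<Longrightarrow> rational_on S (f i)) \<Longrightarrow> rational_on S (\<lambda>p. \<Prod>i\<in>I. f i p)"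
  by (induction I rule: infinite_finite_induct) (auto intro: rational_on_1 rational_on_mult)

lemma rational_on_qpoch:
  assumes u: "rational_on S u" and q: "rational_on S q"
    and nz: "n \<ge> 0 \<or> (\<forall>p\<in>S. q p \<noteq> 0 \<and> (\<forall>j<0. u p * q p powi j \<noteq> 1))"
  shows "rational_on S (\<lambda>p. qpoch (u p) (q p) n)"
proof (cases "n \<ge> 0")
  case True
  thus ?thesis unfolding qpoch_def
    by (auto intro!: rational_on_prod rational_on_diff rational_on_1 rational_on_mult rational_on_power u q)
next
  case False
  have "rational_on S (\<lambda>p. \<Prod>j = 1..nat (- n). inverse (1 - u p * q p powi (- int j)))"
  proof (intro rational_on_prod rational_on_inverse rational_on_diff rational_on_1 rational_on_mult rational_on_powi u q)
    fix j p assume j: "j \<in> {1..nat (- n)}" "p \<in> S"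
    thus "1 - u p * q p powi (- int j) \<noteq> 0" using nz False by auto
  qed (use nz False in auto)
  thus ?thesis using False by (simp add: qpoch_def)
qed

context
  fixes S :: "point set" and q a b c :: "point \<Rightarrow> complex"
  assumes rat: "rational_on S q" "rational_on S a" "rational_on S b" "rational_on S c"
    and adm: "\<And>p. p \<in> S \<Longrightarrow> admissible (a p) (b p) (c p) (q p)"
begin

text \<open>
  The shape in which bases of shifted factorials occur in denominators.
\<close>

definition nonres_on :: "(point \<Rightarrow> complex) \<Rightarrow> bool" where
  "nonres_on u \<longleftrightarrow> rational_on S u \<and> (\<forall>p\<in>S. nonres (q p) (u p))"

lemma q_neq_0: "p \<in> S \<Longrightarrow> q p \<noteq> 0" and c_neq_0: "p \<in> S \<Longrightarrow> c p \<noteq> 0"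
  and a_neq_0: "p \<in> S \<Longrightarrow> a p \<noteq> 0" and b_neq_0: "p \<in> S \<Longrightarrow> b p \<noteq> 0"
  using adm by (auto simp: admissible_def)

lemma rational_q_powi: "rational_on S (\<lambda>p. q p powi j)"
  using q_neq_0 by (intro rational_on_powi rat) auto

lemma nonres_on_shift: "nonres_on u \<Longrightarrow> nonres_on (\<lambda>p. u p * q p powi j)"
  unfolding nonres_on_def using nonres_shift[OF q_neq_0]
  by (auto intro!: rational_on_mult rational_q_powi)

lemma nonres_on_inverse:
  assumes "nonres_on u" "\<And>p. p \<in> S \<Longrightarrow> u p \<noteq> 0"
  shows "nonres_on (\<lambda>p. q p powi j / u p)"
  using assms nonres_inverse[OF q_neq_0]
  unfolding nonres_on_def by (auto intro!: rational_on_divide rational_q_powi)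

lemma nonres_on_basic: "nonres_on a" "nonres_on b" "nonres_on c" "nonres_on (\<lambda>p. c p / a p)" "nonres_on (\<lambda>p. c p / b p)"
proof -
  have "generic (q p) (a p) (b p) (c p)" "nonres (q p) (c p)" if "p \<in> S" for p
    using admissibleD[OF adm[OF that]] by auto
  thus "nonres_on a" "nonres_on b" "nonres_on c" "nonres_on (\<lambda>p. c p / a p)" "nonres_on (\<lambda>p. c p / b p)"
    using a_neq_0 b_neq_0 by (auto simp: nonres_on_def generic_def intro!: rat rational_on_divide)
qed

lemma nonres_on_params:
  "nonres_on (\<lambda>p. c p * q p powi j)" "nonres_on (\<lambda>p. a p * q p powi j)" "nonres_on (\<lambda>p. b p * q p powi j)"
  "nonres_on (\<lambda>p. a p * q p / c p)" "nonres_on (\<lambda>p. b p * q p / c p)" "nonres_on (\<lambda>p. (q p)\<^sup>2 / c p)"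
  "nonres_on (\<lambda>p. c p * q p powi j / a p)" "nonres_on (\<lambda>p. c p * q p powi j / b p)"
proof -
  note s = nonres_on_shift[OF nonres_on_basic(1), of j] nonres_on_shift[OF nonres_on_basic(2), of j]
    nonres_on_shift[OF nonres_on_basic(3), of j] nonres_on_shift[OF nonres_on_basic(4), of j]
    nonres_on_shift[OF nonres_on_basic(5), of j]
  note i = nonres_on_inverse[OF nonres_on_basic(4), of 1] nonres_on_inverse[OF nonres_on_basic(5), of 1]
    nonres_on_inverse[OF nonres_on_basic(3), of 2]
  show "nonres_on (\<lambda>p. c p * q p powi j)" "nonres_on (\<lambda>p. a p * q p powi j)" "nonres_on (\<lambda>p. b p * q p powi j)"
    "nonres_on (\<lambda>p. a p * q p / c p)" "nonres_on (\<lambda>p. b p * q p / c p)" "nonres_on (\<lambda>p. (q p)\<^sup>2 / c p)"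
    "nonres_on (\<lambda>p. c p * q p powi j / a p)" "nonres_on (\<lambda>p. c p * q p powi j / b p)"
    using s i a_neq_0 b_neq_0 c_neq_0 by (auto simp: mult_ac)
qed

lemma rational_qpoch: "nonres_on u \<Longrightarrow> rational_on S (\<lambda>p. qpoch (u p) (q p) n)"
  by (rule rational_on_qpoch) (auto simp: nonres_on_def nonres_def rat q_neq_0)

lemma rational_qpoch_nat: "rational_on S u \<Longrightarrow> rational_on S (\<lambda>p. qpoch (u p) (q p) (int n))"
  by (rule rational_on_qpoch) (auto simp: rat)

lemma qpoch_on_neq_0: "nonres_on u \<Longrightarrow> p \<in> S \<Longrightarrow> qpoch (u p) (q p) n \<noteq> 0"
  by (auto simp: nonres_on_def qpoch_nonres)

lemma qpoch_q_on_neq_0: "p \<in> S \<Longrightarrow> qpoch (q p) (q p) (int n) \<noteq> 0"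
  using adm by (intro qpoch_q_neq_0) (auto simp: admissible_def)

lemma qpoch_q_powi_neq_0:
  assumes "p \<in> S"
  shows "qpoch (q p powi (- int n)) (q p) (int n) \<noteq> 0"
proof (rule qpoch_neq_0)
  fix i assume "0 \<le> i" "i < int n"
  have "0 < norm (q p)" "norm (q p) < 1" using adm[OF assms] by (auto simp: admissible_def)
  moreover have "q p powi (- int n + i) = q p powi (- int n) * q p powi i"
    using q_neq_0[OF assms] by (intro power_int_add) auto
  ultimately show "q p powi (- int n) * q p powi i \<noteq> 1"
    using not_root_of_unity[of "q p" "- int n + i"] \<open>i < int n\<close> by auto
qed auto

lemma rational_phi43:
  assumes "rational_on S a1" "rational_on S a2" "rational_on S a3" "nonres_on b1" "nonres_on b2" "nonres_on b3"
    "rational_on S z"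
  shows "rational_on S (\<lambda>p. phi43 (q p powi (- int n)) (a1 p) (a2 p) (a3 p) (b1 p) (b2 p) (b3 p) (q p) (z p))"
proof (rule rational_on_cong)
  show "rational_on S (\<lambda>p. \<Sum>i\<le>n. qpoch (q p powi (- int n)) (q p) (int i) * qpoch (a1 p) (q p) (int i)
       * qpoch (a2 p) (q p) (int i) * qpoch (a3 p) (q p) (int i) /
       (qpoch (q p) (q p) (int i) * qpoch (b1 p) (q p) (int i) * qpoch (b2 p) (q p) (int i) * qpoch (b3 p) (q p) (int i)) * z p ^ i)"
    by (intro rational_on_sum rational_on_mult rational_on_divide rational_on_power rational_qpoch_nat
          rational_qpoch rational_q_powi assms)
      (use assms qpoch_on_neq_0 qpoch_q_on_neq_0 rat in auto)
qed (simp add: phi43_terminating q_neq_0)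

lemma rational_coeffs:
  "rational_on S (\<lambda>p. coeff_A k l m (a p) (b p) (c p) (q p) n)"
  "rational_on S (\<lambda>p. coeff_B k l m (a p) (b p) (c p) (q p) n)"
  "rational_on S (\<lambda>p. coeff_At k l m (a p) (b p) (c p) (q p) n)"
  "rational_on S (\<lambda>p. coeff_Bt k l m (a p) (b p) (c p) (q p) n)"
proof -
  have "rational_on S (\<lambda>p. coeff_A k l m (a p) (b p) (c p) (q p) n) \<and>
    rational_on S (\<lambda>p. coeff_B k l m (a p) (b p) (c p) (q p) n) \<and>
    rational_on S (\<lambda>p. coeff_At k l m (a p) (b p) (c p) (q p) n) \<and>
    rational_on S (\<lambda>p. coeff_Bt k l m (a p) (b p) (c p) (q p) n)"
  proof (cases "n < 0")
    case True
    thus ?thesis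
      by (simp add: coeff_A_def coeff_B_def coeff_At_def coeff_Bt_def rational_on_0)
  next
    case False
    then obtain i where n: "n = int i" by (metis nonneg_int_cases not_less)
    have r: "rational_on S u" if "nonres_on u" for u using that by (simp add: nonres_on_def)
    note np = nonres_on_params
    note rules = rational_on_mult rational_on_divide rational_on_minus rational_q_powi rational_phi43
      rational_qpoch[OF np(1)] rational_qpoch[OF np(2)] rational_qpoch[OF np(3)] rational_qpoch[OF np(4)]
      rational_qpoch[OF np(5)] rational_qpoch[OF np(6)] rational_qpoch[OF nonres_on_basic(1)]
      rational_qpoch[OF nonres_on_basic(2)] rational_qpoch[OF nonres_on_basic(3)]
      r[OF np(1)] r[OF np(7)] r[OF np(8)] np nonres_on_basic r[OF nonres_on_basic(4)] r[OF nonres_on_basic(5)]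
      rational_qpoch_nat rat
    note nz = qpoch_on_neq_0[OF np(1)] qpoch_on_neq_0[OF np(2)] qpoch_on_neq_0[OF np(3)] qpoch_on_neq_0[OF np(4)]
      qpoch_on_neq_0[OF np(5)] qpoch_on_neq_0[OF np(6)] qpoch_on_neq_0[OF nonres_on_basic(1)]
      qpoch_on_neq_0[OF nonres_on_basic(2)] qpoch_on_neq_0[OF nonres_on_basic(3)] qpoch_q_on_neq_0 qpoch_q_powi_neq_0
      a_neq_0 b_neq_0 c_neq_0 q_neq_0
    have 1: "rational_on S (\<lambda>p. coeff_A k l m (a p) (b p) (c p) (q p) n)"
      unfolding coeff_A_def n by simp (intro rules; simp add: nz)
    have 2: "rational_on S (\<lambda>p. coeff_B k l m (a p) (b p) (c p) (q p) n)"
      unfolding coeff_B_def n by simp (intro rules; simp add: nz)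
    have 3: "rational_on S (\<lambda>p. coeff_At k l m (a p) (b p) (c p) (q p) n)"
      unfolding coeff_At_def n by simp (intro rules; simp add: nz)
    have 4: "rational_on S (\<lambda>p. coeff_Bt k l m (a p) (b p) (c p) (q p) n)"
      unfolding coeff_Bt_def n by simp (intro rules; simp add: nz)
    show ?thesis using 1 2 3 4 by blast
  qed
  thus "rational_on S (\<lambda>p. coeff_A k l m (a p) (b p) (c p) (q p) n)"
    "rational_on S (\<lambda>p. coeff_B k l m (a p) (b p) (c p) (q p) n)"
    "rational_on S (\<lambda>p. coeff_At k l m (a p) (b p) (c p) (q p) n)"
    "rational_on S (\<lambda>p. coeff_Bt k l m (a p) (b p) (c p) (q p) n)"
    by blast+
qed

lemma rational_P_poly:
  assumes "rational_on S x"
  shows "rational_on S (\<lambda>p. poly (P_poly k l m (a p) (b p) (c p) (q p)) (x p))"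
proof -
  note rules = rational_on_sum rational_on_mult rational_on_diff rational_coeffs rational_on_power assms
  show ?thesis
    by (cases "m \<ge> 0"; cases "k + l - m \<ge> 0"; simp add: P_poly_def poly_sum poly_monom; intro rules)
qed

end

section \<open>Independence of the two basic functions\<close>

lemma infinite_unit_circle: "infinite {z :: complex. norm z = 1}"
proof
  assume fin: "finite {z :: complex. norm z = 1}"
  have "(\<lambda>t. Complex t (sqrt (1 - t\<^sup>2))) ` {0..1} \<subseteq> {z. norm z = 1}"
  proof (clarsimp simp: cmod_def)
    fix t :: real assume "0 \<le> t" "t \<le> 1"
    hence "t\<^sup>2 \<le> 1" by (simp add: power_le_one)
    thus "t\<^sup>2 + (sqrt (1 - t\<^sup>2))\<^sup>2 = 1" by simp
  qed
  moreover have "inj_on (\<lambda>t. Complex t (sqrt (1 - t\<^sup>2))) {0..1}" by (auto simp: inj_on_def)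
  ultimately have "finite {0..1::real}" using fin by (metis finite_imageD finite_subset)
  thus False by (simp add: infinite_Icc)
qed

text \<open>
  The step of Zariski density in one more variable: a point where the leading coefficient survives extends to
  a point where the polynomial does.
\<close>

lemma eval_via_neq_0:
  assumes "h 0 = 0" "h (lead_coeff P) \<noteq> 0" "infinite A"
  obtains y where "y \<in> A" "eval_via h y P \<noteq> 0"
proof -
  have "coeff (map_poly h P) (degree P) \<noteq> 0" using assms by (simp add: coeff_map_poly)
  hence "map_poly h P \<noteq> 0" by auto
  hence "finite {y. poly (map_poly h P) y = 0}" by (rule poly_roots_finite)
  hence "\<not> A \<subseteq> {y. poly (map_poly h P) y = 0}" using assms(3) finite_subset by blast
  thus ?thesis using that by (auto simp: eval_via_def)
qed

text \<open>
  Points whose three parameters have absolute value one are admissible for every \<open>q\<close> in the punctured unit disc, because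
  powers of \<open>q\<close> with nonzero exponent have a different absolute value. So \<open>q\<close> can be chosen after \<open>a\<close>, \<open>b\<close>, \<open>c\<close>.
\<close>

definition unimodular :: "complex \<Rightarrow> complex \<Rightarrow> complex \<Rightarrow> bool" where
  "unimodular a b c \<longleftrightarrow> norm a = 1 \<and> norm b = 1 \<and> norm c = 1 \<and> a \<noteq> 1 \<and> b \<noteq> 1 \<and> c \<noteq> 1 \<and> a \<noteq> b \<and> a \<noteq> c \<and> b \<noteq> c"

lemma unit_int_power:
  fixes q :: complex
  assumes "0 < norm q" "norm q < 1" "norm u = 1" "u \<in> int_powers q"
  shows "u = 1"
proof -
  obtain j where u: "u = q powi j" using assms(4) by (auto simp: int_powers_def)
  have "norm q powi j = 1" using assms(3) by (simp add: u norm_power_int)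
  hence "of_real (norm q) powi j = (1 :: complex)" by (metis of_real_1 of_real_power_int)
  hence "j = 0" by (rule not_root_of_unity[rotated 2]) (use assms in auto)
  thus ?thesis by (simp add: u)
qed

lemma unimodular_admissible:
  assumes "unimodular a b c" "0 < norm q" "norm q < 1"
  shows "admissible a b c q"
proof -
  have "a \<noteq> 0" "b \<noteq> 0" "c \<noteq> 0" using assms(1) by (auto simp: unimodular_def)
  thus ?thesis
    using assms unit_int_power[OF assms(2,3)] unfolding admissible_def unimodular_def
    by (auto simp: norm_divide dest!: unit_int_power[OF assms(2,3), rotated])
qed

lemma eval5_eq_0_imp:
  assumes "\<And>a b c q x. unimodular a b c \<Longrightarrow> 0 < norm q \<Longrightarrow> norm q < 1 \<Longrightarrow> norm x < 1 \<Longrightarrow> eval5 P a b c q x = 0"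
  shows "P = 0"
proof (rule ccontr)
  assume P: "P \<noteq> 0"
  define P1 where "P1 = lead_coeff P"
  define P2 where "P2 = lead_coeff P1"
  define P3 where "P3 = lead_coeff P2"
  define P4 where "P4 = lead_coeff P3"
  have "P4 \<noteq> 0" using P by (simp add: P1_def P2_def P3_def P4_def)
  note hom = is_hom_of_rat is_hom_eval_via
  have circ: "infinite ({z :: complex. norm z = 1} - F)" if "finite F" for F
    using infinite_unit_circle that by (rule Diff_infinite_finite[rotated])
  obtain a where a: "a \<in> {z. norm z = 1} - {1}" "eval_via of_rat a P4 \<noteq> 0"
    by (rule eval_via_neq_0[of of_rat P4 "{z. norm z = 1} - {1}"]) (use \<open>P4 \<noteq> 0\<close> circ in auto)
  obtain b where b: "b \<in> {z. norm z = 1} - {1, a}" "eval_via (eval_via of_rat a) b P3 \<noteq> 0"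
    by (rule eval_via_neq_0[of "eval_via of_rat a" P3 "{z. norm z = 1} - {1, a}"])
      (use a circ in \<open>auto simp: P4_def\<close>)
  obtain c where c: "c \<in> {z. norm z = 1} - {1, a, b}" "eval_via (eval_via (eval_via of_rat a) b) c P2 \<noteq> 0"
    by (rule eval_via_neq_0[of "eval_via (eval_via of_rat a) b" P2 "{z. norm z = 1} - {1, a, b}"])
      (use b circ in \<open>auto simp: P3_def\<close>)
  have disc: "infinite (ball (0 :: complex) 1)" by (metis countable_finite uncountable_ball zero_less_one)
  obtain q where q: "q \<in> ball 0 1 - {0}" "eval_via (eval_via (eval_via (eval_via of_rat a) b) c) q P1 \<noteq> 0"
    by (rule eval_via_neq_0[of "eval_via (eval_via (eval_via of_rat a) b) c" P1 "ball 0 1 - {0}"])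
      (use c disc in \<open>auto simp: P2_def\<close>)
  obtain x where x: "x \<in> ball 0 1" "eval_via (eval_via (eval_via (eval_via (eval_via of_rat a) b) c) q) x P \<noteq> 0"
    by (rule eval_via_neq_0[of "eval_via (eval_via (eval_via (eval_via of_rat a) b) c) q" P "ball 0 1"])
      (use q disc in \<open>auto simp: P1_def\<close>)
  have "eval5 P a b c q x = 0"
    using a b c q x by (intro assms) (auto simp: unimodular_def)
  with x show False by (simp add: eval5_def)
qed

lemma qshift_of_poly: "qshift q (fps_of_poly p) = fps_of_poly (pcompose p [:0, q:])"
  unfolding qshift_def by (simp add: fps_of_poly_pcompose fps_of_poly_pCons mult.commute)

lemma finite_support_fps_of_poly:
  fixes f :: "complex fps"
  assumes "\<And>n. n > N \<Longrightarrow> f $ n = 0"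
  obtains p where "f = fps_of_poly p" "degree p \<le> N"
proof
  define p where "p = (\<Sum>n\<le>N. monom (f $ n) n)"
  show "f = fps_of_poly p"
    by (rule fps_ext) (use assms in \<open>auto simp: p_def coeff_sum\<close>)
  show "degree p \<le> N"
    unfolding p_def by (rule degree_sum_le) (auto intro: order.trans[OF degree_monom_le])
qed

lemma poly_eq_0_if_geometric_roots:
  fixes p :: "complex poly"
  assumes q: "0 < norm q" "norm q < 1" and z: "z \<noteq> 0" and I: "infinite I" "\<And>i. i \<in> I \<Longrightarrow> poly p (q powi i * z) = 0"
  shows "p = 0"
proof (rule ccontr)
  assume "p \<noteq> 0"
  hence "finite {x. poly p x = 0}" by (rule poly_roots_finite)
  moreover have "(\<lambda>i. q powi i * z) ` I \<subseteq> {x. poly p x = 0}" using I(2) by auto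
  moreover have "inj_on (\<lambda>i. q powi i * z) I"
  proof (rule inj_onI)
    fix i j assume "q powi i * z = q powi j * z"
    hence e: "q powi i = q powi j" using z by simp
    have "q \<noteq> 0" using q by auto
    hence "q powi (i - j) = 1" using e by (simp add: power_int_diff)
    thus "i = j" using not_root_of_unity[OF q] by fastforce
  qed
  ultimately show False using I(1) by (metis finite_imageD finite_subset)
qed

text \<open>
  A common zero \<open>z\<close> is a zero at \<open>z\<close> and \<open>q * z\<close>, and the second order q-difference equation propagates it to
  further points \<open>q powi i * z\<close>. Propagation to positive \<open>i\<close> can only stop where \<open>c / q = a * b * (q powi i * z)\<close>, to negative
  \<open>i\<close> only where \<open>q powi i * z = 1\<close>; both at once would make \<open>c / b\<close> a power of \<open>q\<close>. So the polynomial
  would have infinitely many zeros.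
\<close>

lemma no_common_root:
  assumes q: "0 < norm q" "norm q < 1" and bc: "norm b = 1" "norm c = 1" "b \<noteq> c" "c \<noteq> 1"
    and a: "a = q powi (- int N)"
    and p0: "hyp q a b c 1 = fps_of_poly p0" and p1: "hyp q (a * q) (b * q) (c * q) 1 = fps_of_poly p1"
    and z: "poly p0 z = 0" "poly p1 z = 0"
  shows False
proof -
  have q0: "q \<noteq> 0" using q by auto
  have c: "nonres q c" using nonres_not_int_power[OF q0] unit_int_power[OF q] bc by blast
  have "poly p0 0 = 1" using hyp_0[of q a b c 1] by (simp add: p0 poly_0_coeff_0)
  hence z0: "z \<noteq> 0" and p0_neq: "p0 \<noteq> 0" using z by auto
  define s where "s = (\<lambda>i. poly p0 (q powi i * z))"
  have s0: "s 0 = 0" by (simp add: s_def z)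
  have s1: "s 1 = 0"
  proof -
    have "fps_of_poly (p0 - pcompose p0 [:0, q:]) = fps_of_poly ([:0, (1 - a) * (1 - b) / (1 - c):] * p1)"
      using hyp_minus_qshift[OF q c, of a b] unfolding p0 p1 qshift_of_poly
      by (simp add: fps_of_poly_diff fps_of_poly_mult fps_of_poly_pCons)
    hence e: "p0 - pcompose p0 [:0, q:] = [:0, (1 - a) * (1 - b) / (1 - c):] * p1" by simp
    have "poly (p0 - pcompose p0 [:0, q:]) z = 0" unfolding e using z by simp
    thus ?thesis using z by (simp add: s_def poly_pcompose mult.commute)
  qed
  have rec: "(1 - x) * poly p0 x - (1 + c / q - (a + b) * x) * poly p0 (q * x) + (c / q - a * b * x) * poly p0 (q * (q * x)) = 0" for x
  proof -
    define L where "L = [:1, - 1:] * p0 - [:1 + c / q, - (a + b):] * pcompose p0 [:0, q:]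
      + [:c / q, - (a * b):] * pcompose (pcompose p0 [:0, q:]) [:0, q:]"
    have lin: "fps_of_poly [:u, - v:] = fps_const u - fps_const v * fps_X" for u v :: complex
      by (simp add: fps_of_poly_pCons mult.commute)
    have "fps_of_poly L = 0"
      using qhyp_eq_hyp[OF q c, of a b 1] unfolding qhyp_eq_def p0 qshift_of_poly L_def
      by (simp only: fps_of_poly_diff fps_of_poly_add fps_of_poly_mult lin) simp
    hence "L = 0" by simp
    hence "poly L x = 0" by simp
    thus ?thesis by (simp add: L_def poly_pcompose algebra_simps)
  qed
  have srec: "(1 - q powi i * z) * s i - (1 + c / q - (a + b) * (q powi i * z)) * s (i + 1)
      + (c / q - a * b * (q powi i * z)) * s (i + 2) = 0" for i
  proof -
    have "q * (q powi j * z) = q powi (j + 1) * z" for j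
      using q0 by (simp add: power_int_add)
    from this[of i] this[of "i + 1"]
    have e: "q * (q powi i * z) = q powi (i + 1) * z" "q * (q powi (i + 1) * z) = q powi (i + 2) * z"
      by (simp_all add: add.assoc)
    show ?thesis using rec[of "q powi i * z"] unfolding e s_def .
  qed
  show False
  proof (cases "\<forall>n::nat. c / q \<noteq> a * b * (q powi int n * z)")
    case True
    have "s (int n) = 0 \<and> s (int n + 1) = 0" for n
    proof (induction n)
      case (Suc n)
      have "s (int n + 2) = 0" using srec[of "int n"] Suc True by simp
      thus ?case using Suc by (simp add: add.commute)
    qed (use s0 s1 in auto)
    hence "p0 = 0"
      by (intro poly_eq_0_if_geometric_roots[OF q z0, of "range int"])
        (auto simp: s_def finite_image_iff)
    with p0_neq show False by simp
  next
    case False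
    then obtain n :: nat where n: "c / q = a * b * (q powi int n * z)" by blast
    have free: "q powi (- int j) * z \<noteq> 1" for j
    proof
      assume "q powi (- int j) * z = 1"
      hence "z = q powi int j" using q0 by (simp add: power_int_minus field_simps)
      hence "c = q * (a * b * (q powi int n * q powi int j))" using n q0 by (simp add: field_simps)
      also have "\<dots> = b * q powi (1 - int N + int n + int j)"
        unfolding a using q0 by (simp add: power_int_add power_int_diff power_int_minus field_simps)
      finally have "c / b = q powi (1 - int N + int n + int j)" using bc by auto
      hence "c / b \<in> int_powers q" by (auto simp: int_powers_def)
      from unit_int_power[OF q _ this] bc show False by (auto simp: norm_divide)
    qed
    have "s (- int j) = 0 \<and> s (- int j + 1) = 0" for j
    proof (induction j)
      case (Suc j)
      have "- int (Suc j) + 1 = - int j" "- int (Suc j) + 2 = - int j + 1" by simp_all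
      hence "(1 - q powi (- int (Suc j)) * z) * s (- int (Suc j)) = 0"
        using srec[of "- int (Suc j)"] Suc by (simp only:) simp
      moreover have "1 - q powi (- int (Suc j)) * z \<noteq> 0" using free[of "Suc j"] by simp
      ultimately show ?case using Suc by simp
    qed (use s0 s1 in auto)
    hence "p0 = 0"
      by (intro poly_eq_0_if_geometric_roots[OF q z0, of "range (\<lambda>j. - int j)"])
        (auto simp: s_def finite_image_iff inj_on_def)
    with p0_neq show False by simp
  qed
qed

text \<open>
  Linear factors of \<open>p\<close> are cancelled one by one; each has to divide \<open>s\<close>.
\<close>

lemma dvd_if_no_common_root:
  fixes p r s :: "complex poly"
  assumes "p \<noteq> 0" "\<And>z. poly p z = 0 \<Longrightarrow> poly r z \<noteq> 0" "p dvd s * r"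
  shows "p dvd s"
  using assms
proof (induction "degree p" arbitrary: p s)
  case 0
  hence "p dvd 1" by (simp add: is_unit_iff_degree)
  thus ?case by (rule dvd_trans) simp
next
  case (Suc n)
  hence "\<not> constant (poly p)" by (simp add: constant_degree)
  then obtain z where z: "poly p z = 0" using fundamental_theorem_of_algebra by blast
  then obtain p' where p': "p = [:- z, 1:] * p'" by (auto simp: poly_eq_0_iff_dvd elim: dvdE)
  obtain t where t: "s * r = p * t" using Suc.prems(3) by (elim dvdE)
  have "poly (p * t) z = 0" using z by simp
  hence "poly (s * r) z = 0" by (simp only: t)
  hence "poly s z = 0" using Suc.prems(2)[OF z] by simp
  then obtain s' where s': "s = [:- z, 1:] * s'" by (auto simp: poly_eq_0_iff_dvd elim: dvdE)
  have p'0: "p' \<noteq> 0" using Suc.prems(1) p' by auto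
  have "p' dvd s'"
  proof (rule Suc.hyps(1))
    have "degree p = Suc (degree p')" using p'0 unfolding p' by (subst degree_mult_eq) auto
    thus "n = degree p'" using Suc.hyps(2) by simp
    show "poly r w \<noteq> 0" if "poly p' w = 0" for w using Suc.prems(2)[of w] that by (simp add: p')
    have "[:- z, 1:] * p' dvd [:- z, 1:] * (s' * r)" using Suc.prems(3) unfolding p' s' by (simp only: mult.assoc)
    thus "p' dvd s' * r" by (simp only: dvd_mult_cancel_left) auto
  qed (rule p'0)
  thus ?case unfolding p' s' by (rule mult_dvd_mono[OF dvd_refl])
qed

text \<open>
  For fixed \<open>b\<close>, \<open>c\<close>, \<open>q\<close> a polynomial function is a polynomial in \<open>x\<close> with coefficients that are polynomials in \<open>a\<close>,
  which makes its degree in \<open>x\<close> bounded independently of \<open>a\<close>.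
\<close>

lemma eval5_bivariate:
  obtains Xp :: "complex poly poly" where
    "\<And>a x. eval5 P a b c q x = poly (map_poly (\<lambda>r. poly r a) Xp) x"
proof -
  have hom: "is_hom (\<lambda>r. poly r a)" for a :: complex
    by (simp add: is_hom_def)
  note h = is_hom_eval[OF hom]
  have "\<exists>Xp. \<forall>t. eval5 P (fst t) b c q (snd t) = poly (map_poly (\<lambda>r. poly r (fst t)) Xp) (snd t)"
  proof (rule eval5_closed[where F = "\<lambda>f. \<exists>Xp :: complex poly poly. \<forall>t. f t = poly (map_poly (\<lambda>r. poly r (fst t)) Xp) (snd t)"])
    show const: "\<exists>Xp :: complex poly poly. \<forall>t. r = poly (map_poly (\<lambda>r. poly r (fst t)) Xp) (snd t)" for r :: complex
      by (rule exI[of _ "[:[:r:]:]"]) (simp add: map_poly_pCons)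
    show "\<exists>Xp :: complex poly poly. \<forall>t. b = poly (map_poly (\<lambda>r. poly r (fst t)) Xp) (snd t)"
      "\<exists>Xp :: complex poly poly. \<forall>t. c = poly (map_poly (\<lambda>r. poly r (fst t)) Xp) (snd t)"
      "\<exists>Xp :: complex poly poly. \<forall>t. q = poly (map_poly (\<lambda>r. poly r (fst t)) Xp) (snd t)"
      by (rule const)+
    show "\<exists>Xp :: complex poly poly. \<forall>t. fst t = poly (map_poly (\<lambda>r. poly r (fst t)) Xp) (snd t)"
      by (rule exI[of _ "[:[:0, 1:]:]"]) (simp add: map_poly_pCons)
    show "\<exists>Xp :: complex poly poly. \<forall>t. snd t = poly (map_poly (\<lambda>r. poly r (fst t)) Xp) (snd t)"
      by (rule exI[of _ "[:0, 1:]"]) (simp add: map_poly_pCons)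
    fix f g :: "complex \<times> complex \<Rightarrow> complex"
    assume "\<exists>Xp. \<forall>t. f t = poly (map_poly (\<lambda>r. poly r (fst t)) Xp) (snd t)"
      "\<exists>Xp. \<forall>t. g t = poly (map_poly (\<lambda>r. poly r (fst t)) Xp) (snd t)"
    then obtain X1 X2 where
      "\<And>t. f t = poly (map_poly (\<lambda>r. poly r (fst t)) X1) (snd t)" "\<And>t. g t = poly (map_poly (\<lambda>r. poly r (fst t)) X2) (snd t)"
      by blast
    thus "\<exists>Xp. \<forall>t. f t + g t = poly (map_poly (\<lambda>r. poly r (fst t)) Xp) (snd t)"
      "\<exists>Xp. \<forall>t. f t * g t = poly (map_poly (\<lambda>r. poly r (fst t)) Xp) (snd t)"
      by (auto simp: is_homD(3,4)[OF h, symmetric])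
  qed
  then obtain Xp where "\<And>t. eval5 P (fst t) b c q (snd t) = poly (map_poly (\<lambda>r. poly r (fst t)) Xp) (snd t)" by blast
  from this[of "(a, x)" for a x] that show ?thesis by auto
qed

text \<open>
  The point \<open>a = q powi (- N)\<close> is not admissible, but the coefficient of each power of \<open>x\<close> in the relation is a polynomial
  in \<open>a\<close>, so the relation persists there. As the two functions become coprime polynomials, \<open>phi21 a b c q\<close> divides
  the value of \<open>X\<close>, which is impossible for \<open>N\<close> larger than the degree of \<open>X\<close> in \<open>x\<close> unless the
  value is zero. A polynomial in \<open>a\<close> with all these zeros vanishes.
\<close>

theorem basic_functions_independent:
  assumes rel: "\<And>a b c q x. admissible a b c q \<Longrightarrow> norm x < 1 \<Longrightarrow>
      eval5 X a b c q x * phi21 (a * q) (b * q) (c * q) q x + eval5 Y a b c q x * phi21 a b c q x = 0"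
  shows "X = 0" "Y = 0"
proof -
  have both: "eval5 X a b c q x = 0 \<and> eval5 Y a b c q x = 0"
    if uni: "unimodular a b c" and q: "0 < norm q" "norm q < 1" for a b c q x
  proof -
    have q0: "q \<noteq> 0" using q by auto
    have bc: "norm b = 1" "norm c = 1" "b \<noteq> 1" "c \<noteq> 1" "b \<noteq> c" using uni by (auto simp: unimodular_def)
    have nr1: "nonres q u" if "norm u = 1" "u \<noteq> 1" for u
      using nonres_not_int_power[OF q0] unit_int_power[OF q] that by blast
    have nrs: "nonres q (u * q)" if "nonres q u" for u
      by (rule nonres_shift[OF q0 that, of _ 1]) simp
    obtain Xp where Xp: "\<And>a x. eval5 X a b c q x = poly (map_poly (\<lambda>r. poly r a) Xp) x"
      using eval5_bivariate[of X b c q] by blast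
    obtain Yp where Yp: "\<And>a x. eval5 Y a b c q x = poly (map_poly (\<lambda>r. poly r a) Yp) x"
      using eval5_bivariate[of Y b c q] by blast
    define Xa Ya where "Xa = (\<lambda>a. map_poly (\<lambda>r. poly r a) Xp)" and "Ya = (\<lambda>a. map_poly (\<lambda>r. poly r a) Yp)"
    define f0 f1 where "f0 = (\<lambda>a. hyp q a b c 1)" and "f1 = (\<lambda>a. hyp q (a * q) (b * q) (c * q) 1)"
    \<comment> \<open>Unimodular \<open>a\<close>: the relation holds on the unit disc, hence between the power series.\<close>
    have good: "fps_of_poly (Xa a) * f1 a + fps_of_poly (Ya a) * f0 a = 0" if "norm a = 1" "a \<notin> {1, b, c}" for a
    proof (rule eval_fps_eqD)
      have adm: "admissible a b c q" using that bc q by (intro unimodular_admissible) (auto simp: unimodular_def)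
      have r: "fps_conv_radius (f1 a) = 1" "fps_conv_radius (f0 a) = 1"
        unfolding f0_def f1_def using that bc by (auto intro!: hyp_conv_radius[OF q] nr1 nrs)
      have R: "1 \<le> fps_conv_radius (fps_of_poly p * f)" if "fps_conv_radius f = 1" for p and f :: "complex fps"
        by (rule order.trans[OF _ fps_conv_radius_mult]) (use that in simp)
      have "1 \<le> min (fps_conv_radius (fps_of_poly (Xa a) * f1 a)) (fps_conv_radius (fps_of_poly (Ya a) * f0 a))"
        using R r by simp
      also have "\<dots> \<le> fps_conv_radius (fps_of_poly (Xa a) * f1 a + fps_of_poly (Ya a) * f0 a)"
        by (rule fps_conv_radius_add)
      finally show "0 < fps_conv_radius (fps_of_poly (Xa a) * f1 a + fps_of_poly (Ya a) * f0 a)"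
        by (rule less_le_trans[rotated]) simp
      have "eval_fps (fps_of_poly (Xa a) * f1 a + fps_of_poly (Ya a) * f0 a) x = 0" if "norm x < 1" for x
      proof -
        have n: "ereal (norm x) < 1" using that by (simp add: one_ereal_def)
        have n': "ereal (norm x) < fps_conv_radius (fps_of_poly (Xa a) * f1 a)"
          "ereal (norm x) < fps_conv_radius (fps_of_poly (Ya a) * f0 a)"
          using less_le_trans[OF n R] r by auto
        have "eval_fps (fps_of_poly (Xa a) * f1 a + fps_of_poly (Ya a) * f0 a) x
          = poly (Xa a) x * eval_fps (f1 a) x + poly (Ya a) x * eval_fps (f0 a) x"
          using n n' r by (simp add: eval_fps_add eval_fps_mult)
        thus ?thesis using rel[OF adm that] unfolding Xp Yp Xa_def Ya_def f0_def f1_def eval_hyp by simp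
      qed
      hence "\<forall>x\<in>ball 0 1. eval_fps (fps_of_poly (Xa a) * f1 a + fps_of_poly (Ya a) * f0 a) x = eval_fps 0 x" by simp
      moreover have "eventually (\<lambda>x :: complex. x \<in> ball 0 1) (nhds 0)" by (rule eventually_nhds_in_open) auto
      ultimately show "\<forall>\<^sub>F x in nhds 0. eval_fps (fps_of_poly (Xa a) * f1 a + fps_of_poly (Ya a) * f0 a) x = eval_fps 0 x"
        by (auto elim: eventually_mono)
    qed simp
    \<comment> \<open>All \<open>a\<close>: each coefficient is a polynomial in \<open>a\<close> that vanishes on most of the unit circle.\<close>
    have all: "fps_of_poly (Xa a) * f1 a + fps_of_poly (Ya a) * f0 a = 0" for a
    proof (rule fps_ext)
      fix n
      define g0 g1 where "g0 = (\<lambda>j. smult (qpoch b q (int j) / (qpoch q q (int j) * qpoch c q (int j))) (qprod q 1 j))"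
        and "g1 = (\<lambda>j. smult (qpoch (b * q) q (int j) / (qpoch q q (int j) * qpoch (c * q) q (int j))) (qprod q q j))"
      have g: "f0 a $ j = poly (g0 j) a" "f1 a $ j = poly (g1 j) a" for j a
        by (simp_all add: f0_def f1_def g0_def g1_def hyp_def qpoch_qprod mult.commute[of q])
      define G where "G = (\<Sum>i=0..n. coeff Xp i * g1 (n - i)) + (\<Sum>i=0..n. coeff Yp i * g0 (n - i))"
      have G: "(fps_of_poly (Xa a) * f1 a + fps_of_poly (Ya a) * f0 a) $ n = poly G a" for a
        by (simp add: fps_mult_nth G_def g Xa_def Ya_def coeff_map_poly poly_sum)
      have "{a. norm a = 1} - {1, b, c} \<subseteq> {a. poly G a = 0}"
      proof
        fix a assume "a \<in> {a. norm a = 1} - {1, b, c}"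
        hence "fps_of_poly (Xa a) * f1 a + fps_of_poly (Ya a) * f0 a = 0" by (intro good) auto
        thus "a \<in> {a. poly G a = 0}" by (simp only: G[symmetric] fps_zero_nth mem_Collect_eq)
      qed
      hence "infinite {a. poly G a = 0}"
        using infinite_unit_circle by (metis (no_types, lifting) finite.emptyI finite.insertI finite_Diff2 finite_subset)
      hence G0: "G = 0" using poly_roots_finite by blast
      show "(fps_of_poly (Xa a) * f1 a + fps_of_poly (Ya a) * f0 a) $ n = 0 $ n" unfolding G G0 by simp
    qed
    have special: "Xa (q powi (- int N)) = 0 \<and> Ya (q powi (- int N)) = 0" if N: "N > degree Xp" for N
    proof -
      define a where "a = q powi (- int N)"
      have aq: "a * q = q powi (- int (N - 1))"
        using N q0 by (simp add: a_def of_nat_diff power_int_diff power_int_minus power_int_add divide_inverse)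
      have "f0 a $ n = 0" if "n > N" for n
        unfolding f0_def hyp_def a_def using qpoch_negative_power_eq_0[OF q0 that] by simp
      then obtain p0 where p0: "f0 a = fps_of_poly p0" by (rule finite_support_fps_of_poly)
      have "f1 a $ n = 0" if "n > N - 1" for n
        unfolding f1_def hyp_def aq using qpoch_negative_power_eq_0[OF q0 that] by simp
      then obtain p1 where p1: "f1 a = fps_of_poly p1" by (rule finite_support_fps_of_poly)
      have "coeff p0 N \<noteq> 0"
      proof -
        have "qpoch a q (int N) \<noteq> 0"
        proof (rule qpoch_neq_0)
          fix i assume "0 \<le> i" "i < int N"
          moreover have "q powi (- int N + i) = a * q powi i"
            unfolding a_def using q0 by (intro power_int_add) auto
          ultimately show "a * q powi i \<noteq> 1" using not_root_of_unity[OF q, of "- int N + i"] by auto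
        qed auto
        moreover have "qpoch b q (int N) \<noteq> 0" "qpoch c q (int N) \<noteq> 0" "qpoch q q (int N) \<noteq> 0"
          using bc nr1 q by (auto simp: qpoch_nonres qpoch_q_neq_0)
        moreover have "coeff p0 N = f0 a $ N" by (simp add: p0)
        ultimately show ?thesis by (simp add: f0_def hyp_def)
      qed
      hence deg: "degree p0 \<ge> N" and p0_neq: "p0 \<noteq> 0" by (auto intro: le_degree)
      have no_common: "poly p1 z \<noteq> 0" if "poly p0 z = 0" for z
        using no_common_root[OF q bc(1,2,5,4) a_def _ _ that] p0 p1 unfolding f0_def f1_def by blast
      have "fps_of_poly (Xa a * p1 + Ya a * p0) = 0"
        using all[of a] unfolding p0 p1 by (simp add: fps_of_poly_add fps_of_poly_mult)
      hence sum: "Xa a * p1 + Ya a * p0 = 0" by simp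
      hence "Xa a * p1 = - Ya a * p0" by (simp add: eq_neg_iff_add_eq_0)
      hence "p0 dvd Xa a * p1" by simp
      hence "p0 dvd Xa a" using dvd_if_no_common_root[OF p0_neq no_common] by blast
      moreover have "degree (Xa a) \<le> degree Xp" unfolding Xa_def by (rule degree_le) (simp add: coeff_map_poly coeff_eq_0)
      ultimately have "Xa a = 0" using deg N by (metis dvd_imp_degree_le le_trans not_less)
      thus ?thesis using sum p0_neq unfolding a_def by simp
    qed
    have inf: "infinite ((\<lambda>N. q powi (- int N)) ` {N. N > degree Xp})"
    proof -
      have "inj_on (\<lambda>N. q powi (- int N)) {N. N > degree Xp}"
      proof (rule inj_onI)
        fix i j assume e: "q powi (- int i) = q powi (- int j)"
        have "q powi (- int i - - int j) = 1" using e q0 by (subst power_int_diff) auto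
        thus "i = j" using not_root_of_unity[OF q] by fastforce
      qed
      moreover have "infinite {N. N > degree Xp}" by (metis infinite_Ioi greaterThan_def)
      ultimately show ?thesis using finite_imageD by blast
    qed
    have zero: "coeff Z i = 0" if Z: "\<And>N. N > degree Xp \<Longrightarrow> map_poly (\<lambda>r. poly r (q powi (- int N))) Z = 0" for Z i
    proof (rule ccontr)
      assume "coeff Z i \<noteq> 0"
      hence "finite {y. poly (coeff Z i) y = 0}" by (rule poly_roots_finite)
      moreover have "(\<lambda>N. q powi (- int N)) ` {N. N > degree Xp} \<subseteq> {y. poly (coeff Z i) y = 0}"
      proof clarsimp
        fix N assume "N > degree Xp"
        from arg_cong[OF Z[OF this], of "\<lambda>p. coeff p i"]
        show "poly (coeff Z i) (q powi (- int N)) = 0" by (simp add: coeff_map_poly)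
      qed
      ultimately show False using inf finite_subset by blast
    qed
    have "Xp = 0" "Yp = 0"
      by (rule poly_eqI, simp add: zero special[unfolded Xa_def Ya_def])+
    thus ?thesis by (simp add: Xp Yp)
  qed
  show "X = 0" "Y = 0" by (rule eval5_eq_0_imp; use both in blast)+
qed

section \<open>Existence and uniqueness of the coefficients\<close>

lemma eventually_poly_neq_0:
  fixes p :: "complex poly"
  assumes "p \<noteq> 0"
  shows "eventually (\<lambda>y. poly p y \<noteq> 0) (at x)"
proof -
  have "eventually (\<lambda>y. \<forall>r\<in>{r. poly p r = 0}. y \<noteq> r) (at x)"
    by (intro eventually_ball_finite poly_roots_finite[OF assms] ballI eventually_neq_at_within)
  thus ?thesis by (rule eventually_mono) auto
qed

lemma qpoch_neg_one: "q \<noteq> 0 \<Longrightarrow> qpoch u q (- 1) = inverse (1 - u / q)"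
  using qpoch_neg_Suc[of u q 0] by (simp add: power_int_minus divide_inverse)

text \<open>
  The points where the formula for \<open>Q\<close> makes sense, and below those for \<open>R\<close>.
\<close>

definition Q_points :: "int \<Rightarrow> int \<Rightarrow> int \<Rightarrow> point set" where
  "Q_points k l m = {p. admissible (pa p) (pb p) (pc p) (pq p) \<and> (px p \<noteq> 0 \<or> m \<le> 1) \<and>
     qpoch (pa p * pb p * pq p * px p / pc p) (pq p) (max (k + l - m) 0 - 1) \<noteq> 0}"

definition R_points :: "int \<Rightarrow> int \<Rightarrow> int \<Rightarrow> point set" where
  "R_points k l m = {p. admissible (pa p) (pb p) (pc p) (pq p) \<and> (px p \<noteq> 0 \<or> m \<le> 1) \<and>
     qpoch (pa p * pb p * pq p * px p / pc p) (pq p) (max (k + l - m - 1) 0) \<noteq> 0}"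

lemma admissible_neq:
  assumes "admissible a b c q"
  shows "q \<noteq> 0" "a \<noteq> 0" "b \<noteq> 0" "c \<noteq> 0" "c \<noteq> 1" "q \<noteq> c"
proof -
  have "q powi 0 \<in> int_powers q" "q powi 1 \<in> int_powers q" unfolding int_powers_def by blast+
  thus "q \<noteq> 0" "a \<noteq> 0" "b \<noteq> 0" "c \<noteq> 0" "c \<noteq> 1" "q \<noteq> c" using assms by (auto simp: admissible_def)
qed

lemma admissible_shift:
  assumes "admissible a b c q"
  shows "admissible (a * q) (b * q) (c * q) q"
proof -
  have q: "q \<noteq> 0" using admissible_neq[OF assms] by simp
  have s: "u * q \<notin> int_powers q" if u: "u \<notin> int_powers q" for u
  proof
    assume "u * q \<in> int_powers q"
    then obtain j where "u * q = q powi j" by (auto simp: int_powers_def)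
    hence "u = q powi (j - 1)" using q by (simp add: power_int_diff field_simps)
    thus False using u by (auto simp: int_powers_def)
  qed
  show ?thesis using assms q s by (simp add: admissible_def)
qed

lemma rational_x_power:
  assumes "\<And>p. p \<in> S \<Longrightarrow> px p \<noteq> 0 \<or> m \<le> 1"
  shows "rational_on S (\<lambda>p. px p powi (1 - max m 0))" "rational_on S (\<lambda>p. px p powi (- max (m - 1) 0))"
proof -
  have "m \<le> 1 \<or> (\<forall>p\<in>S. px p \<noteq> 0)" using assms by blast
  thus "rational_on S (\<lambda>p. px p powi (1 - max m 0))" "rational_on S (\<lambda>p. px p powi (- max (m - 1) 0))"
    by (auto intro!: rational_on_powi rational_on_coord)
qed

lemma Q_rational: "rational_on (Q_points k l m) (\<lambda>p. Q_value k l m (pa p) (pb p) (pc p) (pq p) (px p))"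
proof -
  define S where "S = Q_points k l m"
  define N where "N = max (k + l - m) 0 - 1"
  have adm: "admissible (pa p) (pb p) (pc p) (pq p)" if "p \<in> S" for p using that by (simp add: S_def Q_points_def)
  have x: "px p \<noteq> 0 \<or> m \<le> 1" if "p \<in> S" for p using that by (simp add: S_def Q_points_def)
  have nz: "qpoch (pa p * pb p * pq p * px p / pc p) (pq p) N \<noteq> 0" if "p \<in> S" for p
    using that by (simp add: S_def Q_points_def N_def)
  note rules = rational_on_mult rational_on_divide rational_on_diff rational_on_minus rational_on_1 rational_on_coord
    rational_x_power[OF x]
  have u: "rational_on S (\<lambda>p. pa p * pb p * pq p * px p / pc p)" "rational_on S (\<lambda>p. pa p * pb p * pq p * px p / pc p / pq p)"
    by (intro rules; use admissible_neq[OF adm] in auto)+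
  have "rational_on S (\<lambda>p. qpoch (pa p * pb p * pq p * px p / pc p) (pq p) N)"
  proof (cases "N \<ge> 0")
    case True
    thus ?thesis by (intro rational_on_qpoch u rational_on_coord) auto
  next
    case False
    hence N: "N = - 1" by (simp add: N_def)
    \<comment> \<open>At index \<open>-1\<close> only the single value \<open>u = q\<close> of the base has to be avoided, and there the factorial is zero by convention.\<close>
    have e: "qpoch (pa p * pb p * pq p * px p / pc p) (pq p) N = inverse (1 - pa p * pb p * pq p * px p / pc p / pq p)"
      if "p \<in> S" for p
      unfolding N using admissible_neq[OF adm[OF that]] by (intro qpoch_neg_one)
    have "rational_on S (\<lambda>p. inverse (1 - pa p * pb p * pq p * px p / pc p / pq p))"
    proof (intro rational_on_inverse rational_on_diff rational_on_1 u)
      fix p assume "p \<in> S"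
      from nz[OF this] show "1 - pa p * pb p * pq p * px p / pc p / pq p \<noteq> 0" unfolding e[OF \<open>p \<in> S\<close>] by auto
    qed
    thus ?thesis by (rule rational_on_cong) (rule e)
  qed
  moreover have "rational_on S (\<lambda>p. poly (P_poly k l m (pa p) (pb p) (pc p) (pq p)) (px p))"
    by (rule rational_P_poly) (use adm in \<open>auto intro: rational_on_coord\<close>)
  ultimately show ?thesis
    unfolding Q_value_def S_def[symmetric] N_def[symmetric]
    by (intro rules) (use admissible_neq[OF adm] nz x in auto)
qed

lemma R_rational: "rational_on (R_points k l m) (\<lambda>p. R_value k l m (pa p) (pb p) (pc p) (pq p) (px p))"
proof -
  define S where "S = R_points k l m"
  have adm: "admissible (pa p) (pb p) (pc p) (pq p)" if "p \<in> S" for p using that by (simp add: S_def R_points_def)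
  have x: "px p \<noteq> 0 \<or> m \<le> 1" if "p \<in> S" for p using that by (simp add: S_def R_points_def)
  have nz: "qpoch (pa p * pb p * pq p * px p / pc p) (pq p) (max (k + l - m - 1) 0) \<noteq> 0" if "p \<in> S" for p
    using that by (simp add: S_def R_points_def)
  note rules = rational_on_mult rational_on_divide rational_on_minus rational_on_coord rational_x_power[OF x]
  have u: "rational_on S (\<lambda>p. pa p * pb p * pq p * px p / pc p)"
    using admissible_neq[OF adm] by (auto intro!: rules)
  have "rational_on S (\<lambda>p. qpoch (pa p * pb p * pq p * px p / pc p) (pq p) (max (k + l - m - 1) 0))"
    by (intro rational_on_qpoch u rational_on_coord) auto
  moreover have "rational_on S (\<lambda>p. poly (P_poly (k - 1) (l - 1) (m - 1) (pa p * pq p) (pb p * pq p) (pc p * pq p) (pq p)) (px p))"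
    by (rule rational_P_poly) (use adm admissible_shift in \<open>auto intro!: rules\<close>)
  ultimately show ?thesis
    unfolding R_value_def S_def[symmetric]
    by (intro rules) (use nz x in auto)
qed

lemma eval5_poly_in_x: "\<exists>p. \<forall>x. eval5 P a b c q x = poly p x"
proof (rule eval5_closed[where F = "\<lambda>f. \<exists>p. \<forall>x. f x = poly p x"])
  show const: "\<exists>p. \<forall>x. r = poly p x" for r :: complex by (rule exI[of _ "[:r:]"]) simp
  show "\<exists>p. \<forall>x. a = poly p x" "\<exists>p. \<forall>x. b = poly p x" "\<exists>p. \<forall>x. c = poly p x" "\<exists>p. \<forall>x. q = poly p x"
    by (rule const)+
  show "\<exists>p. \<forall>x :: complex. x = poly p x" by (rule exI[of _ "[:0, 1:]"]) simp
  fix f g :: "complex \<Rightarrow> complex"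
  assume "\<exists>p. \<forall>x. f x = poly p x" "\<exists>p. \<forall>x. g x = poly p x"
  thus "\<exists>p. \<forall>x. f x + g x = poly p x" "\<exists>p. \<forall>x. f x * g x = poly p x"
    by (metis poly_add, metis poly_mult)
qed

lemma isCont_phi21_shifted:
  assumes adm: "admissible a b c q" and x: "norm x < 1"
  shows "isCont (phi21 (a * q powi k) (b * q powi l) (c * q powi m) q) x"
proof -
  have "fps_conv_radius (hyp q (a * q powi k) (b * q powi l) (c * q powi m) 1) = 1"
    using admissibleD[OF adm] generic_shift[OF admissibleD(3,4)[OF adm]] by (intro hyp_conv_radius) auto
  moreover have "phi21 (a * q powi k) (b * q powi l) (c * q powi m) q
      = eval_fps (hyp q (a * q powi k) (b * q powi l) (c * q powi m) 1)"
    by (rule ext) (simp add: eval_hyp)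
  ultimately show ?thesis using x by (auto intro!: continuous_eval_fps simp: one_ereal_def)
qed

lemma isCont_phi21:
  assumes "admissible a b c q" "norm x < 1"
  shows "isCont (phi21 a b c q) x"
  using isCont_phi21_shifted[OF assms, of 0 0 0] by simp

text \<open>
  The value does not depend on the representation as a fraction.
\<close>

lemma has_value_value_at:
  assumes "has_value (Fract N D) a b c q x u"
    and "value_at D (a, b, c, q, x) \<noteq> 0"
  shows "u = value_at N (a, b, c, q, x) / value_at D (a, b, c, q, x)"
proof -
  obtain N' D' where 1: "Fract N D = Fract N' D'" "eval5 D' a b c q x \<noteq> 0" "u = eval5 N' a b c q x / eval5 D' a b c q x"
    using assms(1) unfolding has_value_def by blast
  have "D \<noteq> 0" "D' \<noteq> 0" using assms(2) 1(2) by (auto simp: value_at_simps eval5_simps)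
  hence "N * D' = N' * D" using 1(1) by (simp add: eq_fract)
  from arg_cong[OF this, of "\<lambda>P. eval5 P a b c q x"]
  have "eval5 N a b c q x * eval5 D' a b c q x = eval5 N' a b c q x * eval5 D a b c q x"
    by (simp add: eval5_simps)
  thus ?thesis using 1 assms(2) by (simp add: value_at_def frac_eq_eq)
qed

text \<open>
  The relation is required wherever \<open>Q\<close> and \<open>R\<close> have values, which may include points where the formulas break down
  but another representation of the fractions does not. These points are reached by continuity in \<open>x\<close>, since near a given
  \<open>x\<close> all but \<open>x\<close> itself satisfy the conditions of \<open>three_term_Q_R\<close>.
\<close>

lemma three_term_coeffs_exist:
  assumes kl: "k \<le> l"
  obtains Q R where "three_term_coeffs k l m Q R"
    "\<And>a b c q x. (a, b, c, q, x) \<in> Q_points k l m \<Longrightarrow> has_value Q a b c q x (Q_value k l m a b c q x)"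
    "\<And>a b c q x. (a, b, c, q, x) \<in> R_points k l m \<Longrightarrow> has_value R a b c q x (R_value k l m a b c q x)"
proof -
  obtain N D where Q: "\<And>p. p \<in> Q_points k l m \<Longrightarrow>
      value_at D p \<noteq> 0 \<and> Q_value k l m (pa p) (pb p) (pc p) (pq p) (px p) = value_at N p / value_at D p"
    using Q_rational[of k l m] unfolding rational_on_def by blast
  obtain M E where R: "\<And>p. p \<in> R_points k l m \<Longrightarrow>
      value_at E p \<noteq> 0 \<and> R_value k l m (pa p) (pb p) (pc p) (pq p) (px p) = value_at M p / value_at E p"
    using R_rational[of k l m] unfolding rational_on_def by blast
  have hQ: "has_value (Fract N D) a b c q x (Q_value k l m a b c q x)" if "(a, b, c, q, x) \<in> Q_points k l m" for a b c q x
    using Q[OF that] unfolding has_value_def value_at_def by auto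
  have hR: "has_value (Fract M E) a b c q x (R_value k l m a b c q x)" if "(a, b, c, q, x) \<in> R_points k l m" for a b c q x
    using R[OF that] unfolding has_value_def value_at_def by auto
  have "three_term_coeffs k l m (Fract N D) (Fract M E)"
    unfolding three_term_coeffs_def
  proof (intro allI impI, elim conjE)
    fix a b c q x u v
    assume adm: "admissible a b c q" and x: "norm x < 1"
      and u: "has_value (Fract N D) a b c q x u" and v: "has_value (Fract M E) a b c q x v"
    obtain N' D' where u': "Fract N D = Fract N' D'" "eval5 D' a b c q x \<noteq> 0" "u = eval5 N' a b c q x / eval5 D' a b c q x"
      using u unfolding has_value_def by blast
    obtain M' E' where v': "Fract M E = Fract M' E'" "eval5 E' a b c q x \<noteq> 0" "v = eval5 M' a b c q x / eval5 E' a b c q x"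
      using v unfolding has_value_def by blast
    obtain n' d' where n': "\<And>y. eval5 N' a b c q y = poly n' y" and d': "\<And>y. eval5 D' a b c q y = poly d' y"
      using eval5_poly_in_x by metis
    obtain m' e' where m': "\<And>y. eval5 M' a b c q y = poly m' y" and e': "\<And>y. eval5 E' a b c q y = poly e' y"
      using eval5_poly_in_x by metis
    define F G where "F = phi21 (a * q powi k) (b * q powi l) (c * q powi m) q"
      and "G = (\<lambda>y. poly n' y / poly d' y * phi21 (a * q) (b * q) (c * q) q y + poly m' y / poly e' y * phi21 a b c q y)"
    note ne = admissible_neq[OF adm]
    have "poly (qprod q (a * b * q / c) i) 0 = 1" for i
      by (induction i) (simp_all add: qprod_Suc)
    hence qp: "qprod q (a * b * q / c) i \<noteq> 0" for i by (metis poly_0 zero_neq_one)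
    have ev: "eventually (\<lambda>y. norm y < 1) (at x)"
      using x by (intro order_tendstoD(2)[of norm "norm x"] tendsto_intros) auto
    have "d' \<noteq> 0" "e' \<noteq> 0" using u'(2) v'(2) unfolding d' e' by auto
    note ev_de = this[THEN eventually_poly_neq_0, of x]
    have ev_c: "eventually (\<lambda>y. poly [:1, - (a * b / c):] y \<noteq> 0) (at x)"
      by (rule eventually_poly_neq_0) simp
    have "eventually (\<lambda>y. F y = G y) (at x)"
      using ev eventually_neq_at_within[of 0 x] ev_c
        eventually_poly_neq_0[OF qp, of "nat (max (k + l - m) 0 - 1)" x]
        eventually_poly_neq_0[OF qp, of "nat (max (k + l - m - 1) 0)" x]
        ev_de
    proof eventually_elim
      case (elim y)
      note d1 = elim(6,7)
      have y1: "a * b * y / c \<noteq> 1" using elim(3) by (auto simp: mult.commute)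
      have c1: "a * b * q / c * y = a * b * q * y / c" by simp
      have q2: "qpoch (a * b * q * y / c) q (max (k + l - m - 1) 0) \<noteq> 0"
        using elim(5) by (simp add: qpoch_qprod)
      have q1: "qpoch (a * b * q * y / c) q (max (k + l - m) 0 - 1) \<noteq> 0"
      proof (cases "k + l - m \<ge> 1")
        case True
        thus ?thesis using elim(4) by (simp add: qpoch_qprod)
      next
        case False
        hence "max (k + l - m) 0 - 1 = - 1" by simp
        moreover have "a * b * q * y / c / q = a * b * y / c" using ne by simp
        ultimately show ?thesis using y1 qpoch_neg_one[OF ne(1), of "a * b * q * y / c"] by simp
      qed
      have pQ: "(a, b, c, q, y) \<in> Q_points k l m" and pR: "(a, b, c, q, y) \<in> R_points k l m"
        using adm elim(2) q1 q2 by (auto simp: Q_points_def R_points_def)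
      have "has_value (Fract N D) a b c q y (poly n' y / poly d' y)"
        unfolding has_value_def u'(1) using d1(1) n' d' by metis
      from has_value_value_at[OF this] Q[OF pQ] have vQ: "poly n' y / poly d' y = Q_value k l m a b c q y" by simp
      have "has_value (Fract M E) a b c q y (poly m' y / poly e' y)"
        unfolding has_value_def v'(1) using d1(2) m' e' by metis
      from has_value_value_at[OF this] R[OF pR] have vR: "poly m' y / poly e' y = R_value k l m a b c q y" by simp
      show ?case unfolding F_def G_def vQ vR
        by (rule three_term_Q_R[OF adm elim(1) kl elim(2) y1 q1 q2])
    qed
    moreover have "isCont F x" unfolding F_def by (rule isCont_phi21_shifted[OF adm x])
    moreover have "isCont G x"
      unfolding G_def using u'(2) v'(2) isCont_phi21[OF adm x] isCont_phi21[OF admissible_shift[OF adm] x]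
      unfolding d' e' by (intro continuous_intros) auto
    ultimately have "(G \<longlongrightarrow> F x) (at x)" "(G \<longlongrightarrow> G x) (at x)"
      unfolding isCont_def using tendsto_cong[of F G "at x" "F x"] by simp_all
    hence "F x = G x" by (rule tendsto_unique[OF at_neq_bot])
    thus "phi21 (a * q powi k) (b * q powi l) (c * q powi m) q x =
        u * phi21 (a * q) (b * q) (c * q) q x + v * phi21 a b c q x"
      by (simp add: F_def G_def u'(3) v'(3) n' d' m' e')
  qed
  with hQ hR show ?thesis using that by blast
qed

lemma three_term_coeffs_unique:
  assumes 1: "three_term_coeffs k l m Q1 R1" and 2: "three_term_coeffs k l m Q2 R2"
  shows "Q1 = Q2" "R1 = R2"
proof -
  obtain N1 D1 where Q1: "Q1 = Fract N1 D1" "D1 \<noteq> 0" by (cases Q1)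
  obtain N2 D2 where Q2: "Q2 = Fract N2 D2" "D2 \<noteq> 0" by (cases Q2)
  obtain M1 E1 where R1: "R1 = Fract M1 E1" "E1 \<noteq> 0" by (cases R1)
  obtain M2 E2 where R2: "R2 = Fract M2 E2" "E2 \<noteq> 0" by (cases R2)
  \<comment> \<open>The factor \<open>Z\<close> makes the cleared relation valid also where a denominator vanishes.\<close>
  define Z where "Z = D1 * D2 * (E1 * E2)"
  define X Y where "X = (N1 * D2 - N2 * D1) * (E1 * E2) * Z" and "Y = (M1 * E2 - M2 * E1) * (D1 * D2) * Z"
  have rel: "eval5 X a b c q x * phi21 (a * q) (b * q) (c * q) q x + eval5 Y a b c q x * phi21 a b c q x = 0"
    if adm: "admissible a b c q" and x: "norm x < 1" for a b c q x
  proof (cases "eval5 Z a b c q x = 0")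
    case True
    thus ?thesis by (simp add: X_def Y_def eval5_simps)
  next
    case False
    define e where "e = (\<lambda>P. eval5 P a b c q x)"
    define F F1 F0 where "F = phi21 (a * q powi k) (b * q powi l) (c * q powi m) q x"
      and "F1 = phi21 (a * q) (b * q) (c * q) q x" and "F0 = phi21 a b c q x"
    have nz: "e D1 \<noteq> 0" "e D2 \<noteq> 0" "e E1 \<noteq> 0" "e E2 \<noteq> 0"
      using False by (auto simp: e_def Z_def eval5_simps)
    have hv: "has_value (Fract N D) a b c q x (e N / e D)" if "e D \<noteq> 0" for N D
      using that unfolding has_value_def e_def by blast
    have "F = e N1 / e D1 * F1 + e M1 / e E1 * F0"
      using 1 adm x hv[OF nz(1)] hv[OF nz(3)] unfolding three_term_coeffs_def Q1 R1 F_def F1_def F0_def by blast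
    moreover have "F = e N2 / e D2 * F1 + e M2 / e E2 * F0"
      using 2 adm x hv[OF nz(2)] hv[OF nz(4)] unfolding three_term_coeffs_def Q2 R2 F_def F1_def F0_def by blast
    ultimately have "(e N1 / e D1 - e N2 / e D2) * F1 + (e M1 / e E1 - e M2 / e E2) * F0 = 0"
      by (simp add: algebra_simps)
    moreover have "e N1 / e D1 - e N2 / e D2 = (e N1 * e D2 - e N2 * e D1) / (e D1 * e D2)"
      "e M1 / e E1 - e M2 / e E2 = (e M1 * e E2 - e M2 * e E1) / (e E1 * e E2)"
      using nz by (simp_all add: diff_frac_eq)
    ultimately have "(e N1 * e D2 - e N2 * e D1) / (e D1 * e D2) * F1 + (e M1 * e E2 - e M2 * e E1) / (e E1 * e E2) * F0 = 0"
      by simp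
    moreover have "e X * F1 + e Y * F0 = e Z * (e D1 * e D2 * (e E1 * e E2)) *
      ((e N1 * e D2 - e N2 * e D1) / (e D1 * e D2) * F1 + (e M1 * e E2 - e M2 * e E1) / (e E1 * e E2) * F0)"
    proof -
      have "e X = (e N1 * e D2 - e N2 * e D1) * (e E1 * e E2) * e Z" "e Y = (e M1 * e E2 - e M2 * e E1) * (e D1 * e D2) * e Z"
        by (simp_all add: e_def X_def Y_def eval5_simps)
      moreover have "s * r * z * F1 + t * w * z * F0 = z * (w * r) * (s / w * F1 + t / r * F0)"
        if "w \<noteq> 0" "r \<noteq> 0" for s t r w z :: complex
        using that by (simp add: field_simps)
      ultimately show ?thesis using nz by simp
    qed
    ultimately show ?thesis by (simp add: e_def F1_def F0_def)
  qed
  have "X = 0" "Y = 0" using basic_functions_independent[OF rel] by blast+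
  moreover have "Z \<noteq> 0" using Q1 Q2 R1 R2 by (simp add: Z_def)
  ultimately have "N1 * D2 = N2 * D1" "M1 * E2 = M2 * E1" using Q1 Q2 R1 R2 by (auto simp: X_def Y_def)
  thus "Q1 = Q2" "R1 = R2" using Q1 Q2 R1 R2 by (simp_all add: eq_fract)
qed

theorem theorem2:
  fixes k l m :: int
  assumes "k \<le> l"
  shows
    "(\<exists>!QR. three_term_coeffs k l m (fst QR) (snd QR)) \<and>
     (\<forall>Q R. three_term_coeffs k l m Q R \<longrightarrow>
       (\<forall>a b c q x. admissible a b c q \<longrightarrow>
          ((x \<noteq> 0 \<or> m \<le> 1) \<and> qpoch (a * b * q * x / c) q (max (k + l - m) 0 - 1) \<noteq> 0 \<longrightarrow>
            has_value Q a b c q x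
              (- ((1 - a) * (1 - b) * c / ((q - c) * (1 - c)))
               * (x powi (1 - max m 0) / qpoch (a * b * q * x / c) q (max (k + l - m) 0 - 1))
               * poly (P_poly k l m a b c q) x)) \<and>
          ((x \<noteq> 0 \<or> m \<le> 1) \<and> qpoch (a * b * q * x / c) q (max (k + l - m - 1) 0) \<noteq> 0 \<longrightarrow>
            has_value R a b c q x
              (- (x powi (- max (m - 1) 0) / qpoch (a * b * q * x / c) q (max (k + l - m - 1) 0))
               * poly (P_poly (k - 1) (l - 1) (m - 1) (a * q) (b * q) (c * q) q) x))))"
proof -
  obtain Q R where QR: "three_term_coeffs k l m Q R"
    "\<And>a b c q x. (a, b, c, q, x) \<in> Q_points k l m \<Longrightarrow> has_value Q a b c q x (Q_value k l m a b c q x)"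
    "\<And>a b c q x. (a, b, c, q, x) \<in> R_points k l m \<Longrightarrow> has_value R a b c q x (R_value k l m a b c q x)"
    using three_term_coeffs_exist[OF assms] by blast
  have uni: "Q' = Q \<and> R' = R" if "three_term_coeffs k l m Q' R'" for Q' R'
    using three_term_coeffs_unique[OF that QR(1)] by simp
  show ?thesis
  proof (intro conjI allI impI)
    show "\<exists>!QR. three_term_coeffs k l m (fst QR) (snd QR)"
    proof (rule ex1I[of _ "(Q, R)"])
      fix QR' assume "three_term_coeffs k l m (fst QR') (snd QR')"
      from uni[OF this] show "QR' = (Q, R)" by (simp add: prod_eq_iff)
    qed (use QR(1) in simp)
  next
    fix Q' R' a b c q x
    assume "three_term_coeffs k l m Q' R'" "admissible a b c q"
      "(x \<noteq> 0 \<or> m \<le> 1) \<and> qpoch (a * b * q * x / c) q (max (k + l - m) 0 - 1) \<noteq> 0"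
    thus "has_value Q' a b c q x
              (- ((1 - a) * (1 - b) * c / ((q - c) * (1 - c)))
               * (x powi (1 - max m 0) / qpoch (a * b * q * x / c) q (max (k + l - m) 0 - 1))
               * poly (P_poly k l m a b c q) x)"
      using QR(2)[of a b c q x] uni[of Q' R'] unfolding Q_points_def Q_value_def by auto
  next
    fix Q' R' a b c q x
    assume "three_term_coeffs k l m Q' R'" "admissible a b c q"
      "(x \<noteq> 0 \<or> m \<le> 1) \<and> qpoch (a * b * q * x / c) q (max (k + l - m - 1) 0) \<noteq> 0"
    thus "has_value R' a b c q x
              (- (x powi (- max (m - 1) 0) / qpoch (a * b * q * x / c) q (max (k + l - m - 1) 0))
               * poly (P_poly (k - 1) (l - 1) (m - 1) (a * q) (b * q) (c * q) q) x)"
      using QR(3)[of a b c q x] uni[of Q' R'] unfolding R_points_def R_value_def by auto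
  qed
qed

end
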